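(* Let $m\ge 1$, $n\ge 0$ and $k\ge 0$ be integers and let $M=m-2n$. Put $$\tilde B_k=\{0,1,\ldots,k\}\cap I_{M-1},\qquad B_k^0=\{3-M-\ell\mid \ell\in\tilde B_k\},\qquad B_k=\{0,1,\ldots,k\}\setminus(\tilde B_k\cup B_k^0).$$ Then, under the action of $\mathfrak{osp}(m-1|2n)$, the space $\mathcal H_k=\mathcal H_k(\mathbb R^{m|2n})$ of $k$-homogeneous spherical harmonics has the indecomposable decomposition $$\mathcal H_k\simeq\bigoplus_{\ell\in\tilde B_k}\underline{\tilde{\mathcal H}}_\ell\ \oplus\ \bigoplus_{\ell\in B_k}\underline{\mathcal H}_\ell ,$$ where $\underline{\mathcal H}_\ell=\mathcal H_\ell(\mathbb R^{m-1|2n})$ and $\underline{\tilde{\mathcal H}}_\ell=\tilde{\mathcal H}_\ell(\mathbb R^{m-1|2n})$.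
   Context: For integers $m,n\ge0$, let $\mathcal P=\mathcal P(\mathbb R^{m|2n})=\mathbb R[x_1,\ldots,x_m]\otimes\Lambda(\theta_1,\ldots,\theta_{2n})$ be the superalgebra of polynomials on $\mathbb R^{m|2n}$: $x_1,\dots,x_m$ are commuting (even) variables and $\theta_1,\dots,\theta_{2n}$ are anticommuting (odd) variables generating the Grassmann algebra $\Lambda$. Write $X=(X_1,\ldots,X_{m+2n})=(x_1,\ldots,x_m,\theta_1,\ldots,\theta_{2n})$. The partial derivatives $\partial_{X_i}$ are the superderivations of $\mathcal P$ satisfying the supercommutation relations $[\partial_{X_i},X_j]=\delta_{ij}$. $\mathcal P_k$ denotes the subspace of polynomials homogeneous of total degree $k$ in all the variables $x_i,\theta_j$, and $\mathcal P_k=0$ for $k<0$. Put $$\Delta=\sum_{j=1}^m\partial_{x_j}^2-4\sum_{j=1}^n\partial_{\theta_{2j-1}}\partial_{\theta_{2j}},\qquad R^2=\sum_{j=1}^m x_j^2-\sum_{j=1}^n\theta_{2j-1}\theta_{2j}.$$ The spherical harmonics and generalized spherical harmonics of degree $k$ are $$\mathcal H_k(\mathbb R^{m|2n})=\{P\in\mathcal P_k\mid\Delta P=0\},\qquad \tilde{\mathcal H}_k(\mathbb R^{m|2n})=\{P\in\mathcal P_k\mid \Delta R^2\Delta P=0\}$$ ($R^2$ acting by multiplication). $M=m-2n$ is the superdimension of $\mathbb R^{m|2n}$; that of $\mathbb R^{m-1|2n}$ is $M-1$. For an integer $N$, the set of exceptional indices is $I_N=\{\ell\in\mathbb N_0\mid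 2-N/2\le \ell\le 2-N\}$ if $N\in-2\mathbb N_0=\{0,-2,-4,\ldots\}$, and $I_N=\emptyset$ otherwise. The orthosymplectic Lie superalgebra $\mathfrak{osp}(m|2n)$, with its natural action on $\mathcal P(\mathbb R^{m|2n})$, is realized as the Lie superalgebra of superderivations of $\mathcal P(\mathbb R^{m|2n})$ that map the linear span of the coordinates $X_1,\ldots,X_{m+2n}$ to itself and annihilate $R^2$; the operators $\Delta$ and $R^2$ are invariant under it. Identifying $\mathbb R^{m-1|2n}$ with the hyperplane $x_m=0$ (coordinates $x_1,\dots,x_{m-1},\theta_1,\dots,\theta_{2n}$), $\mathfrak{osp}(m-1|2n)$ acts on $\mathcal P(\mathbb R^{m|2n})=\mathcal P(\mathbb R^{m-1|2n})\otimes\mathbb R[x_m]$ by the extensions of its superderivations that annihilate $x_m$; this is the restriction of the action of $\mathfrak{osp}(m|2n)$ to a subalgebra. The symbol $\simeq$ means isomorphism of $\mathfrak{osp}(m-1|2n)$-modules. "Indecomposable decomposition" means that the summands are indecomposable modules (some summands may be zero and are then to be ignored). *)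

theory Defs
  imports
    Complex_Main
    "HOL-Library.FuncSet"
    "HOL-Library.FSet"
    "HOL-Library.Poly_Mapping"
begin

section \<open>Superpolynomials\<close>

instantiation poly_mapping :: (type, real_vector) real_vector
begin

lift_definition scaleR_poly_mapping :: "real \<Rightarrow> ('a \<Rightarrow>\<^sub>0 'b) \<Rightarrow> ('a \<Rightarrow>\<^sub>0 'b)"
  is "\<lambda>r f x. r *\<^sub>R f x"
  by (rule finite_subset[rotated]) auto

instance
  by standard (transfer; simp add: fun_eq_iff scaleR_add_right scaleR_add_left)+

end

text \<open>
  The pair \<open>(a, S)\<close> stands for the monomial
  \<open>\<Prod>\<^sub>i x\<^sub>i\<^bsup>a i\<^esup> \<cdot> \<theta>\<^bsub>s\<^sub>1\<^esub> \<cdots> \<theta>\<^bsub>s\<^sub>r\<^esub>\<close> with \<open>S = {s\<^sub>1 < \<dots> < s\<^sub>r}\<close>. The type below has countably many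
  even and odd variables; the algebras with finitely many variables are subalgebras of it.
\<close>

type_synonym smono = "(nat \<Rightarrow>\<^sub>0 nat) \<times> nat fset"

typedef spoly = "UNIV :: (smono \<Rightarrow>\<^sub>0 real) set"
  morphisms coeffs Spoly ..

setup_lifting type_definition_spoly

instantiation spoly :: real_vector
begin
lift_definition zero_spoly :: spoly is 0 .
lift_definition plus_spoly :: "spoly \<Rightarrow> spoly \<Rightarrow> spoly" is "(+)" .
lift_definition minus_spoly :: "spoly \<Rightarrow> spoly \<Rightarrow> spoly" is "(-)" .
lift_definition uminus_spoly :: "spoly \<Rightarrow> spoly" is "uminus" .
lift_definition scaleR_spoly :: "real \<Rightarrow> spoly \<Rightarrow> spoly" is "scaleR" .
instance
  by standard (transfer; simp add: scaleR_add_right scaleR_add_left add.assoc)+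
end

definition coeff :: "spoly \<Rightarrow> smono \<Rightarrow> real" where
  "coeff f = Poly_Mapping.lookup (coeffs f)"

definition supp :: "spoly \<Rightarrow> smono set" where
  "supp f = Poly_Mapping.keys (coeffs f)"

definition mon :: "smono \<Rightarrow> spoly" where
  "mon u = Spoly (Poly_Mapping.single u 1)"

lemma spoly_eqI: "(\<And>u. coeff f u = coeff g u) \<Longrightarrow> f = g"
  by (metis coeff_def coeffs_inject poly_mapping_eqI)

lemma coeff_simps [simp]:
  "coeff 0 u = 0" "coeff (f + g) u = coeff f u + coeff g u"
  "coeff (f - g) u = coeff f u - coeff g u" "coeff (- f) u = - coeff f u"
  "coeff (c *\<^sub>R f) u = c * coeff f u"
  by (simp_all add: coeff_def zero_spoly.rep_eq plus_spoly.rep_eq minus_spoly.rep_eq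
      uminus_spoly.rep_eq scaleR_spoly.rep_eq lookup_add lookup_minus scaleR_poly_mapping.rep_eq)

lemma coeff_mon: "coeff (mon v) u = (if u = v then 1 else 0)"
  by (simp add: coeff_def mon_def Spoly_inverse lookup_single when_def)

lemma supp_iff: "u \<in> supp f \<longleftrightarrow> coeff f u \<noteq> 0"
  by (simp add: coeff_def supp_def in_keys_iff)

lemma finite_supp [simp]: "finite (supp f)"
  by (simp add: supp_def)

lemma supp_mon [simp]: "supp (mon u) = {u}"
  by (auto simp: supp_iff coeff_mon split: if_splits)

lemma mon_nz [simp]: "mon u \<noteq> 0"
  using coeff_mon[of u u] by (metis coeff_simps(1) zero_neq_one)

lemma coeff_sum: "coeff (sum g A) u = (\<Sum>x\<in>A. coeff (g x) u)"
  by (induction A rule: infinite_finite_induct) auto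

definition lin_ext :: "(smono \<Rightarrow> 'v::real_vector) \<Rightarrow> spoly \<Rightarrow> 'v" where
  "lin_ext g f = (\<Sum>u\<in>supp f. coeff f u *\<^sub>R g u)"

lemma lin_ext_superset:
  assumes "finite A" "supp f \<subseteq> A"
  shows "lin_ext g f = (\<Sum>u\<in>A. coeff f u *\<^sub>R g u)"
  unfolding lin_ext_def using assms by (intro sum.mono_neutral_left) (auto simp: supp_iff)

lemma linear_lin_ext: "linear (lin_ext g)"
proof (rule linearI)
  fix f h :: spoly and c :: real
  let ?A = "supp f \<union> supp h"
  have "lin_ext g (f + h) = (\<Sum>u\<in>?A. coeff (f + h) u *\<^sub>R g u)"
    by (rule lin_ext_superset) (auto simp: supp_iff)
  also have "\<dots> = (\<Sum>u\<in>?A. coeff f u *\<^sub>R g u) + (\<Sum>u\<in>?A. coeff h u *\<^sub>R g u)"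
    by (simp add: scaleR_add_left sum.distrib)
  also have "\<dots> = lin_ext g f + lin_ext g h"
    by (subst (1 2) lin_ext_superset[where A = ?A]) auto
  finally show "lin_ext g (f + h) = lin_ext g f + lin_ext g h" .
  have "lin_ext g (c *\<^sub>R f) = (\<Sum>u\<in>supp f. coeff (c *\<^sub>R f) u *\<^sub>R g u)"
    by (rule lin_ext_superset) (auto simp: supp_iff)
  also have "\<dots> = c *\<^sub>R lin_ext g f"
    by (simp add: lin_ext_def scaleR_sum_right)
  finally show "lin_ext g (c *\<^sub>R f) = c *\<^sub>R lin_ext g f" .
qed

lemma lin_ext_mon [simp]: "lin_ext g (mon u) = g u"
  by (simp add: lin_ext_def coeff_mon)

lemma lin_ext_id: "lin_ext mon f = f"
  by (rule spoly_eqI)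
    (simp add: lin_ext_def coeff_sum coeff_mon supp_iff if_distrib[of "\<lambda>x. _ * x"] cong: if_cong)

lemma linear_eq_on_supp:
  assumes "linear F" "linear G" "\<And>u. u \<in> supp f \<Longrightarrow> F (mon u) = G (mon u)"
  shows "F f = (G f :: 'v::real_vector)"
proof -
  have "H f = (\<Sum>u\<in>supp f. coeff f u *\<^sub>R H (mon u))" if "linear H" for H :: "spoly \<Rightarrow> 'v"
    using that
    by (subst (1) lin_ext_id[symmetric, of f])
       (simp add: lin_ext_def linear_sum linear_scale)
  from this[OF assms(1)] this[OF assms(2)] assms(3) show ?thesis by simp
qed

lemma linear_lin_ext_fun:
  assumes "\<And>u. linear (\<lambda>h. g h u)"
  shows "linear (\<lambda>h. lin_ext (g h) f)"
  unfolding lin_ext_def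
  by (rule linearI)
    (simp_all only: linear_add[OF assms] linear_scale[OF assms] sum.distrib scaleR_add_right
      scaleR_sum_right scaleR_left_commute)

definition inversions :: "nat fset \<Rightarrow> nat fset \<Rightarrow> nat" where
  "inversions S T = card {(s, t). s |\<in>| S \<and> t |\<in>| T \<and> t < s}"

fun mono_mult :: "smono \<Rightarrow> smono \<Rightarrow> spoly" where
  "mono_mult (a, S) (b, T) =
     (if S |\<inter>| T = {||} then (-1) ^ inversions S T *\<^sub>R mon (a + b, S |\<union>| T) else 0)"

definition below :: "nat fset \<Rightarrow> nat \<Rightarrow> nat" where
  "below S j = card {s. s |\<in>| S \<and> s < j}"

definition above :: "nat fset \<Rightarrow> nat \<Rightarrow> nat" where
  "above S j = card {s. s |\<in>| S \<and> j < s}"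

lemma finite_inv: "finite {(s, t). s |\<in>| S \<and> t |\<in>| T \<and> t < s}"
  by (rule finite_subset[of _ "fset S \<times> fset T"]) auto

lemma inversions_union_left:
  assumes "S |\<inter>| T = {||}"
  shows "inversions (S |\<union>| T) U = inversions S U + inversions T U"
proof -
  have "{(s, t). s |\<in>| S |\<union>| T \<and> t |\<in>| U \<and> t < s}
     = {(s, t). s |\<in>| S \<and> t |\<in>| U \<and> t < s} \<union> {(s, t). s |\<in>| T \<and> t |\<in>| U \<and> t < s}" by auto
  moreover have "{(s, t). s |\<in>| S \<and> t |\<in>| U \<and> t < s} \<inter> {(s, t). s |\<in>| T \<and> t |\<in>| U \<and> t < s} = {}"
    using assms by fastforce
  ultimately show ?thesis unfolding inversions_def by (simp add: card_Un_disjoint finite_inv)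
qed

lemma inversions_union_right:
  assumes "T |\<inter>| U = {||}"
  shows "inversions S (T |\<union>| U) = inversions S T + inversions S U"
proof -
  have "{(s, t). s |\<in>| S \<and> t |\<in>| T |\<union>| U \<and> t < s}
     = {(s, t). s |\<in>| S \<and> t |\<in>| T \<and> t < s} \<union> {(s, t). s |\<in>| S \<and> t |\<in>| U \<and> t < s}" by auto
  moreover have "{(s, t). s |\<in>| S \<and> t |\<in>| T \<and> t < s} \<inter> {(s, t). s |\<in>| S \<and> t |\<in>| U \<and> t < s} = {}"
    using assms by fastforce
  ultimately show ?thesis unfolding inversions_def by (simp add: card_Un_disjoint finite_inv)
qed

lemma inversions_singleton_left: "inversions {|j|} T = below T j"
proof -
  have "{(s, t). s |\<in>| {|j|} \<and> t |\<in>| T \<and> t < s} = Pair j ` {t. t |\<in>| T \<and> t < j}" by auto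
  then show ?thesis unfolding inversions_def below_def by (simp add: card_image inj_on_def)
qed

lemma inversions_singleton_right: "inversions S {|j|} = above S j"
proof -
  have "{(s, t). s |\<in>| S \<and> t |\<in>| {|j|} \<and> t < s} = (\<lambda>s. (s, j)) ` {t. t |\<in>| S \<and> j < t}" by auto
  then show ?thesis unfolding inversions_def above_def by (simp add: card_image inj_on_def)
qed

lemma inversions_empty [simp]: "inversions {||} T = 0" "inversions S {||} = 0"
  by (auto simp: inversions_def)

instantiation spoly :: real_algebra_1
begin

definition one_spoly :: spoly where "one_spoly = mon (0, {||})"

definition times_spoly :: "spoly \<Rightarrow> spoly \<Rightarrow> spoly" where
  "times_spoly f g = lin_ext (\<lambda>u. lin_ext (mono_mult u) g) f"

instance
proof
  have lin1: "linear (\<lambda>f. f * g)" for g :: spoly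
    unfolding times_spoly_def by (rule linear_lin_ext)
  have lin2: "linear (\<lambda>g. f * g)" for f :: spoly
    unfolding times_spoly_def by (rule linear_lin_ext_fun) (rule linear_lin_ext)
  have mm: "mon u * mon v = mono_mult u v" for u v
    by (simp add: times_spoly_def)
  have s1: "(c *\<^sub>R f) * g = c *\<^sub>R (f * g)" for c and f g :: spoly
    by (rule linear_scale[OF lin1])
  have s2: "f * (c *\<^sub>R g) = c *\<^sub>R (f * g)" for c and f g :: spoly
    by (rule linear_scale[OF lin2])
  fix f g h :: spoly and c :: real
  show "(f + g) * h = f * h + g * h" by (rule linear_add[OF lin1])
  show "f * (g + h) = f * g + f * h" by (rule linear_add[OF lin2])
  show "(c *\<^sub>R f) * g = c *\<^sub>R (f * g)" by (rule s1)
  show "f * (c *\<^sub>R g) = c *\<^sub>R (f * g)" by (rule s2)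
  have z: "0 * g = 0" "g * 0 = 0" for g :: spoly
    using linear_0[OF lin1] linear_0[OF lin2] by auto
  show "(0::spoly) \<noteq> 1" by (simp add: one_spoly_def not_sym[OF mon_nz] mon_nz[symmetric])
  show "1 * f = f"
    by (rule linear_eq_on_supp[OF lin2 linear_id[unfolded id_def]])
       (auto simp: one_spoly_def mm)
  show "f * 1 = f"
    by (rule linear_eq_on_supp[OF lin1 linear_id[unfolded id_def]])
       (auto simp: one_spoly_def mm)
  have a1: "(mon u * mon v) * mon w = mon u * (mon v * mon w)" for u v w
  proof -
    obtain a S b T c U where uvw: "u = (a, S)" "v = (b, T)" "w = (c, U)" by (metis surj_pair)
    show ?thesis
    proof (cases "S |\<inter>| T = {||} \<and> S |\<inter>| U = {||} \<and> T |\<inter>| U = {||}")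
      case True
      then have "(S |\<union>| T) |\<inter>| U = {||}" "S |\<inter>| (T |\<union>| U) = {||}" by auto
      with True show ?thesis unfolding uvw
        by (simp add: mm s1 s2 inversions_union_left inversions_union_right power_add
            ac_simps sup_assoc)
    next
      case False
      then have "mon u * mon v = 0 \<or> (S |\<union>| T) |\<inter>| U \<noteq> {||}"
        "mon v * mon w = 0 \<or> S |\<inter>| (T |\<union>| U) \<noteq> {||}"
        "S |\<inter>| T \<noteq> {||} \<or> (S |\<union>| T) |\<inter>| U \<noteq> {||}"
        "T |\<inter>| U \<noteq> {||} \<or> S |\<inter>| (T |\<union>| U) \<noteq> {||}"
        unfolding uvw by (auto simp: mm)
      then show ?thesis unfolding uvw by (auto simp: mm s1 s2 z)
    qed
  qed
  have a2: "(f * mon v) * mon w = f * (mon v * mon w)" for f v w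
    by (rule linear_eq_on_supp[of "\<lambda>f. (f * mon v) * mon w" "\<lambda>f. f * (mon v * mon w)"])
       (auto intro: linear_compose[OF lin1 lin1, unfolded o_def] lin1 a1)
  have a3: "(f * g) * mon w = f * (g * mon w)" for f g w
    by (rule linear_eq_on_supp[of "\<lambda>g. (f * g) * mon w" "\<lambda>g. f * (g * mon w)"])
       (auto intro: linear_compose[OF lin2 lin1, unfolded o_def]
           linear_compose[OF lin1 lin2, unfolded o_def] a2)
  show "(f * g) * h = f * (g * h)"
    by (rule linear_eq_on_supp[of "\<lambda>h. (f * g) * h" "\<lambda>h. f * (g * h)"])
       (auto intro: lin2 linear_compose[OF lin2 lin2, unfolded o_def] a3)
qed

end

lemma mon_mult: "mon u * mon v = mono_mult u v"
  by (simp add: times_spoly_def)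

text \<open>
  Parities are natural numbers read modulo 2. The set \<open>superpolys m n\<close> is
  \<open>\<P>(\<real>\<^bsup>m|2n\<^esup>)\<close> in the variables
  \<open>x\<^sub>1, \<dots>, x\<^sub>m, \<theta>\<^sub>1, \<dots>, \<theta>\<^sub>2\<^sub>n\<close>.
\<close>

definition super_part :: "nat \<Rightarrow> spoly set" where
  "super_part p = {f. \<forall>(a, S) \<in> supp f. even (fcard S) = even p}"

definition superpolys :: "nat \<Rightarrow> nat \<Rightarrow> spoly set" where
  "superpolys m n = {f. \<forall>(a, S) \<in> supp f. Poly_Mapping.keys a \<subseteq> {1..m} \<and> fset S \<subseteq> {1..2 * n}}"

definition homogeneous :: "nat \<Rightarrow> nat \<Rightarrow> nat \<Rightarrow> spoly set" where
  "homogeneous m n k =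
     {f \<in> superpolys m n. \<forall>(a, S) \<in> supp f.
        (\<Sum>i\<in>Poly_Mapping.keys a. Poly_Mapping.lookup a i) + fcard S = k}"

definition x_var :: "nat \<Rightarrow> spoly" where
  "x_var i = mon (Poly_Mapping.single i 1, {||})"

definition th_var :: "nat \<Rightarrow> spoly" where
  "th_var j = mon (0, {|j|})"

section \<open>Superderivations\<close>

definition linear_on :: "'a::real_vector set \<Rightarrow> ('a \<Rightarrow> 'b::real_vector) \<Rightarrow> bool" where
  "linear_on A D \<longleftrightarrow>
     (\<forall>f\<in>A. \<forall>g\<in>A. D (f + g) = D f + D g) \<and> (\<forall>c. \<forall>f\<in>A. D (c *\<^sub>R f) = c *\<^sub>R D f)"

definition hom_superderivation :: "spoly set \<Rightarrow> nat \<Rightarrow> (spoly \<Rightarrow> spoly) \<Rightarrow> bool" where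
  "hom_superderivation A p D \<longleftrightarrow>
     D \<in> A \<rightarrow> A \<and> linear_on A D \<and>
     (\<forall>q. D \<in> A \<inter> super_part q \<rightarrow> super_part (p + q)) \<and>
     (\<forall>q. \<forall>f \<in> A \<inter> super_part q. \<forall>g \<in> A.
        D (f * g) = D f * g + (-1) ^ (p * q) *\<^sub>R (f * D g))"

text \<open>
  Operators on a subspace \<open>A\<close> are total functions; \<open>extensional A\<close> makes the
  representation by such a function unique.
\<close>

definition superderivation :: "spoly set \<Rightarrow> (spoly \<Rightarrow> spoly) \<Rightarrow> bool" where
  "superderivation A D \<longleftrightarrow> D \<in> extensional A \<and>
     (\<exists>D0 D1. hom_superderivation A 0 D0 \<and> hom_superderivation A 1 D1 \<and>
        (\<forall>f\<in>A. D f = D0 f + D1 f))"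

definition d_x :: "nat \<Rightarrow> spoly \<Rightarrow> spoly" where
  "d_x i = lin_ext (\<lambda>(a, S).
     real (Poly_Mapping.lookup a i) *\<^sub>R mon (a - Poly_Mapping.single i 1, S))"

definition d_th :: "nat \<Rightarrow> spoly \<Rightarrow> spoly" where
  "d_th j = lin_ext (\<lambda>(a, S).
     if j |\<in>| S then (-1) ^ below S j *\<^sub>R mon (a, S |-| {|j|}) else 0)"

lemma linear_mult: "linear (\<lambda>f::spoly. f * g)" "linear (\<lambda>f::spoly. g * f)"
  by (auto intro!: linearI simp: algebra_simps)

lemma supp_add: "supp (f + g) \<subseteq> supp f \<union> supp g"
  and supp_scaleR: "supp (c *\<^sub>R f) \<subseteq> supp f"
  and supp_0 [simp]: "supp 0 = {}"
  by (auto simp: supp_iff)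

lemma subspace_supp: "subspace {f. supp f \<subseteq> Q}"
  unfolding subspace_def using supp_add supp_scaleR by auto blast+

lemma super_part_alt: "super_part p = {f. supp f \<subseteq> {u. even (fcard (snd u)) = even p}}"
  by (auto simp: super_part_def)

lemma superpolys_alt:
  "superpolys m n = {f. supp f \<subseteq> {u. Poly_Mapping.keys (fst u) \<subseteq> {1..m} \<and> fset (snd u) \<subseteq> {1..2 * n}}}"
  unfolding superpolys_def subset_iff by (auto simp: case_prod_unfold)

lemma subspace_super_part: "subspace (super_part p)"
  unfolding super_part_alt by (rule subspace_supp)

lemma subspace_superpolys: "subspace (superpolys m n)"
  unfolding superpolys_alt by (rule subspace_supp)

lemma super_part_cong: "even p = even q \<Longrightarrow> super_part p = super_part q"
  by (simp add: super_part_def)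

lemma subspace_linear_image:
  assumes "linear F" "subspace V" "\<And>u. u \<in> supp f \<Longrightarrow> F (mon u) \<in> V"
  shows "F f \<in> V"
proof -
  have "F f = (\<Sum>u\<in>supp f. coeff f u *\<^sub>R F (mon u))"
    by (subst (1) lin_ext_id[symmetric, of f])
      (simp add: lin_ext_def linear_sum[OF assms(1)] linear_scale[OF assms(1)])
  then show ?thesis using assms by (auto intro!: subspace_sum subspace_scale)
qed

lemma mon_super_part: "mon u \<in> super_part p \<longleftrightarrow> even (fcard (snd u)) = even p"
  by (simp add: super_part_alt)

lemma hom_superderivationI:
  assumes A: "A = {f. supp f \<subseteq> Q}"
    and lin: "linear D"
    and D: "\<And>u. u \<in> Q \<Longrightarrow> D (mon u) \<in> A \<inter> super_part (p + fcard (snd u))"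
    and leib: "\<And>u v. u \<in> Q \<Longrightarrow> v \<in> Q \<Longrightarrow> D (mon u * mon v) =
      D (mon u) * mon v + (-1) ^ (p * fcard (snd u)) *\<^sub>R (mon u * D (mon v))"
  shows "hom_superderivation A p D"
  unfolding hom_superderivation_def
proof (intro conjI allI ballI)
  note lins = linear_compose[OF lin linear_mult(1), unfolded o_def]
    linear_compose[OF linear_mult(1) lin, unfolded o_def]
    linear_compose[OF lin linear_mult(2), unfolded o_def]
    linear_compose[OF linear_mult(2) lin, unfolded o_def]
    linear_compose_add[OF linear_compose[OF lin linear_mult(1), unfolded o_def]
      linear_compose_scale_right[OF linear_mult(1)]]
    linear_compose_add[OF linear_mult(2)
      linear_compose_scale_right[OF linear_compose[OF lin linear_mult(2), unfolded o_def]]]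
  show "D \<in> A \<rightarrow> A"
  proof
    fix f assume f: "f \<in> A"
    show "D f \<in> A"
      by (rule subspace_linear_image[OF lin]) (use f D in \<open>auto simp: A subspace_supp\<close>)
  qed
  show "linear_on A D"
    by (simp add: linear_on_def linear_add[OF lin] linear_scale[OF lin])
  show "D \<in> A \<inter> super_part q \<rightarrow> super_part (p + q)" for q
  proof
    fix f assume f: "f \<in> A \<inter> super_part q"
    show "D f \<in> super_part (p + q)"
    proof (rule subspace_linear_image[OF lin subspace_super_part])
      fix u assume "u \<in> supp f"
      then have "u \<in> Q" "even (fcard (snd u)) = even q" using f by (auto simp: A super_part_alt)
      then show "D (mon u) \<in> super_part (p + q)"
        using D[of u] super_part_cong[of "p + fcard (snd u)" "p + q"] by auto
    qed
  qed
  fix q f g assume f: "f \<in> A \<inter> super_part q" and g: "g \<in> A"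
  show "D (f * g) = D f * g + (- 1) ^ (p * q) *\<^sub>R (f * D g)"
  proof (rule linear_eq_on_supp[of "\<lambda>f. D (f * g)" "\<lambda>f. D f * g + (- 1) ^ (p * q) *\<^sub>R (f * D g)"])
    fix u assume "u \<in> supp f"
    then have u: "u \<in> Q" "even (fcard (snd u)) = even q" using f by (auto simp: A super_part_alt)
    have s: "(- 1) ^ (p * q) = ((-1) ^ (p * fcard (snd u)) :: real)"
      using u(2) by (simp add: minus_one_power_iff)
    show "D (mon u * g) = D (mon u) * g + (- 1) ^ (p * q) *\<^sub>R (mon u * D g)"
    proof (rule linear_eq_on_supp[of "\<lambda>g. D (mon u * g)"
          "\<lambda>g. D (mon u) * g + (- 1) ^ (p * q) *\<^sub>R (mon u * D g)"])
      fix v assume "v \<in> supp g"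
      then have "v \<in> Q" using g by (auto simp: A)
      then show "D (mon u * mon v) = D (mon u) * mon v + (- 1) ^ (p * q) *\<^sub>R (mon u * D (mon v))"
        unfolding s using leib u by blast
    qed (rule lins)+
  qed (rule lins)+
qed

text \<open>
  \<open>d_x i\<close> and \<open>d_th j\<close> (a left derivative) are the superderivations with
  \<open>[\<partial>\<^bsub>X\<^sub>i\<^esub>, X\<^sub>j] = \<delta>\<^sub>i\<^sub>j\<close>.
\<close>

lemma d_x_superderivation: "hom_superderivation UNIV 0 (d_x i)"
proof (rule hom_superderivationI[where Q = UNIV])
  fix u v :: smono
  obtain a S b T where uv: "u = (a, S)" "v = (b, T)" by (metis surj_pair)
  define e where "e = Poly_Mapping.single i (1::nat)"
  have ee: "a - e + b = a + b - e" if "Poly_Mapping.lookup a i \<noteq> 0" for a b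
    using that by (intro poly_mapping_eqI) (auto simp: lookup_add lookup_minus lookup_single when_def e_def)
  have e1: "a - e + b = a + b - e" if "Poly_Mapping.lookup a i \<noteq> 0"
    using ee[OF that] .
  have e2: "a + (b - e) = a + b - e" if "Poly_Mapping.lookup b i \<noteq> 0"
    using ee[OF that, of a] by (metis add.commute)
  show "d_x i (mon u * mon v) = d_x i (mon u) * mon v + (- 1) ^ (0 * fcard (snd u)) *\<^sub>R (mon u * d_x i (mon v))"
    unfolding uv d_x_def e_def[symmetric]
    using e1 e2
    by (cases "Poly_Mapping.lookup a i = 0"; cases "Poly_Mapping.lookup b i = 0")
      (simp_all add: mon_mult linear_scale[OF linear_lin_ext] linear_0[OF linear_lin_ext]
        lookup_add distrib_left mult.commute[of "real _"] scaleR_add_left scaleR_add_right)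
qed (simp_all add: d_x_def linear_lin_ext mon_super_part case_prod_unfold
    subspace_scale[OF subspace_super_part])

lemma below_add: "S |\<inter>| T = {||} \<Longrightarrow> below (S |\<union>| T) j = below S j + below T j"
  using inversions_union_right[of S T "{|j|}"] by (simp add: inversions_singleton_left)


lemma above_below: "below S j + above S j + (if j |\<in>| S then 1 else 0) = fcard S"
proof -
  have fin: "finite {s. s |\<in>| S \<and> P s}" for P by (rule finite_subset[of _ "fset S"]) auto
  have "fset S = ({s. s |\<in>| S \<and> s < j} \<union> {s. s |\<in>| S \<and> j < s}) \<union> {s. s |\<in>| S \<and> s = j}" by auto
  then have "card (fset S) =
      card (({s. s |\<in>| S \<and> s < j} \<union> {s. s |\<in>| S \<and> j < s}) \<union> {s. s |\<in>| S \<and> s = j})" by (rule arg_cong)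
  also have "\<dots> = card ({s. s |\<in>| S \<and> s < j} \<union> {s. s |\<in>| S \<and> j < s}) + card {s. s |\<in>| S \<and> s = j}"
    by (rule card_Un_disjoint[OF finite_UnI[OF fin fin] fin]) auto
  also have "card ({s. s |\<in>| S \<and> s < j} \<union> {s. s |\<in>| S \<and> j < s}) = below S j + above S j"
    unfolding below_def above_def by (rule card_Un_disjoint[OF fin fin]) auto
  also have "{s. s |\<in>| S \<and> s = j} = (if j |\<in>| S then {j} else {})" by auto
  finally show ?thesis by (simp add: fcard.rep_eq split: if_splits)
qed

lemma below_minus [simp]: "below (S |-| {|j|}) j = below S j"
  and above_minus [simp]: "above (S |-| {|j|}) j = above S j"
  unfolding below_def above_def by (rule arg_cong[where f = card]; auto)+

lemma inversions_remove_left: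
  assumes "j |\<in>| S" shows "inversions S T = below T j + inversions (S |-| {|j|}) T"
proof -
  have "S = {|j|} |\<union>| (S |-| {|j|})" "{|j|} |\<inter>| (S |-| {|j|}) = {||}" using assms by auto
  then show ?thesis
    by (metis inversions_union_left inversions_singleton_left)
qed

lemma inversions_remove_right:
  assumes "j |\<in>| T" shows "inversions S T = above S j + inversions S (T |-| {|j|})"
proof -
  have "T = {|j|} |\<union>| (T |-| {|j|})" "{|j|} |\<inter>| (T |-| {|j|}) = {||}" using assms by auto
  then show ?thesis
    by (metis inversions_union_right inversions_singleton_right)
qed

lemma d_th_superderivation: "hom_superderivation UNIV 1 (d_th j)"
proof (rule hom_superderivationI[where Q = UNIV])
  fix u v :: smono
  obtain a S b T where uv: "u = (a, S)" "v = (b, T)" by (metis surj_pair)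
  have d: "d_th j (mon (c, U)) = (if j |\<in>| U then (-1) ^ below U j *\<^sub>R mon (c, U |-| {|j|}) else 0)" for c U
    by (simp add: d_th_def)
  have lin: "linear (d_th j)" by (simp add: d_th_def linear_lin_ext)
  have sgn: "(-1) ^ k = ((-1) ^ l :: real)" if "even (k + l)" for k l
    using that by (simp add: minus_one_power_iff)
  have sgn': "(-1) ^ k = - ((-1) ^ l :: real)" if "odd (k + l)" for k l
    using that by (auto simp: minus_one_power_iff)
  note ss = mon_mult linear_scale[OF lin] linear_0[OF lin] d power_add[symmetric]
  have sc: "(c *\<^sub>R f) * g = c *\<^sub>R (f * g)" "f * (c *\<^sub>R g) = c *\<^sub>R (f * g)" for c and f g :: spoly by auto
  show "d_th j (mon u * mon v) = d_th j (mon u) * mon v + (- 1) ^ (1 * fcard (snd u)) *\<^sub>R (mon u * d_th j (mon v))"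
  proof (cases "j |\<in>| S"; cases "j |\<in>| T")
    assume j: "j |\<in>| S" "j |\<in>| T"
    show ?thesis
    proof (cases "S |\<inter>| T = {|j|}")
      case True
      then have 1: "(S |-| {|j|}) |\<inter>| T = {||}" "S |\<inter>| (T |-| {|j|}) = {||}"
        "(S |-| {|j|}) |\<union>| T = S |\<union>| T" "S |\<union>| (T |-| {|j|}) = S |\<union>| T" using j by auto
      have 2: "inversions (S |-| {|j|}) T = above S j + inversions (S |-| {|j|}) (T |-| {|j|})"
        using inversions_remove_right[OF j(2), of "S |-| {|j|}"] by simp
      have 3: "inversions S (T |-| {|j|}) = below T j + inversions (S |-| {|j|}) (T |-| {|j|})"
        using inversions_remove_left[OF j(1), of "T |-| {|j|}"] by simp
      have "odd ((below S j + inversions (S |-| {|j|}) T) + (fcard S + (below T j + inversions S (T |-| {|j|}))))"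
        using above_below[of S j] j(1) unfolding 2 3 by (simp only: if_True) presburger
      note sg = sgn'[OF this]
      have "d_th j (mon u) * mon v =
          (-1) ^ (below S j + inversions (S |-| {|j|}) T) *\<^sub>R mon (a + b, S |\<union>| T)"
        unfolding uv using j 1 by (simp add: ss)
      moreover have "(- 1) ^ (1 * fcard (snd u)) *\<^sub>R (mon u * d_th j (mon v)) =
          (-1) ^ (fcard S + (below T j + inversions S (T |-| {|j|}))) *\<^sub>R mon (a + b, S |\<union>| T)"
        unfolding uv using j 1 by (simp add: ss)
      moreover have "d_th j (mon u * mon v) = 0"
        unfolding uv using True by (simp add: ss)
      ultimately show ?thesis unfolding sg by simp
    next
      case False
      then have "S |\<inter>| T \<noteq> {||}" "(S |-| {|j|}) |\<inter>| T \<noteq> {||}" "S |\<inter>| (T |-| {|j|}) \<noteq> {||}" using j by auto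
      then show ?thesis using j unfolding uv by (simp add: ss)
    qed
  next
    assume j: "j |\<in>| S" "j |\<notin>| T"
    then have 1: "(S |-| {|j|}) |\<inter>| T = {||} \<longleftrightarrow> S |\<inter>| T = {||}"
        "(S |-| {|j|}) |\<union>| T = (S |\<union>| T) |-| {|j|}" by auto
    have "even ((inversions S T + below (S |\<union>| T) j) + (below S j + inversions (S |-| {|j|}) T))"
      if "S |\<inter>| T = {||}"
      unfolding inversions_remove_left[OF j(1), of T] below_add[OF that, of j] by presburger
    from sgn[OF this] show ?thesis
      unfolding uv using j 1 by (cases "S |\<inter>| T = {||}") (simp_all add: ss)
  next
    assume j: "j |\<notin>| S" "j |\<in>| T"
    then have 1: "S |\<inter>| (T |-| {|j|}) = {||} \<longleftrightarrow> S |\<inter>| T = {||}"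
        "S |\<union>| (T |-| {|j|}) = (S |\<union>| T) |-| {|j|}" by auto
    have "even ((inversions S T + below (S |\<union>| T) j) + (fcard S + (below T j + inversions S (T |-| {|j|}))))"
      if "S |\<inter>| T = {||}"
      unfolding inversions_remove_right[OF j(2), of S] below_add[OF that, of j]
      using above_below[of S j] j(1) by (simp only: if_False) presburger
    from sgn[OF this] show ?thesis
      unfolding uv using j 1 by (cases "S |\<inter>| T = {||}") (simp_all add: ss)
  next
    assume "j |\<notin>| S" "j |\<notin>| T"
    then show ?thesis
      unfolding uv by (cases "S |\<inter>| T = {||}") (simp_all add: ss)
  qed
next
  fix u :: smono
  obtain a S where u: "u = (a, S)" by (metis surj_pair)
  show "d_th j (mon u) \<in> UNIV \<inter> super_part (1 + fcard (snd u))"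
  proof (cases "j |\<in>| S")
    case True
    then have "fcard S = Suc (fcard (S |-| {|j|}))" by (metis fcard_Suc_fminus1)
    then have "even (fcard (S |-| {|j|})) = even (1 + fcard S)"
      by (metis even_Suc plus_1_eq_Suc)
    then have "mon (a, S |-| {|j|}) \<in> super_part (1 + fcard S)"
      by (simp only: mon_super_part snd_conv)
    then show ?thesis using True unfolding u d_th_def
      by (simp add: subspace_scale[OF subspace_super_part])
  next
    case False
    then show ?thesis by (simp add: u d_th_def subspace_0[OF subspace_super_part])
  qed
qed (simp_all add: d_th_def linear_lin_ext)

lemma below_singleton [simp]: "below {|j|} j = 0"
  by (auto simp: below_def)

lemma d_var [simp]:
  "d_x i (x_var j) = (if i = j then 1 else 0)" "d_x i (th_var j) = 0"
  "d_th i (th_var j) = (if i = j then 1 else 0)" "d_th i (x_var j) = 0"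
  by (auto simp: d_x_def d_th_def x_var_def th_var_def one_spoly_def lookup_single)

section \<open>Extending superderivations by a further even variable\<close>

text \<open>
  Here \<open>D\<close> is a superderivation of \<open>\<P>(\<real>\<^bsup>m-1|2n\<^esup>)\<close> and
  \<open>extension m n D\<close> its extension to \<open>\<P>(\<real>\<^bsup>m|2n\<^esup>)\<close> that
  annihilates \<open>x\<^sub>m\<close>; for \<open>m \<ge> 1\<close> it exists and is unique (lemma \<open>ex1_extension\<close>).
\<close>

definition is_extension ::
    "nat \<Rightarrow> nat \<Rightarrow> (spoly \<Rightarrow> spoly) \<Rightarrow> (spoly \<Rightarrow> spoly) \<Rightarrow> bool" where
  "is_extension m n D D' \<longleftrightarrow>
     superderivation (superpolys m n) D' \<and>
     (\<forall>f \<in> superpolys (m - 1) n. D' f = D f) \<and> D' (x_var m) = 0"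

definition extension :: "nat \<Rightarrow> nat \<Rightarrow> (spoly \<Rightarrow> spoly) \<Rightarrow> spoly \<Rightarrow> spoly" where
  "extension m n D = (THE D'. is_extension m n D D')"

lemma mult_closed:
  assumes V: "subspace V" and uv: "\<And>u v. u \<in> supp f \<Longrightarrow> v \<in> supp g \<Longrightarrow> mono_mult u v \<in> V"
  shows "f * g \<in> V"
proof (rule subspace_linear_image[OF linear_mult(1) V])
  fix u assume u: "u \<in> supp f"
  show "mon u * g \<in> V"
    by (rule subspace_linear_image[OF linear_mult(2) V]) (use uv[OF u] in \<open>simp add: mon_mult\<close>)
qed

lemma mono_mult_subspace:
  assumes "subspace V" "mon (fst u + fst v, snd u |\<union>| snd v) \<in> V"
  shows "mono_mult u v \<in> V"
  using assms by (cases u; cases v) (auto simp: subspace_0 intro!: subspace_scale)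

lemma superpolys_mult:
  assumes "f \<in> superpolys m n" "g \<in> superpolys m n"
  shows "f * g \<in> superpolys m n"
proof (rule mult_closed[OF subspace_superpolys], rule mono_mult_subspace[OF subspace_superpolys])
  fix u v assume "u \<in> supp f" "v \<in> supp g"
  then have *: "Poly_Mapping.keys (fst u) \<subseteq> {1..m}" "Poly_Mapping.keys (fst v) \<subseteq> {1..m}"
    "fset (snd u) \<subseteq> {1..2 * n}" "fset (snd v) \<subseteq> {1..2 * n}"
    using assms unfolding superpolys_alt by blast+
  then have "Poly_Mapping.keys (fst u + fst v) \<subseteq> {1..m}" "fset (snd u |\<union>| snd v) \<subseteq> {1..2 * n}"
    using keys_add[of "fst u" "fst v"] by (blast, simp only: sup_fset.rep_eq Un_subset_iff)
  then show "mon (fst u + fst v, snd u |\<union>| snd v) \<in> superpolys m n"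
    unfolding superpolys_alt by simp
qed

lemma super_part_mult: "f \<in> super_part p \<Longrightarrow> g \<in> super_part q \<Longrightarrow> f * g \<in> super_part (p + q)"
proof (rule mult_closed[OF subspace_super_part])
  fix u v assume *: "f \<in> super_part p" "g \<in> super_part q" "u \<in> supp f" "v \<in> supp g"
  obtain a S b T where uv: "u = (a, S)" "v = (b, T)" by (metis surj_pair)
  have "fcard (S |\<union>| T) = fcard S + fcard T" if "S |\<inter>| T = {||}"
    using that by (rule fcard_funion_disjoint)
  then show "mono_mult u v \<in> super_part (p + q)"
  proof (cases "S |\<inter>| T = {||}")
    case True
    have "even (fcard S) = even p" "even (fcard T) = even q"
      using * unfolding uv super_part_alt by auto
    then have "mon (a + b, S |\<union>| T) \<in> super_part (p + q)"
      using True \<open>S |\<inter>| T = {||} \<Longrightarrow> _\<close> by (simp add: mon_super_part)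
    then show ?thesis
      unfolding uv using subspace_scale[OF subspace_super_part] True by simp
  qed (simp add: uv subspace_0[OF subspace_super_part])
qed

lemma linear_on_sum:
  assumes "linear_on A D" "subspace A" "finite I" "\<And>i. i \<in> I \<Longrightarrow> w i \<in> A"
  shows "D (\<Sum>i\<in>I. c i *\<^sub>R w i) = (\<Sum>i\<in>I. c i *\<^sub>R D (w i))"
  using assms(3,4)
proof (induction I rule: finite_induct)
  case empty
  have "D (0 *\<^sub>R 0) = 0 *\<^sub>R D 0"
    using assms(1) subspace_0[OF assms(2)] unfolding linear_on_def by blast
  then show ?case by simp
next
  case (insert i I)
  have "(\<Sum>i\<in>I. c i *\<^sub>R w i) \<in> A" "c i *\<^sub>R w i \<in> A"
    using insert.prems assms(2) by (auto intro!: subspace_sum subspace_scale)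
  then show ?case using insert assms(1) unfolding linear_on_def by simp
qed

lemma linear_on_lin_ext:
  assumes "linear_on {f. supp f \<subseteq> Q} D" "supp f \<subseteq> Q"
  shows "D f = lin_ext (\<lambda>u. D (mon u)) f"
proof -
  have "D f = D (\<Sum>u\<in>supp f. coeff f u *\<^sub>R mon u)"
    by (subst (1) lin_ext_id[symmetric, of f]) (simp add: lin_ext_def)
  also have "\<dots> = (\<Sum>u\<in>supp f. coeff f u *\<^sub>R D (mon u))"
    by (rule linear_on_sum[OF assms(1) subspace_supp]) (use assms(2) in auto)
  finally show ?thesis by (simp add: lin_ext_def)
qed


definition xp :: "nat \<Rightarrow> nat \<Rightarrow> spoly" where
  "xp m i = mon (Poly_Mapping.single m i, {||})"

lemma mon_xp: "mon (a, S) * xp m i = mon (a + Poly_Mapping.single m i, S)"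
  by (simp add: xp_def mon_mult)

lemma xp_commute: "f * xp m i = xp m i * f"
proof (rule linear_eq_on_supp[OF linear_mult])
  fix u show "mon u * xp m i = xp m i * mon u"
    by (cases u) (simp add: xp_def mon_mult add.commute)
qed

lemma xp_mult: "xp m i * xp m j = xp m (i + j)"
  by (simp add: xp_def mon_mult single_add)

lemma xp_0 [simp]: "xp m 0 = 1" and xp_1: "xp m 1 = x_var m"
  by (simp_all add: xp_def one_spoly_def x_var_def)

lemma xp_superpolys: "1 \<le> m \<Longrightarrow> xp m i \<in> superpolys m n"
  by (auto simp: xp_def superpolys_def)

lemma xp_even: "xp m i \<in> super_part 0"
  by (simp add: xp_def mon_super_part fcard.rep_eq)

definition strip :: "nat \<Rightarrow> smono \<Rightarrow> smono" where
  "strip m u = (fst u - Poly_Mapping.single m (Poly_Mapping.lookup (fst u) m), snd u)"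

lemma strip_mult: "mon (strip m u) * xp m (Poly_Mapping.lookup (fst u) m) = mon u"
proof -
  have "fst u - Poly_Mapping.single m (Poly_Mapping.lookup (fst u) m)
      + Poly_Mapping.single m (Poly_Mapping.lookup (fst u) m) = fst u"
    by (rule poly_mapping_eqI) (simp add: lookup_add lookup_minus lookup_single when_def)
  then show ?thesis by (simp add: strip_def mon_xp)
qed

lemma keys_strip: "Poly_Mapping.keys (fst (strip m u)) = Poly_Mapping.keys (fst u) - {m}"
  by (auto simp: strip_def in_keys_iff lookup_minus lookup_single when_def split: if_splits)

abbreviation (input) super_monos :: "nat \<Rightarrow> nat \<Rightarrow> smono set" where
  "super_monos m n \<equiv> {u. Poly_Mapping.keys (fst u) \<subseteq> {1..m} \<and> fset (snd u) \<subseteq> {1..2 * n}}"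

lemma strip_super_monos: "u \<in> super_monos m n \<Longrightarrow> strip m u \<in> super_monos (m - 1) n"
proof -
  assume "u \<in> super_monos m n"
  moreover have "{1..m} - {m} \<subseteq> {1..m - 1}" by auto
  ultimately show ?thesis using keys_strip[of m u] by (auto simp: strip_def)
qed

lemma strip_eq: "u \<in> super_monos (m - 1) n \<Longrightarrow> 1 \<le> m \<Longrightarrow>
  Poly_Mapping.lookup (fst u) m = 0 \<and> strip m u = u"
proof -
  assume "u \<in> super_monos (m - 1) n" "1 \<le> m"
  then have "m \<notin> Poly_Mapping.keys (fst u)" by auto
  then show ?thesis by (simp add: strip_def in_keys_iff)
qed

lemma hom_extension_exists:
  assumes D: "hom_superderivation (superpolys (m - 1) n) p D" and m: "1 \<le> m"
  obtains F where "hom_superderivation (superpolys m n) p F"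
    "\<And>f. f \<in> superpolys (m - 1) n \<Longrightarrow> F f = D f" "F (x_var m) = 0"
proof -
  let ?A = "superpolys (m - 1) n" and ?l = "\<lambda>u :: smono. Poly_Mapping.lookup (fst u) m"
  define E where "E = lin_ext (\<lambda>u. D (mon u))"
  define F where "F = lin_ext (\<lambda>u. D (mon (strip m u)) * xp m (?l u))"
  have linE: "linear E" and linF: "linear F" by (simp_all add: E_def F_def linear_lin_ext)
  have linD: "linear_on ?A D" using D by (simp add: hom_superderivation_def)
  have ED: "E f = D f" if "f \<in> ?A" for f
    using linear_on_lin_ext[OF linD[unfolded superpolys_alt], of f] that
    unfolding E_def superpolys_alt by simp
  have monA: "mon u \<in> ?A \<longleftrightarrow> u \<in> super_monos (m - 1) n" for u
    by (auto simp: superpolys_alt)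
  have Fm: "F (mon u) = D (mon (strip m u)) * xp m (?l u)" for u
    by (simp add: F_def)
  have FX: "F (f * xp m i) = D f * xp m i" if "f \<in> ?A" for f i
  proof -
    have "F (f * xp m i) = E f * xp m i"
    proof (rule linear_eq_on_supp[OF linear_compose[OF linear_mult(1) linF, unfolded o_def]
            linear_compose[OF linE linear_mult(1), unfolded o_def]])
      fix u assume "u \<in> supp f"
      then have u: "u \<in> super_monos (m - 1) n" using that unfolding superpolys_alt by blast
      define v where "v = (fst u + Poly_Mapping.single m i, snd u)"
      have "m \<notin> Poly_Mapping.keys (fst u)" using u m by auto
      then have l: "?l v = i" by (simp add: v_def lookup_add in_keys_iff)
      have "strip m v = u" unfolding strip_def l by (simp add: v_def)
      moreover have "mon u * xp m i = mon v" using mon_xp[of "fst u" "snd u"] by (simp add: v_def)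
      ultimately show "F (mon u * xp m i) = E (mon u) * xp m i"
        using l by (simp add: Fm E_def)
    qed
    then show ?thesis using ED that by simp
  qed
  have sub: "?A \<subseteq> superpolys m n"
  proof -
    have "super_monos (m - 1) n \<subseteq> super_monos m n" by fastforce
    then show ?thesis unfolding superpolys_alt by blast
  qed
  have hom: "hom_superderivation (superpolys m n) p F"
  proof (rule hom_superderivationI[OF superpolys_alt linF])
    fix u assume "u \<in> super_monos m n"
    then have s: "mon (strip m u) \<in> ?A" using monA strip_super_monos by blast
    moreover have "mon (strip m u) \<in> super_part (fcard (snd u))"
      by (simp add: mon_super_part strip_def)
    ultimately have "D (mon (strip m u)) \<in> ?A" "D (mon (strip m u)) \<in> super_part (p + fcard (snd u))"
      using D unfolding hom_superderivation_def by blast+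
    then show "F (mon u) \<in> superpolys m n \<inter> super_part (p + fcard (snd u))"
      unfolding Fm using superpolys_mult xp_superpolys[OF m] sub
        super_part_mult[OF _ xp_even, of _ "p + fcard (snd u)"] by auto
  next
    fix u v assume "u \<in> super_monos m n" "v \<in> super_monos m n"
    then have s: "mon (strip m u) \<in> ?A" "mon (strip m v) \<in> ?A" using monA strip_super_monos by blast+
    let ?f = "mon (strip m u)" and ?g = "mon (strip m v)"
    let ?x = "xp m (?l u)" and ?y = "xp m (?l v)"
    have q: "?f \<in> super_part (fcard (snd u))" by (simp add: mon_super_part strip_def)
    have c: "?x * h = h * ?x" for h by (simp add: xp_commute)
    have c': "?x * (h * k) = h * (?x * k)" for h k by (metis c mult.assoc)
    have "mon u * mon v = (?f * ?g) * xp m (?l u + ?l v)"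
      unfolding strip_mult[of m u, symmetric] strip_mult[of m v, symmetric] xp_mult[symmetric]
      by (simp add: mult.assoc c')
    then have "F (mon u * mon v) = D (?f * ?g) * xp m (?l u + ?l v)"
      using FX superpolys_mult s by simp
    also have "D (?f * ?g) = D ?f * ?g + (- 1) ^ (p * fcard (snd u)) *\<^sub>R (?f * D ?g)"
      using D s q unfolding hom_superderivation_def by blast
    also have "\<dots> * xp m (?l u + ?l v) = D ?f * ?x * (?g * ?y)
        + (- 1) ^ (p * fcard (snd u)) *\<^sub>R ((?f * ?x) * (D ?g * ?y))"
      unfolding xp_mult[symmetric] by (simp add: distrib_right mult.assoc c')
    finally show "F (mon u * mon v) = F (mon u) * mon v + (- 1) ^ (p * fcard (snd u)) *\<^sub>R (mon u * F (mon v))"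
      unfolding Fm strip_mult .
  qed
  have FD: "F f = D f" if "f \<in> ?A" for f
    using FX[OF that, of 0] by simp
  have "F (x_var m) = D 1 * x_var m"
  proof -
    have "(1::spoly) \<in> ?A" by (simp add: one_spoly_def superpolys_alt)
    from FX[OF this, of 1] show ?thesis by (simp only: xp_1 mult_1_left)
  qed
  moreover have "D 1 = 0"
  proof -
    have "(1::spoly) \<in> ?A" "(1::spoly) \<in> super_part 0"
      by (simp_all add: one_spoly_def superpolys_alt mon_super_part fcard.rep_eq)
    then have "D (1 * 1) = D 1 * 1 + (- 1) ^ (p * 0) *\<^sub>R (1 * D 1)"
      using D unfolding hom_superderivation_def by blast
    then show ?thesis by simp
  qed
  ultimately show ?thesis using that hom FD by simp
qed

lemma super_part_0_1: "f + g = 0 \<Longrightarrow> f \<in> super_part 0 \<Longrightarrow> g \<in> super_part 1 \<Longrightarrow> f = 0"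
proof (rule spoly_eqI, rule ccontr)
  fix u assume *: "f + g = 0" "f \<in> super_part 0" "g \<in> super_part 1" "coeff f u \<noteq> coeff 0 u"
  then have "coeff f u + coeff g u = 0" by (metis coeff_simps(1,2))
  then have "u \<in> supp f" "u \<in> supp g" using * by (auto simp: supp_iff)
  then show False using * by (auto simp: super_part_alt)
qed

lemma superderivation_mult_x:
  assumes D: "superderivation (superpolys m n) D" and x: "D (x_var m) = 0"
    and m: "1 \<le> m" and u: "u \<in> super_monos m n"
  shows "D (mon u * x_var m) = D (mon u) * x_var m"
proof -
  let ?A = "superpolys m n"
  obtain D0 D1 where h: "hom_superderivation ?A 0 D0" "hom_superderivation ?A 1 D1"
    "\<forall>f\<in>?A. D f = D0 f + D1 f" using D unfolding superderivation_def by blast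
  have xA: "x_var m \<in> ?A" "x_var m \<in> super_part 0"
    using xp_superpolys[OF m, of 1] xp_even[of m 1] by (simp_all only: xp_1)
  have "D0 (x_var m) + D1 (x_var m) = 0" using h(3) xA x by simp
  moreover have "D0 (x_var m) \<in> super_part (0 + 0)" "D1 (x_var m) \<in> super_part (1 + 0)"
    using h(1,2) xA unfolding hom_superderivation_def by blast+
  ultimately have z: "D0 (x_var m) = 0" "D1 (x_var m) = 0"
    using super_part_0_1[of "D0 (x_var m)" "D1 (x_var m)"] by simp_all
  have uA: "mon u \<in> ?A" "mon u \<in> super_part (fcard (snd u))"
    using u by (simp_all add: superpolys_alt mon_super_part)
  have "D0 (mon u * x_var m) = D0 (mon u) * x_var m + (-1) ^ (0 * fcard (snd u)) *\<^sub>R (mon u * D0 (x_var m))"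
    "D1 (mon u * x_var m) = D1 (mon u) * x_var m + (-1) ^ (1 * fcard (snd u)) *\<^sub>R (mon u * D1 (x_var m))"
    using h(1,2) xA uA unfolding hom_superderivation_def by blast+
  then show ?thesis using z h(3) uA xA superpolys_mult[OF uA(1) xA(1)] by (simp add: distrib_right)
qed

lemma ex1_extension:
  assumes D: "superderivation (superpolys (m - 1) n) D" and m: "1 \<le> m"
  shows "\<exists>!D'. is_extension m n D D'"
proof (rule ex_ex1I)
  obtain D0 D1 where h: "hom_superderivation (superpolys (m - 1) n) 0 D0"
    "hom_superderivation (superpolys (m - 1) n) 1 D1"
    "\<forall>f\<in>superpolys (m - 1) n. D f = D0 f + D1 f"
    using D unfolding superderivation_def by blast
  obtain F0 where F0: "hom_superderivation (superpolys m n) 0 F0"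
    "\<And>f. f \<in> superpolys (m - 1) n \<Longrightarrow> F0 f = D0 f" "F0 (x_var m) = 0"
    using hom_extension_exists[OF h(1) m] by blast
  obtain F1 where F1: "hom_superderivation (superpolys m n) 1 F1"
    "\<And>f. f \<in> superpolys (m - 1) n \<Longrightarrow> F1 f = D1 f" "F1 (x_var m) = 0"
    using hom_extension_exists[OF h(2) m] by blast
  let ?F = "restrict (\<lambda>f. F0 f + F1 f) (superpolys m n)"
  have "superpolys (m - 1) n \<subseteq> superpolys m n"
  proof -
    have "super_monos (m - 1) n \<subseteq> super_monos m n" by fastforce
    then show ?thesis unfolding superpolys_alt by blast
  qed
  moreover have "x_var m \<in> superpolys m n" using xp_superpolys[OF m, of 1] by (simp only: xp_1)
  moreover have "superderivation (superpolys m n) ?F"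
    unfolding superderivation_def using F0(1) F1(1) by auto
  ultimately have "is_extension m n D ?F"
    unfolding is_extension_def using F0 F1 h(3) by auto
  then show "\<exists>D'. is_extension m n D D'" by blast
next
  fix F G assume F: "is_extension m n D F" and G: "is_extension m n D G"
  have eq: "F (mon u) = G (mon u)" if "u \<in> super_monos m n" for u
    using that
  proof (induction "Poly_Mapping.lookup (fst u) m" arbitrary: u)
    case 0
    then have "strip m u = u" by (simp add: strip_def)
    then have "mon u \<in> superpolys (m - 1) n"
      using strip_super_monos[OF 0(2)] by (auto simp: superpolys_alt)
    then show ?case using F G unfolding is_extension_def by simp
  next
    case (Suc i)
    let ?v = "(fst u - Poly_Mapping.single m 1, snd u)"
    have "fst u - Poly_Mapping.single m 1 + Poly_Mapping.single m 1 = fst u"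
      using Suc(2) by (intro poly_mapping_eqI) (auto simp: lookup_add lookup_minus lookup_single when_def)
    then have u: "mon u = mon ?v * x_var m"
      using mon_xp[of "fst u - Poly_Mapping.single m 1" "snd u" m 1] by (simp only: xp_1 prod.collapse)
    have "Poly_Mapping.keys (fst ?v) \<subseteq> Poly_Mapping.keys (fst u)"
      by (auto simp: in_keys_iff lookup_minus)
    then have v: "?v \<in> super_monos m n" using Suc.prems by auto
    have "i = Poly_Mapping.lookup (fst ?v) m" using Suc(2) by (simp add: lookup_minus)
    from Suc(1)[OF this v] have "F (mon ?v) = G (mon ?v)" .
    then show ?case
      using superderivation_mult_x[of m n _ ?v, OF _ _ m v] F G unfolding u is_extension_def by metis
  qed
  show "F = G"
  proof (rule extensionalityI[of _ "superpolys m n"])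
    show "F \<in> extensional (superpolys m n)" "G \<in> extensional (superpolys m n)"
      using F G by (simp_all add: is_extension_def superderivation_def)
    fix f assume f: "f \<in> superpolys m n"
    have lin: "linear_on {f. supp f \<subseteq> super_monos m n} H" if "superderivation (superpolys m n) H" for H
    proof -
      obtain D0 D1 where h: "linear_on (superpolys m n) D0" "linear_on (superpolys m n) D1"
        "\<forall>f\<in>superpolys m n. H f = D0 f + D1 f"
        using \<open>superderivation (superpolys m n) H\<close> unfolding superderivation_def hom_superderivation_def by blast
      show ?thesis
        unfolding superpolys_alt[symmetric] linear_on_def
        using h subspace_add[OF subspace_superpolys[of m n]] subspace_scale[OF subspace_superpolys[of m n]]
        unfolding linear_on_def by (simp add: scaleR_add_right)
    qed
    have "supp f \<subseteq> super_monos m n" using f by (simp add: superpolys_alt)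
    then have "F f = lin_ext (\<lambda>u. F (mon u)) f" "G f = lin_ext (\<lambda>u. G (mon u)) f"
      using linear_on_lin_ext[OF lin] F G unfolding is_extension_def by blast+
    moreover have "lin_ext (\<lambda>u. F (mon u)) f = lin_ext (\<lambda>u. G (mon u)) f"
      unfolding lin_ext_def using \<open>supp f \<subseteq> _\<close> eq by (intro sum.cong) auto
    ultimately show "F f = G f" by simp
  qed
qed

section \<open>The orthosymplectic Lie superalgebra and spherical harmonics\<close>

definition laplacian :: "nat \<Rightarrow> nat \<Rightarrow> spoly \<Rightarrow> spoly" where
  "laplacian m n f =
     (\<Sum>j=1..m. d_x j (d_x j f)) - 4 *\<^sub>R (\<Sum>j=1..n. d_th (2 * j - 1) (d_th (2 * j) f))"

definition radius_sq :: "nat \<Rightarrow> nat \<Rightarrow> spoly" where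
  "radius_sq m n = (\<Sum>j=1..m. x_var j ^ 2) - (\<Sum>j=1..n. th_var (2 * j - 1) * th_var (2 * j))"

definition spherical_harmonics :: "nat \<Rightarrow> nat \<Rightarrow> nat \<Rightarrow> spoly set" where
  "spherical_harmonics m n k = {P \<in> homogeneous m n k. laplacian m n P = 0}"

definition gen_spherical_harmonics :: "nat \<Rightarrow> nat \<Rightarrow> nat \<Rightarrow> spoly set" where
  "gen_spherical_harmonics m n k =
     {P \<in> homogeneous m n k. laplacian m n (radius_sq m n * laplacian m n P) = 0}"

definition coordinates :: "nat \<Rightarrow> nat \<Rightarrow> spoly set" where
  "coordinates m n = x_var ` {1..m} \<union> th_var ` {1..2 * n}"

definition osp :: "nat \<Rightarrow> nat \<Rightarrow> (spoly \<Rightarrow> spoly) set" where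
  "osp m n = {D. superderivation (superpolys m n) D \<and>
     D ` span (coordinates m n) \<subseteq> span (coordinates m n) \<and> D (radius_sq m n) = 0}"

section \<open>Modules over a Lie superalgebra of operators\<close>

text \<open>
  \<open>parity_part M 0\<close> and \<open>parity_part M 1\<close> cut out the even and the odd elements of the
  carrier.
\<close>

record ('g, 'v) smodule =
  module_carrier :: "'v set"
  parity_part :: "nat \<Rightarrow> 'v set"
  module_action :: "'g \<Rightarrow> 'v \<Rightarrow> 'v"

definition submodule :: "'g set \<Rightarrow> ('g, 'v::real_vector) smodule \<Rightarrow> 'v set \<Rightarrow> bool" where
  "submodule G M U \<longleftrightarrow> subspace U \<and> U \<subseteq> module_carrier M \<and>
     (\<forall>D\<in>G. \<forall>u\<in>U. module_action M D u \<in> U)"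

text \<open>
  The complementary submodules are not required to be graded, so this implies indecomposability
  in the category of graded modules.
\<close>

definition indecomposable :: "'g set \<Rightarrow> ('g, 'v::real_vector) smodule \<Rightarrow> bool" where
  "indecomposable G M \<longleftrightarrow> module_carrier M \<noteq> {0} \<and> submodule G M (module_carrier M) \<and>
     (\<forall>U W. submodule G M U \<and> submodule G M W \<and> U \<inter> W = {0} \<and>
        module_carrier M = {u + w | u w. u \<in> U \<and> w \<in> W} \<longrightarrow> U = {0} \<or> W = {0})"

definition module_iso ::
    "'g set \<Rightarrow> ('g, 'v::real_vector) smodule \<Rightarrow> ('g, 'w::real_vector) smodule \<Rightarrow> ('v \<Rightarrow> 'w) \<Rightarrow> bool"
where
  "module_iso G M N \<phi> \<longleftrightarrow>
     submodule G M (module_carrier M) \<and> submodule G N (module_carrier N) \<and>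
     bij_betw \<phi> (module_carrier M) (module_carrier N) \<and> linear_on (module_carrier M) \<phi> \<and>
     (\<forall>p. \<phi> \<in> module_carrier M \<inter> parity_part M p \<rightarrow> parity_part N p) \<and>
     (\<forall>D\<in>G. \<forall>v\<in>module_carrier M. \<phi> (module_action M D v) = module_action N D (\<phi> v))"

definition direct_sum ::
    "'i set \<Rightarrow> ('i \<Rightarrow> ('g, 'v::real_vector) smodule) \<Rightarrow> ('g, 'i \<Rightarrow>\<^sub>0 'v) smodule" where
  "direct_sum I M = \<lparr>
     module_carrier = {f. Poly_Mapping.keys f \<subseteq> I \<and>
       (\<forall>i\<in>I. Poly_Mapping.lookup f i \<in> module_carrier (M i))},
     parity_part = \<lambda>p. {f. \<forall>i\<in>I. Poly_Mapping.lookup f i \<in> parity_part (M i) p},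
     module_action = \<lambda>D. Poly_Mapping.mapp (\<lambda>i. module_action (M i) D) \<rparr>"

definition indecomposable_decomposition ::
    "'g set \<Rightarrow> ('g, 'v::real_vector) smodule \<Rightarrow> 'i set \<Rightarrow> ('i \<Rightarrow> ('g, 'w::real_vector) smodule) \<Rightarrow> bool"
where
  "indecomposable_decomposition G M I N \<longleftrightarrow>
     (\<exists>\<phi>. module_iso G M (direct_sum I N) \<phi>) \<and>
     (\<forall>i\<in>I. module_carrier (N i) = {0} \<or> indecomposable G (N i))"

text \<open>
  In both cases \<open>V\<close> is a space of superpolynomials: in \<open>natural_module\<close> a superderivation
  acts by itself, in \<open>restricted_module m n\<close> a superderivation of
  \<open>\<P>(\<real>\<^bsup>m-1|2n\<^esup>)\<close> acts through its extension.
\<close>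

definition natural_module :: "spoly set \<Rightarrow> (spoly \<Rightarrow> spoly, spoly) smodule" where
  "natural_module V =
     \<lparr> module_carrier = V, parity_part = super_part, module_action = (\<lambda>D. D) \<rparr>"

definition restricted_module ::
    "nat \<Rightarrow> nat \<Rightarrow> spoly set \<Rightarrow> (spoly \<Rightarrow> spoly, spoly) smodule" where
  "restricted_module m n V =
     \<lparr> module_carrier = V, parity_part = super_part, module_action = extension m n \<rparr>"

section \<open>Index sets\<close>

definition exceptional_indices :: "int \<Rightarrow> nat set" where
  "exceptional_indices N =
     (if N \<le> 0 \<and> even N then {l. 2 - N div 2 \<le> int l \<and> int l \<le> 2 - N} else {})"

definition superdim :: "nat \<Rightarrow> nat \<Rightarrow> int" where
  "superdim m n = int m - 2 * int n"

definition B_gen :: "int \<Rightarrow> nat \<Rightarrow> nat set" where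
  "B_gen M k = {0..k} \<inter> exceptional_indices (M - 1)"

definition B_partner :: "int \<Rightarrow> nat \<Rightarrow> int set" where
  "B_partner M k = {3 - M - int l | l. l \<in> B_gen M k}"

definition B_simple :: "int \<Rightarrow> nat \<Rightarrow> nat set" where
  "B_simple M k = {l \<in> {0..k}. l \<notin> B_gen M k \<and> int l \<notin> B_partner M k}"

end

theory Submission
  imports Defs
begin

text \<open>
  A harmonic polynomial on \<open>\<real>\<^bsup>m|2n\<^esup>\<close> is determined by its value and its normal derivative on
  \<open>x\<^sub>m = 0\<close>, and both can be prescribed; so \<open>\<H>\<^sub>k\<close> is isomorphic to
  \<open>\<P>\<^sub>k \<oplus> \<P>\<^bsub>k-1\<^esub>\<close> over \<open>\<real>\<^bsup>m-1|2n\<^esup>\<close>. Each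
  \<open>\<P>\<^sub>d\<close> has a Fischer decomposition into copies \<open>R\<^bsup>d-l\<^esup>\<H>\<^sub>l\<close>; it follows by
  induction on \<open>d\<close> from the spectrum of \<open>\<Delta>R\<^sup>2\<close>. The eigenvalue \<open>0\<close> occurs only on the
  component \<open>l = 2 - N - d\<close>, where \<open>N\<close> is the superdimension; in that case this component is
  absorbed in the generalized harmonics of degree \<open>d\<close>.

  The harmonics are indecomposable because they are generated by vectors which operators of the algebra
  single out: the powers of \<open>y + \<i>x\<close> if there are two even variables, and otherwise, by
  induction on the number of odd variables, vectors of extremal weight. The generalized harmonics inherit
  this, since the Casimir element acts by \<open>R\<^sup>2\<Delta>\<close> up to scalars: this operator maps them to the
  harmonics, which are its kernel if there is an even variable. Without even variables the generalized
  harmonics of exceptional degree vanish.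
\<close>

section \<open>Variables and derivatives with a common index set\<close>

text \<open>Two obstacles shape the proof. If d + l = 2 - N with l < d of the same parity, then
  R^(d-l) H_l consists of harmonics of degree d. So H_d may meet R^2 P_(d-2), which is why the
  kernel of Delta R^2 Delta has to replace H_d in such a degree, and the spaces of harmonics need
  not be simple, so indecomposability cannot be deduced from irreducibility. Instead, some operator
  of the algebra has an eigenspace that splits along every pair of complementary submodules; one of
  the two submodules is shown to contain vectors of this eigenspace that generate everything.
  Submodules are not assumed graded, and scalars are real, so a rotation of two even variables
  enters through its square. The second obstacle is that the algebra is given abstractly by
  superderivations. They are replaced by combinations of explicit operators \<open>rot a b\<close>;
  one and the same combination represents an element of osp(m-1|2n) and its extension, so
  equivariance reduces to a few commutation rules.\<close>

type_synonym idx = "nat + nat"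

definition var :: "idx \<Rightarrow> spoly" where
  "var = case_sum x_var th_var"

definition pder :: "idx \<Rightarrow> spoly \<Rightarrow> spoly" where
  "pder = case_sum d_x d_th"

definition parity :: "idx \<Rightarrow> nat" where
  "parity a = (if isl a then 0 else 1)"

definition sg :: "idx \<Rightarrow> idx \<Rightarrow> real" where
  "sg a b = (if isl a \<or> isl b then 1 else - 1)"

definition mvars :: "smono \<Rightarrow> idx set" where
  "mvars u = Inl ` Poly_Mapping.keys (fst u) \<union> Inr ` fset (snd u)"

definition mdeg :: "smono \<Rightarrow> nat" where
  "mdeg u = (\<Sum>i\<in>Poly_Mapping.keys (fst u). Poly_Mapping.lookup (fst u) i) + fcard (snd u)"

text \<open>Arbitrary sets of variables are allowed, not only those given by \<open>m\<close> and
  \<open>n\<close>, because later arguments delete a single even variable or a pair of odd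
  ones.\<close>

definition polys :: "idx set \<Rightarrow> spoly set" where
  "polys J = {f. supp f \<subseteq> {u. mvars u \<subseteq> J}}"

definition hpolys :: "idx set \<Rightarrow> nat \<Rightarrow> spoly set" where
  "hpolys J k = {f. supp f \<subseteq> {u. mvars u \<subseteq> J \<and> mdeg u = k}}"

lemma sg_simps [simp]: "sg a b * sg a b = 1" "sg a b * (sg a b * r) = r"
  "sg (Inl i) b = 1" "sg a (Inl i) = 1" "sg (Inr i) (Inr j) = - 1"
  and sg_sym: "sg a b = sg b a"
  by (auto simp: sg_def)

lemma mult_scaleR [simp]:
  "(c *\<^sub>R f) * g = c *\<^sub>R (f * g)" "f * (c *\<^sub>R g) = c *\<^sub>R (f * g)" for f g :: spoly
  by auto

lemma subspace_polys: "subspace (polys J)" and subspace_hpolys: "subspace (hpolys J k)"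
  unfolding polys_def hpolys_def by (rule subspace_supp)+

lemmas polys_closed [simp, intro] =
  subspace_0[OF subspace_polys] subspace_add[OF subspace_polys] subspace_diff[OF subspace_polys]
  subspace_scale[OF subspace_polys] subspace_neg[OF subspace_polys] subspace_sum[OF subspace_polys]
lemmas hpolys_closed [simp, intro] =
  subspace_0[OF subspace_hpolys] subspace_add[OF subspace_hpolys] subspace_diff[OF subspace_hpolys]
  subspace_scale[OF subspace_hpolys] subspace_neg[OF subspace_hpolys] subspace_sum[OF subspace_hpolys]

lemma hpolys_polys: "f \<in> hpolys J k \<Longrightarrow> f \<in> polys J"
  by (auto simp: hpolys_def polys_def)

lemma hpolys_mono: "J \<subseteq> K \<Longrightarrow> f \<in> hpolys J k \<Longrightarrow> f \<in> hpolys K k"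
  by (auto simp: hpolys_def)

lemma mon_polys: "mon u \<in> polys J \<longleftrightarrow> mvars u \<subseteq> J"
  and mon_hpolys: "mon u \<in> hpolys J k \<longleftrightarrow> mvars u \<subseteq> J \<and> mdeg u = k"
  by (auto simp: polys_def hpolys_def)

lemma pdeg_superset:
  "finite A \<Longrightarrow> Poly_Mapping.keys a \<subseteq> A \<Longrightarrow>
    (\<Sum>i\<in>Poly_Mapping.keys a. Poly_Mapping.lookup a i) = (\<Sum>i\<in>A. Poly_Mapping.lookup a i)" for a :: "nat \<Rightarrow>\<^sub>0 nat"
  by (rule sum.mono_neutral_left) (auto simp: in_keys_iff)

lemma mdeg_plus:
  assumes "S |\<inter>| T = {||}"
  shows "mdeg (a + b, S |\<union>| T) = mdeg (a, S) + mdeg (b, T)"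
proof -
  let ?A = "Poly_Mapping.keys a \<union> Poly_Mapping.keys b"
  have "(\<Sum>i\<in>Poly_Mapping.keys c. Poly_Mapping.lookup c i) = (\<Sum>i\<in>?A. Poly_Mapping.lookup c i)"
    if "c \<in> {a, b, a + b}" for c
    by (rule pdeg_superset) (use that keys_add[of a b] in auto)
  then show ?thesis
    using fcard_funion_disjoint[OF assms]
    by (simp only: mdeg_def fst_conv snd_conv insert_iff simp_thms) (simp add: lookup_add sum.distrib)
qed

lemma mvars_plus: "mvars (a + b, S |\<union>| T) \<subseteq> mvars (a, S) \<union> mvars (b, T)"
  using keys_add[of a b] by (auto simp: mvars_def)

lemma polys_mult: "f \<in> polys J \<Longrightarrow> g \<in> polys J \<Longrightarrow> f * g \<in> polys J"
proof (rule mult_closed[OF subspace_polys])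
  fix u v assume *: "f \<in> polys J" "g \<in> polys J" "u \<in> supp f" "v \<in> supp g"
  then have "mvars u \<subseteq> J" "mvars v \<subseteq> J" by (auto simp: polys_def)
  then show "mono_mult u v \<in> polys J"
    using mvars_plus[of "fst u" "fst v" "snd u" "snd v"] 
    by (intro mono_mult_subspace subspace_polys) (auto simp: mon_polys)
qed

lemma hpolys_mult: "f \<in> hpolys J k \<Longrightarrow> g \<in> hpolys J l \<Longrightarrow> f * g \<in> hpolys J (k + l)"
proof (rule mult_closed[OF subspace_hpolys])
  fix u v assume *: "f \<in> hpolys J k" "g \<in> hpolys J l" "u \<in> supp f" "v \<in> supp g"
  obtain a S b T where uv: "u = (a, S)" "v = (b, T)" by (metis surj_pair)
  have "mvars u \<subseteq> J" "mvars v \<subseteq> J" "mdeg u = k" "mdeg v = l" using * by (auto simp: hpolys_def)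
  then have "mvars (a + b, S |\<union>| T) \<subseteq> J"
    using mvars_plus[of a b S T] unfolding uv by blast
  moreover have "mdeg (a + b, S |\<union>| T) = k + l" if "S |\<inter>| T = {||}"
    using mdeg_plus[OF that, of a b] \<open>mdeg u = k\<close> \<open>mdeg v = l\<close> unfolding uv by simp
  ultimately show "mono_mult u v \<in> hpolys J (k + l)"
    unfolding uv by (auto intro!: subspace_scale[OF subspace_hpolys] simp: mon_hpolys)
qed

lemma var_hpolys: "a \<in> J \<Longrightarrow> var a \<in> hpolys J 1"
  by (auto simp: var_def x_var_def th_var_def mon_hpolys mvars_def mdeg_def fcard.rep_eq split: sum.split)

lemma var_polys: "a \<in> J \<Longrightarrow> var a \<in> polys J"
  by (rule hpolys_polys[OF var_hpolys])

lemma one_hpolys [simp]: "1 \<in> hpolys J 0" and one_polys [simp]: "1 \<in> polys J"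
  by (simp_all add: one_spoly_def mon_hpolys mon_polys mvars_def mdeg_def fcard.rep_eq)

lemma var_mult_hpolys: "a \<in> J \<Longrightarrow> f \<in> hpolys J k \<Longrightarrow> var a * f \<in> hpolys J (Suc k)"
  using hpolys_mult[OF var_hpolys, of a J f k] by simp

lemma var_mult_polys: "a \<in> J \<Longrightarrow> f \<in> polys J \<Longrightarrow> var a * f \<in> polys J"
  using polys_mult[OF var_polys] by simp

lemma mdeg_0: "mdeg u = 0 \<Longrightarrow> u = (0, {||})"
proof -
  assume "mdeg u = 0"
  then have "fcard (snd u) = 0" "\<forall>i\<in>Poly_Mapping.keys (fst u). Poly_Mapping.lookup (fst u) i = 0"
    by (auto simp: mdeg_def)
  then have "Poly_Mapping.keys (fst u) = {}" "snd u = {||}" by (auto simp: in_keys_iff intro!: poly_mapping_eqI)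
  then show ?thesis by (cases u) simp
qed

lemma mon_factor:
  assumes "mdeg u = Suc k"
  obtains a v c where "a \<in> mvars u" "mvars v \<subseteq> mvars u" "mdeg v = k" "mon u = c *\<^sub>R (var a * mon v)"
proof -
  obtain b S where u: "u = (b, S)" by (metis surj_pair)
  show thesis
  proof (cases "b = 0")
    case False
    then obtain i where i: "i \<in> Poly_Mapping.keys b" by fastforce
    define e where "e = Poly_Mapping.single i (1::nat)"
    have b: "e + (b - e) = b"
      using i by (intro poly_mapping_eqI) (auto simp: e_def in_keys_iff lookup_add lookup_minus lookup_single when_def)
    have "mon u = 1 *\<^sub>R (var (Inl i) * mon (b - e, S))"
      by (simp add: u var_def x_var_def mon_mult e_def[simplified, symmetric] b)
    moreover have "mdeg u = mdeg (e, {||}) + mdeg (b - e, S)"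
      using mdeg_plus[of "{||}" S e "b - e"] by (simp add: b u)
    then have "mdeg (b - e, S) = k" using assms by (simp add: mdeg_def e_def fcard.rep_eq)
    moreover have "mvars (b - e, S) \<subseteq> mvars u" by (auto simp: mvars_def u in_keys_iff lookup_minus)
    ultimately show thesis using that[of "Inl i" "(b - e, S)" 1] i by (auto simp: u mvars_def)
  next
    case True
    then have "S \<noteq> {||}" using assms by (auto simp: u mdeg_def fcard.rep_eq)
    then obtain j where j: "j |\<in>| S" by auto
    \<comment> \<open>The sign for moving the \<open>j\<close>-th odd variable to the front; it is
      its own inverse.\<close>
    define c :: real where "c = (-1) ^ inversions {|j|} (S |-| {|j|})"
    have S: "{|j|} |\<inter>| (S |-| {|j|}) = {||}" "{|j|} |\<union>| (S |-| {|j|}) = S" "finsert j S = S" using j by auto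
    have "var (Inr j) * mon (0, S |-| {|j|}) = c *\<^sub>R mon u"
      by (simp add: u var_def th_var_def mon_mult True S c_def)
    then have "mon u = c *\<^sub>R (var (Inr j) * mon (0, S |-| {|j|}))"
      by (simp add: c_def power_mult_distrib[symmetric])
    moreover have "mdeg u = mdeg (0, {|j|}) + mdeg (0, S |-| {|j|})"
      using mdeg_plus[OF S(1), of 0 0] by (simp add: u True S)
    then have "mdeg (0, S |-| {|j|}) = k" using assms by (simp add: mdeg_def fcard.rep_eq)
    moreover have "mvars (0, S |-| {|j|}) \<subseteq> mvars u" by (auto simp: mvars_def u)
    ultimately show thesis using that[of "Inr j" "(0, S |-| {|j|})" c] j by (auto simp: u mvars_def)
  qed
qed

section \<open>Induction over products of variables\<close>

lemma supp_induct:
  assumes "supp f \<subseteq> Q" "P 0" "\<And>u. u \<in> Q \<Longrightarrow> P (mon u)"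
    "\<And>f g. supp f \<subseteq> Q \<Longrightarrow> supp g \<subseteq> Q \<Longrightarrow> P f \<Longrightarrow> P g \<Longrightarrow> P (f + g)"
    "\<And>c f. supp f \<subseteq> Q \<Longrightarrow> P f \<Longrightarrow> P (c *\<^sub>R f)"
  shows "P f"
proof -
  have "P (\<Sum>u\<in>A. coeff f u *\<^sub>R mon u) \<and> supp (\<Sum>u\<in>A. coeff f u *\<^sub>R mon u) \<subseteq> Q"
    if "finite A" "A \<subseteq> supp f" for A
    using that
  proof (induction A rule: finite_induct)
    case (insert u A)
    have *: "supp (coeff f u *\<^sub>R mon u) \<subseteq> Q" using supp_scaleR[of "coeff f u" "mon u"] insert.prems assms(1) by auto
    have u: "u \<in> Q" using assms(1) insert.prems by auto
    have "P (coeff f u *\<^sub>R mon u)" by (rule assms(5)) (use u assms(3)[OF u] in simp_all)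
    with insert * show ?case
      using assms(4) supp_add[of "coeff f u *\<^sub>R mon u" "\<Sum>u\<in>A. coeff f u *\<^sub>R mon u"] by auto
  qed (simp add: assms(2))
  from this[of "supp f"] show ?thesis using lin_ext_id[of f] by (simp add: lin_ext_def)
qed

text \<open>All operators below obey a product rule for left multiplication by one variable, so in
  applications only the case \<open>var\<close> has content. The degree is an argument of
  \<open>P\<close> because it changes in that case.\<close>

lemma hpolys_induct [consumes 1, case_names zero one var add scale]:
  assumes "f \<in> hpolys J k" "\<And>k. P k 0" "P 0 1"
    "\<And>a k g. a \<in> J \<Longrightarrow> g \<in> hpolys J k \<Longrightarrow> P k g \<Longrightarrow> P (Suc k) (var a * g)"
    "\<And>k f g. f \<in> hpolys J k \<Longrightarrow> g \<in> hpolys J k \<Longrightarrow> P k f \<Longrightarrow> P k g \<Longrightarrow> P k (f + g)"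
    "\<And>k c f. f \<in> hpolys J k \<Longrightarrow> P k f \<Longrightarrow> P k (c *\<^sub>R f)"
  shows "P k f"
proof -
  have m: "P k (mon u)" if "mvars u \<subseteq> J" "mdeg u = k" for u k
    using that
  proof (induction k arbitrary: u)
    case 0
    then show ?case using assms(3) mdeg_0[of u] by (simp add: one_spoly_def)
  next
    case (Suc k)
    obtain a v c where av: "a \<in> mvars u" "mvars v \<subseteq> mvars u" "mdeg v = k" "mon u = c *\<^sub>R (var a * mon v)"
      using mon_factor[OF Suc.prems(2)] by blast
    then have *: "a \<in> J" "mvars v \<subseteq> J" using Suc.prems by auto
    then have "mon v \<in> hpolys J k" "P k (mon v)" using Suc.IH av by (auto simp: mon_hpolys)
    then have "P (Suc k) (var a * mon v)" "var a * mon v \<in> hpolys J (Suc k)"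
      using assms(4) var_mult_hpolys *(1) by auto
    then show ?case unfolding av(4) by (rule assms(6)[rotated])
  qed
  show ?thesis
    by (rule supp_induct[of f "{u. mvars u \<subseteq> J \<and> mdeg u = k}"])
      (use assms m in \<open>auto simp: hpolys_def\<close>)
qed

lemma polys_induct [consumes 1, case_names zero one var add scale]:
  assumes "f \<in> polys J" "P 0" "P 1"
    "\<And>a g. a \<in> J \<Longrightarrow> g \<in> polys J \<Longrightarrow> P g \<Longrightarrow> P (var a * g)"
    "\<And>f g. f \<in> polys J \<Longrightarrow> g \<in> polys J \<Longrightarrow> P f \<Longrightarrow> P g \<Longrightarrow> P (f + g)"
    "\<And>c f. f \<in> polys J \<Longrightarrow> P f \<Longrightarrow> P (c *\<^sub>R f)"
  shows "P f"
proof (rule supp_induct[of f "{u. mvars u \<subseteq> J}"])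
  fix u assume u: "u \<in> {u. mvars u \<subseteq> J}"
  then have "mon u \<in> hpolys J (mdeg u)" by (simp add: mon_hpolys)
  then show "P (mon u)"
    by (rule hpolys_induct[where P = "\<lambda>_. P"]) (use assms hpolys_polys in auto)
qed (use assms in \<open>auto simp: polys_def\<close>)

lemma polys_UNIV [simp]: "f \<in> polys UNIV"
  by (simp add: polys_def)

lemma linear_eq_on_polys:
  assumes "f \<in> polys J" "linear F" "linear G" "F 1 = (G 1 :: 'v::real_vector)"
    "\<And>a g. a \<in> J \<Longrightarrow> g \<in> polys J \<Longrightarrow> F g = G g \<Longrightarrow> F (var a * g) = G (var a * g)"
  shows "F f = G f"
  using assms(1)
proof (induction f rule: polys_induct)
  case zero
  show ?case by (simp add: linear_0[OF assms(2)] linear_0[OF assms(3)])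
qed (use assms in \<open>auto simp: linear_add linear_scale\<close>)

lemmas linear_eqI = linear_eq_on_polys[OF polys_UNIV]

section \<open>Calculus of the partial derivatives\<close>

lemma linear_pder: "linear (pder a)"
  by (cases a) (simp_all add: pder_def d_x_def d_th_def linear_lin_ext)

lemmas pder_linear [simp] =
  linear_0[OF linear_pder] linear_add[OF linear_pder] linear_diff[OF linear_pder]
  linear_scale[OF linear_pder] linear_neg[OF linear_pder] linear_sum[OF linear_pder]

lemma pder_superderivation: "hom_superderivation UNIV (parity a) (pder a)"
  by (cases a) (simp_all add: pder_def parity_def d_x_superderivation d_th_superderivation[simplified])

lemma var_super_part: "var a \<in> super_part (parity a)"
  by (cases a) (simp_all add: var_def parity_def x_var_def th_var_def mon_super_part fcard.rep_eq)

lemma sg_parity: "(- 1) ^ (parity a * parity b) = sg a b"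
  by (simp add: sg_def parity_def)

lemma pder_mult:
  "f \<in> super_part q \<Longrightarrow> pder a (f * g) = pder a f * g + (- 1) ^ (parity a * q) *\<^sub>R (f * pder a g)"
  using pder_superderivation[of a] by (simp add: hom_superderivation_def)

lemma pder_super_part: "f \<in> super_part q \<Longrightarrow> pder a f \<in> super_part (parity a + q)"
  using pder_superderivation[of a] unfolding hom_superderivation_def by blast

lemma pder_var1: "pder a (var b) = (if a = b then 1 else 0)"
  by (cases a; cases b) (auto simp: pder_def var_def)

lemma pder_var: "pder a (var b * f) = (if a = b then f else 0) + sg a b *\<^sub>R (var b * pder a f)"
  using pder_mult[OF var_super_part, of a b f] by (simp add: pder_var1 sg_parity)

lemma pder_1 [simp]: "pder a 1 = 0"
  by (cases a) (simp_all add: pder_def one_spoly_def d_x_def d_th_def)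

lemma inversions_singletons: "inversions {|i|} {|j|} = (if j < i then 1 else 0)"
proof -
  have "{s. s |\<in>| {|j|} \<and> s < i} = (if j < i then {j} else {})" by auto
  then show ?thesis by (simp add: inversions_singleton_left below_def)
qed

lemma var_comm1: "var a * var b = sg a b *\<^sub>R (var b * var a)"
proof (cases a; cases b)
  fix i j assume *: "a = Inr i" "b = Inr j"
  have "{|i, j|} = {|j, i|}" by auto
  then show ?thesis using *
    by (cases i j rule: linorder_cases)
      (auto simp: var_def x_var_def th_var_def mon_mult add.commute inversions_singletons)
qed (simp_all add: var_def x_var_def th_var_def mon_mult add.commute)

lemma var_comm: "var a * (var b * f) = sg a b *\<^sub>R (var b * (var a * f))"
  by (simp add: mult.assoc[symmetric] var_comm1[of a b])

lemma pder_comm: "pder a (pder b f) = sg a b *\<^sub>R pder b (pder a f)"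
proof (rule linear_eqI[of "\<lambda>f. pder a (pder b f)"])
  show "linear (\<lambda>f. pder a (pder b f))" "linear (\<lambda>f. sg a b *\<^sub>R pder b (pder a f))"
    by (auto intro!: linearI simp: scaleR_add_right)
  fix c g assume *: "pder a (pder b g) = sg a b *\<^sub>R pder b (pder a g)"
  have s: "sg a b * sg b a = 1" by (metis sg_simps(1) sg_sym)
  show "pder a (pder b (var c * g)) = sg a b *\<^sub>R pder b (pder a (var c * g))"
  proof (cases "a = b")
    case True
    from * have "var c * pder b (pder b g) = sg b b *\<^sub>R (var c * pder b (pder b g))"
      unfolding True by (metis mult_scaleR(2))
    then show ?thesis by (cases "b = c") (auto simp: True pder_var scaleR_add_right)
  next
    case False
    then show ?thesis using * s
      by (cases "a = c"; cases "b = c") (auto simp: pder_var scaleR_add_right sg_sym)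
  qed
qed simp

lemma pder_hpolys:
  assumes "f \<in> hpolys J k"
  shows "pder a f \<in> hpolys J (k - 1) \<and> (k = 0 \<longrightarrow> pder a f = 0) \<and> (a \<notin> J \<longrightarrow> pder a f = 0)"
  using assms
proof (induction rule: hpolys_induct)
  case (var b k g)
  have "var b * pder a g \<in> hpolys J k"
    using var var_mult_hpolys[of b J "pder a g" "k - 1"] by (cases k) auto
  then show ?case using var by (auto simp: pder_var)
qed auto

lemma pder_hpolys_Suc: "f \<in> hpolys J (Suc k) \<Longrightarrow> pder a f \<in> hpolys J k"
  and pder_hpolys_0: "f \<in> hpolys J 0 \<Longrightarrow> pder a f = 0"
  using pder_hpolys[of f J "Suc k" a] pder_hpolys[of f J 0 a] by auto

lemma pder_polys: 
  assumes "f \<in> polys J"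
  shows "pder a f \<in> polys J \<and> (a \<notin> J \<longrightarrow> pder a f = 0)"
  using assms
proof (induction rule: polys_induct)
  case (var b g)
  then show ?case by (auto simp: pder_var intro!: var_mult_polys)
qed auto

lemma pder_outside: "f \<in> polys J \<Longrightarrow> a \<notin> J \<Longrightarrow> pder a f = 0"
  using pder_polys by blast

lemma hpolys_0: "f \<in> hpolys J 0 \<Longrightarrow> \<exists>c. f = c *\<^sub>R 1"
proof (intro exI spoly_eqI)
  fix u assume "f \<in> hpolys J 0"
  then have "u \<notin> supp f" if "u \<noteq> (0, {||})" using that mdeg_0[of u] by (auto simp: hpolys_def)
  then show "coeff f u = coeff (coeff f (0, {||}) *\<^sub>R 1) u" by (auto simp: one_spoly_def coeff_mon supp_iff)
qed

text \<open>Moving \<open>var b\<close> to the left past \<open>var a\<close> and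
  \<open>pder a\<close> produces the same sign twice, so the sum commutes with \<open>var b\<close>
  except for the term \<open>a = b\<close>.\<close>

lemma euler:
  assumes J: "finite J" and f: "f \<in> hpolys J k"
  shows "(\<Sum>a\<in>J. var a * pder a f) = real k *\<^sub>R f"
  using f
proof (induction rule: hpolys_induct)
  case (var b k g)
  have "(\<Sum>a\<in>J. var a * pder a (var b * g))
      = (\<Sum>a\<in>J. if a = b then var b * g else 0) + (\<Sum>a\<in>J. var b * (var a * pder a g))"
    unfolding sum.distrib[symmetric]
    by (intro sum.cong) (auto simp: pder_var distrib_left var_comm[of _ b])
  also have "\<dots> = real (Suc k) *\<^sub>R (var b * g)"
    using var J by (simp add: sum_distrib_left[symmetric] algebra_simps)
  finally show ?case .
qed (auto simp: distrib_left sum.distrib scaleR_add_right scaleR_sum_right[symmetric])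

section \<open>The Laplace operator, the radius and the orthosymplectic operators\<close>

text \<open>
  Indices are raised with the inverse of the form \<open>R\<^sup>2\<close>, which pairs \<open>\<theta>\<^bsub>2j-1\<^esub>\<close> with
  \<open>\<theta>\<^bsub>2j\<^esub>\<close>. The factors are chosen such that \<open>[\<Delta>, X\<^sub>a] = 2 \<partial>\<^sup>a\<close>,
  \<open>\<partial>\<^sup>a R\<^sup>2 = 2 X\<^sub>a\<close>, \<open>\<Delta> = \<Sum>\<^sub>a \<partial>\<^sup>a \<partial>\<^sub>a\<close> and
  \<open>R\<^sup>2 = \<Sum>\<^sub>a X\<^sub>a X\<^sup>a\<close>.
\<close>

definition dual :: "idx \<Rightarrow> idx" where
  "dual = case_sum Inl (\<lambda>j. Inr (if odd j then Suc j else j - 1))"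

definition metric :: "idx \<Rightarrow> real" where
  "metric = case_sum (\<lambda>i. 1) (\<lambda>j. if odd j then 2 else - 2)"

definition uder :: "idx \<Rightarrow> spoly \<Rightarrow> spoly" where
  "uder a f = metric a *\<^sub>R pder (dual a) f"

definition uvar :: "idx \<Rightarrow> spoly" where
  "uvar a = (sg a a / metric a) *\<^sub>R var (dual a)"

definition lap :: "idx set \<Rightarrow> spoly \<Rightarrow> spoly" where
  "lap J f = (\<Sum>a\<in>J. uder a (pder a f))"

definition rsq :: "idx set \<Rightarrow> spoly" where
  "rsq J = (\<Sum>a\<in>J. var a * uvar a)"

text \<open>For even indices this is the infinitesimal rotation of a plane. For two odd indices the
  sign makes it symmetric in \<open>a\<close> and \<open>b\<close>, which gives the symplectic part;
  mixed indices give the odd part of the algebra.\<close>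

definition rot :: "idx \<Rightarrow> idx \<Rightarrow> spoly \<Rightarrow> spoly" where
  "rot a b f = var a * uder b f - sg a b *\<^sub>R (var b * uder a f)"

definition sdim :: "idx set \<Rightarrow> real" where
  "sdim J = (\<Sum>a\<in>J. sg a a)"

text \<open>The index \<open>0\<close> is excluded because it is its own dual.\<close>

definition symplectic_set :: "idx set \<Rightarrow> bool" where
  "symplectic_set J \<longleftrightarrow> finite J \<and> Inr 0 \<notin> J \<and> dual ` J \<subseteq> J"

lemma symplectic_setD:
  "symplectic_set J \<Longrightarrow> finite J" "symplectic_set J \<Longrightarrow> a \<in> J \<Longrightarrow> dual a \<in> J"
  "symplectic_set J \<Longrightarrow> a \<in> J \<Longrightarrow> a \<noteq> Inr 0"
  by (auto simp: symplectic_set_def)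

lemma dual_dual [simp]: "dual (dual a) = a"
  by (cases a) (auto simp: dual_def elim: oddE)

lemma dual_inject [simp]: "dual a = dual b \<longleftrightarrow> a = b"
  by (metis dual_dual)

lemma dual_Inl [simp]: "dual (Inl i) = Inl i" "metric (Inl i) = 1"
  "dual a = Inl i \<longleftrightarrow> a = Inl i" "Inl i = dual a \<longleftrightarrow> a = Inl i"
  by (auto simp: dual_def metric_def split: sum.splits)

lemma sg_dual [simp]: "sg (dual a) b = sg a b" "sg b (dual a) = sg b a"
  by (auto simp: sg_def dual_def split: sum.split)

lemma metric_nz [simp]: "metric a \<noteq> 0"
  by (auto simp: metric_def split: sum.split)

lemma metric_dual: "a \<noteq> Inr 0 \<Longrightarrow> metric (dual a) = sg a a * metric a"
  by (cases a) (auto simp: metric_def dual_def sg_def elim: oddE)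

lemma sg_mult: "sg a b = 1 \<or> sg a b = - 1"
  by (auto simp: sg_def)

lemma dual_notin: "symplectic_set J \<Longrightarrow> dual a \<in> J \<longleftrightarrow> a \<in> J"
  using symplectic_setD(2)[of J] by (metis dual_dual)

section \<open>Commutation rules of raised derivatives, Laplacian and radius\<close>

lemma linear_uder: "linear (uder a)"
  unfolding uder_def by (intro linearI) (simp_all add: scaleR_add_right)

lemmas uder_linear [simp] =
  linear_0[OF linear_uder] linear_add[OF linear_uder] linear_diff[OF linear_uder]
  linear_scale[OF linear_uder] linear_neg[OF linear_uder] linear_sum[OF linear_uder]

lemma linear_lap: "linear (lap J)"
  unfolding lap_def by (intro linearI) (simp_all add: sum.distrib scaleR_sum_right)

lemmas lap_linear [simp] =
  linear_0[OF linear_lap] linear_add[OF linear_lap] linear_diff[OF linear_lap]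
  linear_scale[OF linear_lap] linear_neg[OF linear_lap] linear_sum[OF linear_lap]

lemma linear_rot: "linear (rot a b)"
  unfolding rot_def by (intro linearI) (simp_all add: algebra_simps)

lemmas rot_linear [simp] =
  linear_0[OF linear_rot] linear_add[OF linear_rot] linear_diff[OF linear_rot]
  linear_scale[OF linear_rot] linear_neg[OF linear_rot] linear_sum[OF linear_rot]

lemma uder_1 [simp]: "uder a 1 = 0"
  by (simp add: uder_def)

lemma uder_var:
  "uder a (var b * f) = (if a = dual b then metric a *\<^sub>R f else 0) + sg a b *\<^sub>R (var b * uder a f)"
  unfolding uder_def
  by (cases "a = dual b") (auto simp: pder_var scaleR_add_right scaleR_left_commute mult.commute)

lemma uder_uvar:
  assumes "a \<noteq> Inr 0"
  shows "uder b (uvar a * f) = (if a = b then sg a a *\<^sub>R f else 0) + sg a b *\<^sub>R (uvar a * uder b f)"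
  by (auto simp: uvar_def uder_var scaleR_add_right mult.commute sg_sym[of b a])

lemma uvar_var: "uvar a * (var b * f) = sg a b *\<^sub>R (var b * (uvar a * f))"
  by (auto simp: uvar_def var_comm[of "dual a" b] mult.commute)

lemma uder_pder: "uder a (pder b f) = sg a b *\<^sub>R pder b (uder a f)"
  by (simp add: uder_def pder_comm[of "dual a" b f] scaleR_left_commute)

lemma uder_comm: "uder a (uder b f) = sg a b *\<^sub>R uder b (uder a f)"
  by (simp add: uder_def pder_comm[of "dual a" "dual b" f] mult.commute mult.left_commute)

lemma pder_lap: "pder c (lap J f) = lap J (pder c f)"
proof -
  have "pder c (uder a (pder a f)) = uder a (pder a (pder c f))" for a
    using sg_simps(1)[of a c] sg_sym[of a c]
    by (simp add: uder_pder[of a c] pder_comm[of a c f])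
  then show ?thesis by (simp add: lap_def)
qed

lemma uder_lap: "uder c (lap J f) = lap J (uder c f)"
  by (simp add: uder_def pder_lap)

lemma lap_1 [simp]: "lap J 1 = 0"
  by (simp add: lap_def)

lemma lap_var:
  assumes J: "symplectic_set J"
  shows "lap J (var b * f) = var b * lap J f + (if b \<in> J then 2 *\<^sub>R uder b f else 0)"
proof -
  \<comment> \<open>The terms \<open>a = b\<close> and \<open>a = dual b\<close> of the Laplacian
    contribute \<open>uder b f\<close> each; for even \<open>b\<close> both come from the same
    summand.\<close>
  have "uder a (pder a (var b * f)) = (if a = b then uder b f else 0)
      + (if a = dual b then (if b \<in> J then uder b f else 0) else 0) + var b * uder a (pder a f)" 
    if "a \<in> J" for a
  proof -
    have "sg a b *\<^sub>R metric a *\<^sub>R pder a f = uder b f" if "a = dual b"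
      using metric_dual[of a] symplectic_setD(3)[OF J \<open>a \<in> J\<close>] that sg_mult[of b b]
      by (auto simp: uder_def)
    moreover have "b \<in> J" if "a = dual b" using symplectic_setD(2)[OF J \<open>a \<in> J\<close>] that by simp
    ultimately show ?thesis by (auto simp: pder_var uder_var scaleR_add_right)
  qed
  then show ?thesis
    using symplectic_setD(1,2)[OF J] 
    by (auto simp: lap_def sum.distrib sum_distrib_left[symmetric] scaleR_2 dual_notin[OF J])
qed

lemma lap_uvar:
  assumes J: "symplectic_set J" and a: "a \<in> J"
  shows "lap J (uvar a * f) = uvar a * lap J f + 2 *\<^sub>R pder a f"
  using metric_dual[of a] symplectic_setD[OF J] a sg_mult[of a a]
  by (auto simp: uvar_def lap_var[OF J] uder_def scaleR_add_right)

lemma rsq_var: "rsq J * (var b * f) = var b * (rsq J * f)"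
  by (simp add: rsq_def sum_distrib_right sum_distrib_left mult.assoc uvar_var var_comm[of _ b])

lemma uder_rsq:
  assumes J: "symplectic_set J"
  shows "uder b (rsq J * f) = rsq J * uder b f + (if b \<in> J then 2 *\<^sub>R (var b * f) else 0)"
proof -
  have "uder b (var a * (uvar a * f)) = (if a = dual b then (if b \<in> J then var b * f else 0) else 0)
      + (if a = b then var b * f else 0) + var a * (uvar a * uder b f)" if a: "a \<in> J" for a
  proof -
    have "metric b *\<^sub>R (uvar a * f) = var b * f" if "a = dual b"
      using metric_dual[of a] symplectic_setD(3)[OF J a] that sg_mult[of b b]
      by (auto simp: uvar_def)
    moreover have "b \<in> J" if "a = dual b" using symplectic_setD(2)[OF J a] that by simp
    ultimately show ?thesis using symplectic_setD(3)[OF J a] sg_sym[of a b]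
      by (auto simp: uder_var uder_uvar distrib_left scaleR_add_right)
  qed
  then show ?thesis
    using symplectic_setD(1,2)[OF J]
    by (auto simp: rsq_def sum_distrib_right mult.assoc sum.distrib scaleR_2 dual_notin[OF J])
qed

text \<open>The commutator of the Laplacian with \<open>rot a b\<close> is twice the supercommutator
  of \<open>uder a\<close> and \<open>uder b\<close>, which is 0.\<close>

lemma rot_lap:
  assumes J: "symplectic_set J" and "a \<in> J" "b \<in> J"
  shows "lap J (rot a b f) = rot a b (lap J f)"
  using assms(2,3) by (simp add: rot_def lap_var[OF J] uder_lap uder_comm[of b a] sg_sym[of b a] algebra_simps)

text \<open>Differentiating R^2 leaves twice the supercommutator of \<open>var a\<close> and
  \<open>var b\<close>, which is 0.\<close>

lemma rot_rsq:
  assumes J: "symplectic_set J" and "a \<in> J" "b \<in> J"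
  shows "rot a b (rsq J * f) = rsq J * rot a b f"
  using assms(2,3) by (simp add: rot_def uder_rsq[OF J] rsq_var var_comm[of b a] sg_sym[of b a] algebra_simps)

lemma rot_var:
  assumes "c \<noteq> dual a" "c \<noteq> dual b"
  shows "rot a b (var c * f) = (sg a c * sg b c) *\<^sub>R (var c * rot a b f)"
proof -
  have "b \<noteq> dual c" "a \<noteq> dual c" using assms by auto
  then show ?thesis
    by (simp add: rot_def uder_var var_comm[of _ c] algebra_simps)
qed

lemma rot_hpolys:
  assumes "a \<in> J" "b \<in> J" "f \<in> hpolys J k"
  shows "rot a b f \<in> hpolys J k"
proof (cases k)
  case 0
  then show ?thesis using pder_hpolys_0[of f J] assms by (simp add: rot_def uder_def)
next
  case (Suc l)
  then have "var c * uder d f \<in> hpolys J k" if "c \<in> J" for c d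
    using pder_hpolys_Suc[of f J l "dual d"] assms that var_mult_hpolys[of c J _ l]
    by (simp add: uder_def)
  then show ?thesis using assms unfolding rot_def by blast
qed

lemma lap_hpolys: "f \<in> hpolys J (Suc (Suc k)) \<Longrightarrow> lap J f \<in> hpolys J k"
  unfolding lap_def uder_def using pder_hpolys_Suc by blast

lemma lap_hpolys_low: "f \<in> hpolys J k \<Longrightarrow> k < 2 \<Longrightarrow> lap J f = 0"
proof -
  assume f: "f \<in> hpolys J k" "k < 2"
  have "pder a (pder b f) = 0" for a b
    using f pder_hpolys_0[of f J b] pder_hpolys_Suc[of f J 0 b] pder_hpolys_0[of "pder b f" J a] 
    by (cases k) (auto simp: less_2_cases_iff)
  then show ?thesis by (simp add: lap_def uder_def)
qed

lemma lap_hpolys': "f \<in> hpolys J k \<Longrightarrow> lap J f \<in> hpolys J (k - 2)"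
  using lap_hpolys[of f J "k - 2"] lap_hpolys_low[of f J k]
  by (cases "k < 2") (auto simp: Suc_diff_Suc numeral_2_eq_2)

lemma lap_polys: "f \<in> polys J \<Longrightarrow> lap J f \<in> polys J"
  unfolding lap_def uder_def using pder_polys[of _ J]
  by (intro polys_closed(4,6)) simp

lemma rsq_hpolys: 
  assumes J: "symplectic_set J" shows "rsq J \<in> hpolys J 2"
proof -
  have "var a * var (dual a) \<in> hpolys J 2" if "a \<in> J" for a
    using var_mult_hpolys[OF that var_hpolys[OF symplectic_setD(2)[OF J that]]] by (simp add: numeral_2_eq_2)
  then have "var a * uvar a \<in> hpolys J 2" if "a \<in> J" for a
    using that by (simp add: uvar_def hpolys_closed(4))
  then show ?thesis unfolding rsq_def by (rule hpolys_closed(6))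
qed

lemma rsq_mult_hpolys: "symplectic_set J \<Longrightarrow> f \<in> hpolys J k \<Longrightarrow> rsq J * f \<in> hpolys J (Suc (Suc k))"
  using hpolys_mult[OF rsq_hpolys, of J f k] by simp

lemma rsq_lap_hpolys:
  assumes "symplectic_set J" "f \<in> hpolys J k"
  shows "rsq J * lap J f \<in> hpolys J k"
proof (cases "k < 2")
  case False
  then have k: "k = Suc (Suc (k - 2))" by simp
  then show ?thesis using assms rsq_mult_hpolys lap_hpolys by metis
qed (use lap_hpolys_low[OF assms(2)] in simp)

lemma uvar_uder_sum:
  assumes J: "symplectic_set J"
  shows "(\<Sum>a\<in>J. sg a a *\<^sub>R (uvar a * uder a f)) = (\<Sum>a\<in>J. var a * pder a f)"
proof -
  have "sg a a *\<^sub>R (uvar a * uder a f) = var (dual a) * pder (dual a) f" for a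
    by (simp add: uvar_def uder_def)
  moreover have "bij_betw dual J J"
    by (rule bij_betwI[where g = dual]) (use symplectic_setD(2)[OF J] in auto)
  ultimately show ?thesis
    using sum.reindex_bij_betw[of dual J J "\<lambda>a. var a * pder a f"] by simp
qed

text \<open>This is the sl(2) relation. The Euler operator occurs twice, once with lowered
  derivatives and once, through \<open>uvar_uder_sum\<close>, with raised ones; the superdimension
  counts the derivatives of the variables themselves.\<close>

lemma lap_rsq:
  assumes J: "symplectic_set J" and f: "f \<in> hpolys J k"
  shows "lap J (rsq J * f) = rsq J * lap J f + (4 * real k + 2 * sdim J) *\<^sub>R f"
proof -
  have "lap J (rsq J * f) = (\<Sum>a\<in>J. lap J (var a * (uvar a * f)))"
    by (simp add: rsq_def sum_distrib_right mult.assoc)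
  also have "\<dots> = (\<Sum>a\<in>J. var a * (uvar a * lap J f) + 2 *\<^sub>R (var a * pder a f)
      + 2 *\<^sub>R (sg a a *\<^sub>R f) + 2 *\<^sub>R (sg a a *\<^sub>R (uvar a * uder a f)))"
    by (intro sum.cong refl)
      (simp add: lap_var[OF J] lap_uvar[OF J] uder_uvar symplectic_setD(3)[OF J] algebra_simps)
  also have "\<dots> = rsq J * lap J f + 2 *\<^sub>R (\<Sum>a\<in>J. var a * pder a f) + 2 *\<^sub>R (sdim J *\<^sub>R f)
      + 2 *\<^sub>R (\<Sum>a\<in>J. sg a a *\<^sub>R (uvar a * uder a f))"
    by (simp add: sum.distrib scaleR_sum_right rsq_def sum_distrib_right mult.assoc sdim_def scaleR_sum_left)
  also have "\<dots> = rsq J * lap J f + ((2 * real k) *\<^sub>R f + (2 * sdim J) *\<^sub>R f + (2 * real k) *\<^sub>R f)"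
    by (simp add: uvar_uder_sum[OF J] euler[OF symplectic_setD(1)[OF J] f])
  finally show ?thesis by (simp flip: scaleR_add_left)
qed

text \<open>The coefficients raise both indices. The scalar is twice k (k + M - 2), up to sign the
  eigenvalue of the angular Laplacian on harmonics of degree k.\<close>

lemma casimir:
  assumes J: "symplectic_set J" and f: "f \<in> hpolys J k"
  shows "(\<Sum>a\<in>J. \<Sum>b\<in>J. (sg a a * sg b b / (metric a * metric b)) *\<^sub>R rot a b (rot (dual b) (dual a) f))
      = (2 * real k * (real k + sdim J - 2)) *\<^sub>R f - 2 *\<^sub>R (rsq J * lap J f)"
proof -
  \<comment> \<open>Of the four products in a square of rotations, those in \<open>A\<close> pair an
    index with itself and yield Euler operators, those in \<open>B\<close> yield R^2 Delta. The
    other two products arise by exchanging \<open>a\<close> and \<open>b\<close>.\<close>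
  define A where "A a b = var a * uder b (uvar b * pder a f)" for a b
  define B where "B a b = - sg a b *\<^sub>R (var a * uder b (uvar a * pder b f))" for a b
  have *: "(sg a a * sg b b / (metric a * metric b)) *\<^sub>R rot a b (rot (dual b) (dual a) f)
      = A a b + B a b + (A b a + B b a)" if ab: "a \<in> J" "b \<in> J" for a b
  proof -
    have "(sg a a * sg b b / (metric a * metric b)) *\<^sub>R rot (dual b) (dual a) f
        = uvar b * pder a f - sg a b *\<^sub>R (uvar a * pder b f)"
      using ab by (simp add: rot_def uder_def uvar_def metric_dual symplectic_setD(3)[OF J]
          algebra_simps sg_sym[of b a])
    then have "(sg a a * sg b b / (metric a * metric b)) *\<^sub>R rot a b (rot (dual b) (dual a) f)
        = rot a b (uvar b * pder a f - sg a b *\<^sub>R (uvar a * pder b f))"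
      by (metis rot_linear(4))
    also have "\<dots> = A a b + B a b + (A b a + B b a)"
      unfolding rot_def A_def B_def by (simp add: sg_sym[of b a] algebra_simps)
    finally show ?thesis .
  qed
  have A: "(\<Sum>a\<in>J. \<Sum>b\<in>J. A a b) = (real k * (real k + sdim J - 1)) *\<^sub>R f"
  proof -
    have "(\<Sum>b\<in>J. A a b) = (real k + sdim J - 1) *\<^sub>R (var a * pder a f)" for a
    proof -
      have "(\<Sum>b\<in>J. A a b) = var a * (\<Sum>b\<in>J. sg b b *\<^sub>R pder a f + sg b b *\<^sub>R (uvar b * uder b (pder a f)))"
        by (simp add: A_def sum_distrib_left uder_uvar symplectic_setD(3)[OF J])
      also have "\<dots> = var a * (sdim J *\<^sub>R pder a f + (\<Sum>b\<in>J. var b * pder b (pder a f)))"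
        by (simp add: sum.distrib uvar_uder_sum[OF J] sdim_def scaleR_sum_left)
      also have "(\<Sum>b\<in>J. var b * pder b (pder a f)) = (real k - 1) *\<^sub>R pder a f"
      proof (cases k)
        case 0
        then show ?thesis using pder_hpolys_0[of f J] f by simp
      next
        case (Suc l)
        then show ?thesis using euler[OF symplectic_setD(1)[OF J] pder_hpolys_Suc[of f J l a]] f by simp
      qed
      finally show ?thesis by (simp add: algebra_simps)
    qed
    then show ?thesis
      using euler[OF symplectic_setD(1)[OF J] f] by (simp add: scaleR_sum_right[symmetric])
  qed
  have B: "(\<Sum>a\<in>J. \<Sum>b\<in>J. B a b) = - (real k *\<^sub>R f) - rsq J * lap J f"
  proof -
    have "B a b = (if b = a then - (var a * pder a f) else 0) - var a * (uvar a * uder b (pder b f))"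
      if "a \<in> J" for a b
      using symplectic_setD(3)[OF J that] sg_sym[of b a]
      by (auto simp: B_def uder_uvar algebra_simps)
    then have "(\<Sum>a\<in>J. \<Sum>b\<in>J. B a b) = (\<Sum>a\<in>J. \<Sum>b\<in>J. (if b = a then - (var a * pder a f) else 0) - var a * (uvar a * uder b (pder b f)))"
      by (auto intro!: sum.cong)
    also have "\<dots> = - (\<Sum>a\<in>J. var a * pder a f) - rsq J * lap J f"
      using symplectic_setD(1)[OF J]
      by (simp add: sum_subtractf sum_negf rsq_def lap_def sum_distrib_left sum_distrib_right mult.assoc)
        (rule sum.swap)
    finally show ?thesis by (simp add: euler[OF symplectic_setD(1)[OF J] f])
  qed
  have "(\<Sum>a\<in>J. \<Sum>b\<in>J. (sg a a * sg b b / (metric a * metric b)) *\<^sub>R rot a b (rot (dual b) (dual a) f))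
      = (\<Sum>a\<in>J. \<Sum>b\<in>J. A a b + B a b + (A b a + B b a))"
    by (intro sum.cong refl *)
  also have "\<dots> = (\<Sum>a\<in>J. \<Sum>b\<in>J. A a b) + (\<Sum>a\<in>J. \<Sum>b\<in>J. B a b)
      + ((\<Sum>a\<in>J. \<Sum>b\<in>J. A a b) + (\<Sum>a\<in>J. \<Sum>b\<in>J. B a b))"
    using sum.swap[of "\<lambda>a b. A b a" J J] sum.swap[of "\<lambda>a b. B b a" J J] by (simp add: sum.distrib)
  finally have "(\<Sum>a\<in>J. \<Sum>b\<in>J. (sg a a * sg b b / (metric a * metric b)) *\<^sub>R rot a b (rot (dual b) (dual a) f))
      = ((real k * (real k + sdim J - 1)) + - real k + (real k * (real k + sdim J - 1)) + - real k) *\<^sub>R f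
        - 2 *\<^sub>R (rsq J * lap J f)"
    unfolding A B by (simp only: scaleR_add_left scaleR_2 scaleR_minus_left) simp
  also have "(real k * (real k + sdim J - 1)) + - real k + (real k * (real k + sdim J - 1)) + - real k
      = 2 * real k * (real k + sdim J - 2)" by (simp add: algebra_simps)
  finally show ?thesis .
qed

section \<open>The orthosymplectic Lie superalgebra is spanned by rotations\<close>

text \<open>The parity automorphism. It turns membership in \<open>super_part\<close> into an
  eigenvalue equation, so preservation of parity becomes commutation with one linear
  operator.\<close>

definition grading :: "spoly \<Rightarrow> spoly" where
  "grading = lin_ext (\<lambda>u. (- 1) ^ fcard (snd u) *\<^sub>R mon u)"

lemma linear_grading: "linear grading"
  by (simp add: grading_def linear_lin_ext)

lemmas grading_linear [simp] =
  linear_0[OF linear_grading] linear_add[OF linear_grading] linear_diff[OF linear_grading]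
  linear_scale[OF linear_grading] linear_neg[OF linear_grading] linear_sum[OF linear_grading]

lemma coeff_grading: "coeff (grading f) u = (- 1) ^ fcard (snd u) * coeff f u"
proof -
  have "coeff (grading f) u = (\<Sum>v\<in>supp f. coeff f v * ((- 1) ^ fcard (snd v) * coeff (mon v) u))"
    by (simp add: grading_def lin_ext_def coeff_sum mult.assoc)
  also have "\<dots> = (\<Sum>v\<in>supp f. if v = u then (- 1) ^ fcard (snd u) * coeff f u else 0)"
    by (intro sum.cong) (auto simp: coeff_mon)
  finally show ?thesis by (simp add: supp_iff)
qed

lemma super_part_grading: "f \<in> super_part q \<longleftrightarrow> grading f = (- 1) ^ q *\<^sub>R f"
proof
  assume f: "f \<in> super_part q"
  have "(- 1) ^ fcard (snd u) = ((- 1) ^ q :: real)" if "coeff f u \<noteq> 0" for u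
  proof -
    have "even (fcard (snd u)) = even q" using that f by (auto simp: super_part_alt supp_iff[symmetric])
    then show ?thesis by (auto simp: minus_one_power_iff)
  qed
  then show "grading f = (- 1) ^ q *\<^sub>R f"
    by (intro spoly_eqI) (metis coeff_grading coeff_simps(5) mult_zero_right)
next
  assume *: "grading f = (- 1) ^ q *\<^sub>R f"
  have "even (fcard (snd u)) = even q" if "u \<in> supp f" for u
  proof -
    have "(- 1) ^ fcard (snd u) * coeff f u = (- 1) ^ q * coeff f u"
      using * coeff_grading[of f u] by (metis coeff_simps(5))
    then have "(- 1) ^ fcard (snd u) = ((- 1) ^ q :: real)" using that by (simp add: supp_iff)
    then show ?thesis by (auto simp: minus_one_power_iff split: if_splits)
  qed
  then show "f \<in> super_part q" by (auto simp: super_part_alt)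
qed

lemma grading_mult: "grading (f * g) = grading f * grading g"
proof -
  have g: "grading (mon u) = (- 1) ^ fcard (snd u) *\<^sub>R mon u" for u
    by (simp add: grading_def)
  have m: "grading (mon u * mon v) = grading (mon u) * grading (mon v)" for u v
  proof -
    obtain a S b T where uv: "u = (a, S)" "v = (b, T)" by (metis surj_pair)
    show ?thesis
      using fcard_funion_disjoint[of S T]
      by (cases "S |\<inter>| T = {||}")
        (simp_all add: uv mon_mult g power_add)
  qed
  have m': "grading (mon u * g) = grading (mon u) * grading g" for u
  proof (rule linear_eq_on_supp[of "\<lambda>g. grading (mon u * g)" "\<lambda>g. grading (mon u) * grading g"])
    show "linear (\<lambda>g. grading (mon u * g))" "linear (\<lambda>g. grading (mon u) * grading g)"
      by (intro linearI; simp add: distrib_left)+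
  qed (rule m)
  show ?thesis
  proof (rule linear_eq_on_supp[of "\<lambda>f. grading (f * g)" "\<lambda>f. grading f * grading g"])
    show "linear (\<lambda>f. grading (f * g))" "linear (\<lambda>f. grading f * grading g)"
      by (intro linearI; simp add: distrib_right)+
  qed (rule m')
qed

lemma grading_var: "grading (var a) = sg a a *\<^sub>R var a"
  using var_super_part[of a] by (cases a) (auto simp: super_part_grading parity_def)

lemma grading_1 [simp]: "grading 1 = 1"
  by (simp add: grading_def one_spoly_def fcard.rep_eq)

lemma grading_pder: "grading (pder a f) = sg a a *\<^sub>R pder a (grading f)"
proof (rule linear_eqI[of "\<lambda>f. grading (pder a f)" "\<lambda>f. sg a a *\<^sub>R pder a (grading f)"])
  fix b g assume *: "grading (pder a g) = sg a a *\<^sub>R pder a (grading g)"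
  show "grading (pder a (var b * g)) = sg a a *\<^sub>R pder a (grading (var b * g))"
    using * sg_mult[of a a] sg_mult[of a b] sg_mult[of b b]
    by (auto simp: pder_var grading_mult grading_var)
qed (auto intro!: linearI simp: scaleR_add_right)

lemma grading_lap: "grading (lap J f) = lap J (grading f)"
  by (simp add: lap_def uder_def grading_pder)

lemma grading_rsq: "grading (rsq J * f) = rsq J * grading f"
proof -
  have "grading (rsq J) = rsq J"
    by (simp add: rsq_def uvar_def grading_mult grading_var)
  then show ?thesis by (simp add: grading_mult)
qed

lemma var_supercommute:
  assumes "f \<in> super_part q"
  shows "f * (var b * h) = (- 1) ^ (q * parity b) *\<^sub>R (var b * (f * h))"
proof -
  have "f * (var b * h) = var b * ((if isl b then f else grading f) * h)"
  proof (rule linear_eqI[of "\<lambda>f. f * (var b * h)" "\<lambda>f. var b * ((if isl b then f else grading f) * h)"])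
    fix a g assume "g * (var b * h) = var b * ((if isl b then g else grading g) * h)"
    then show "var a * g * (var b * h) = var b * ((if isl b then var a * g else grading (var a * g)) * h)"
      using var_comm[of a b "g * h"] var_comm[of a b "grading g * h"]
      by (cases a; cases b) (simp_all add: grading_mult grading_var mult.assoc)
  qed (auto intro!: linearI simp: algebra_simps)
  then show ?thesis
    using assms by (simp add: super_part_grading parity_def)
qed

section \<open>Superderivations as first-order differential operators\<close>

lemma linear_on_0: "linear_on A D \<Longrightarrow> x \<in> A \<Longrightarrow> D 0 = 0"
  unfolding linear_on_def by (metis scaleR_zero_left)

text \<open>Both sides satisfy the same product rule. On the right \<open>D (var a)\<close> has
  parity \<open>p + parity a\<close>; the sign from moving it past \<open>var b\<close> partly
  cancels against that of \<open>pder a\<close>, and the sign of a superderivation of parity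
  \<open>p\<close> remains.\<close>

lemma hom_superderivation_formula:
  assumes J: "finite J" and D: "hom_superderivation (polys J) p D" and f: "f \<in> polys J"
  shows "D f = (\<Sum>a\<in>J. D (var a) * pder a f)"
proof -
  have lin: "linear_on (polys J) D" using D by (simp add: hom_superderivation_def)
  have leib: "D (f * g) = D f * g + (- 1) ^ (p * q) *\<^sub>R (f * D g)"
    if "f \<in> polys J" "f \<in> super_part q" "g \<in> polys J" for f g q
    using D that unfolding hom_superderivation_def by blast
  show ?thesis using f
  proof (induction rule: polys_induct)
    case zero
    then show ?case using linear_on_0[OF lin one_polys] by simp
  next
    case one
    have "(1 :: spoly) \<in> super_part 0" by (simp add: super_part_grading)
    then show ?case using leib[of 1 0 1] by simp
  next
    case (var b g)
    have "D (var a) * (var b * h) = ((- 1) ^ (p * parity b) * sg a b) *\<^sub>R (var b * (D (var a) * h))"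
      if "a \<in> J" for a h
    proof -
      have "D (var a) \<in> super_part (p + parity a)"
        using D var_polys[OF that] var_super_part unfolding hom_superderivation_def by blast
      then show ?thesis
        by (simp add: var_supercommute power_add distrib_right sg_parity)
    qed
    then have "(\<Sum>a\<in>J. D (var a) * pder a (var b * g))
        = (\<Sum>a\<in>J. (if a = b then D (var b) * g else 0) + (- 1) ^ (p * parity b) *\<^sub>R (var b * (D (var a) * pder a g)))"
      using sg_simps(1)
      by (intro sum.cong) (auto simp: pder_var distrib_left mult.left_commute[of _ "sg _ _"] mult.assoc)
    also have "\<dots> = D (var b) * g + (- 1) ^ (p * parity b) *\<^sub>R (var b * D g)"
      using var J by (simp add: sum.distrib scaleR_sum_right sum_distrib_left)
    finally show ?case
      using leib[OF var_polys[OF var(1)] var_super_part var(2)] by simp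
  qed (use lin in \<open>auto simp: linear_on_def distrib_left sum.distrib scaleR_sum_right\<close>)
qed

lemma superderivation_formula:
  assumes J: "finite J" and D: "superderivation (polys J) D" and f: "f \<in> polys J"
  shows "D f = (\<Sum>a\<in>J. D (var a) * pder a f)"
proof -
  obtain D0 D1 where h: "hom_superderivation (polys J) 0 D0" "hom_superderivation (polys J) 1 D1"
    "\<forall>f\<in>polys J. D f = D0 f + D1 f" using D unfolding superderivation_def by blast
  have "D f = (\<Sum>a\<in>J. D0 (var a) * pder a f) + (\<Sum>a\<in>J. D1 (var a) * pder a f)"
    using h f hom_superderivation_formula[OF J] by simp
  also have "\<dots> = (\<Sum>a\<in>J. D (var a) * pder a f)"
    using h(3) var_polys by (simp add: sum.distrib[symmetric] distrib_right)
  finally show ?thesis .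
qed

lemma span_var: 
  assumes J: "finite J" shows "span (var ` J) = hpolys J 1"
proof
  show "span (var ` J) \<subseteq> hpolys J 1"
    by (rule span_minimal) (use var_hpolys[of _ J] subspace_hpolys[of J 1] in auto)
  show "hpolys J 1 \<subseteq> span (var ` J)"
  proof
    fix f assume f: "f \<in> hpolys J 1"
    have "var a * pder a f \<in> span (var ` J)" if "a \<in> J" for a
    proof -
      obtain c where "pder a f = c *\<^sub>R 1" using hpolys_0 pder_hpolys_Suc[of f J 0 a] f by auto
      then show ?thesis using that by (auto intro: span_scale span_base)
    qed
    then show "f \<in> span (var ` J)" using euler[OF J f] span_sum[of J "\<lambda>a. var a * pder a f"] by simp
  qed
qed

text \<open>With raised derivatives the operator has coefficients \<open>c b a\<close>, and its
  value on R^2 is twice the quadratic form with these coefficients. That this form vanishes means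
  that \<open>c\<close> is super-antisymmetric, and super-antisymmetrizing the operator turns it
  into rotations.\<close>

lemma derivation_rot:
  assumes J: "symplectic_set J" and E: "\<And>a. a \<in> J \<Longrightarrow> E a \<in> hpolys J 1"
    and R: "(\<Sum>a\<in>J. E a * pder a (rsq J)) = 0"
  shows "\<exists>c. \<forall>f. (\<Sum>a\<in>J. E a * pder a f) = (\<Sum>a\<in>J. \<Sum>b\<in>J. c a b *\<^sub>R rot a b f)"
proof -
  note fin = symplectic_setD(1)[OF J]
  have "\<exists>e. \<forall>a\<in>J. E a = (\<Sum>b\<in>J. e b a *\<^sub>R var b)"
  proof -
    have "\<exists>r. pder b (E a) = r *\<^sub>R 1" if "a \<in> J" for a b
      using hpolys_0 pder_hpolys_Suc[of "E a" J 0 b] E[OF that] by auto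
    then have e: "pder b (E a) = (SOME r. pder b (E a) = r *\<^sub>R 1) *\<^sub>R 1" if "a \<in> J" for a b
      by (rule someI_ex) (rule that)
    define e where "e b a = (SOME r. pder b (E a) = r *\<^sub>R 1)" for b a
    note e = e[folded e_def]
    have "E a = (\<Sum>b\<in>J. e b a *\<^sub>R var b)" if "a \<in> J" for a
      using euler[OF fin E[OF that]] e[OF that] by simp
    then show ?thesis by blast
  qed
  then obtain e where e: "\<And>a. a \<in> J \<Longrightarrow> E a = (\<Sum>b\<in>J. e b a *\<^sub>R var b)" by blast
  define c where "c b a = e b (dual a) / metric a" for b a
  have bij: "bij_betw dual J J"
    by (rule bij_betwI[where g = dual]) (use symplectic_setD(2)[OF J] in auto)
  have D: "(\<Sum>a\<in>J. E a * pder a f) = (\<Sum>a\<in>J. \<Sum>b\<in>J. c b a *\<^sub>R (var b * uder a f))" for f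
  proof -
    have "(\<Sum>a\<in>J. E a * pder a f) = (\<Sum>a\<in>J. E (dual a) * pder (dual a) f)"
      using sum.reindex_bij_betw[OF bij, of "\<lambda>a. E a * pder a f"] by simp
    also have "\<dots> = (\<Sum>a\<in>J. \<Sum>b\<in>J. c b a *\<^sub>R (var b * uder a f))"
      by (intro sum.cong refl)
        (simp add: e symplectic_setD(2)[OF J] sum_distrib_right c_def uder_def)
    finally show ?thesis .
  qed
  have anti: "c x y + sg x y * c y x = 0" if "x \<in> J" "y \<in> J" for x y
  proof -
    have "0 = (\<Sum>a\<in>J. \<Sum>b\<in>J. c b a *\<^sub>R (var b * uder a (rsq J * 1)))" using D[of "rsq J"] R by simp
    also have "\<dots> = (\<Sum>a\<in>J. \<Sum>b\<in>J. (2 * c b a) *\<^sub>R (var b * var a))"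
      unfolding uder_rsq[OF J] by (intro sum.cong refl) (simp add: mult.commute)
    \<comment> \<open>Two derivatives extract a coefficient of the quadratic form.\<close>
    finally have "0 = pder y (pder x (\<Sum>a\<in>J. \<Sum>b\<in>J. (2 * c b a) *\<^sub>R (var b * var a)))" by simp
    also have "\<dots> = (\<Sum>a\<in>J. \<Sum>b\<in>J. (2 * c b a) *\<^sub>R
        ((if x = b then if y = a then 1 else 0 else 0) + (if x = a then if y = b then sg x y *\<^sub>R 1 else 0 else 0)))"
      by (simp, intro sum.cong refl) (auto simp: pder_var pder_var1)
    also have "\<dots> = (\<Sum>a\<in>J. \<Sum>b\<in>J. if x = b then if y = a then (2 * c x y) *\<^sub>R 1 else 0 else 0)
       + (\<Sum>a\<in>J. \<Sum>b\<in>J. if x = a then if y = b then (2 * c y x * sg x y) *\<^sub>R 1 else 0 else 0)"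
      unfolding sum.distrib[symmetric] by (intro sum.cong refl) (auto simp: scaleR_add_right)
    also have "(\<Sum>a\<in>J. \<Sum>b\<in>J. if x = b then if y = a then (2 * c x y) *\<^sub>R 1 else 0 else 0) = (2 * c x y) *\<^sub>R (1 :: spoly)"
      using that fin by simp
    also have "(\<Sum>a\<in>J. \<Sum>b\<in>J. if x = a then if y = b then (2 * c y x * sg x y) *\<^sub>R 1 else 0 else 0)
        = (2 * c y x * sg x y) *\<^sub>R (1 :: spoly)"
      using that fin by (subst sum.swap) simp
    finally have "(2 * c x y + 2 * c y x * sg x y) *\<^sub>R (1 :: spoly) = 0"
      by (simp only: scaleR_add_left)
    then have "2 * c x y + 2 * c y x * sg x y = 0" by (simp only: scaleR_eq_0_iff one_neq_zero simp_thms)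
    then show ?thesis by (simp add: algebra_simps)
  qed
  have "(\<Sum>a\<in>J. E a * pder a f) = (\<Sum>a\<in>J. \<Sum>b\<in>J. (c a b / 2) *\<^sub>R rot a b f)" for f
  proof -
    let ?g = "\<lambda>a b. c a b *\<^sub>R (var a * uder b f)"
    have "(c a b / 2) *\<^sub>R rot a b f = (1/2) *\<^sub>R (?g a b + ?g b a)" if "a \<in> J" "b \<in> J" for a b
    proof -
      have "c b a = - (sg a b * c a b)" using anti[OF that(2,1)] by (simp add: sg_sym[of b a])
      then show ?thesis by (simp add: rot_def algebra_simps)
    qed
    then have "(\<Sum>a\<in>J. \<Sum>b\<in>J. (c a b / 2) *\<^sub>R rot a b f) = (\<Sum>a\<in>J. \<Sum>b\<in>J. (1/2) *\<^sub>R (?g a b + ?g b a))"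
      by (intro sum.cong refl)
    also have "\<dots> = (1/2) *\<^sub>R ((\<Sum>a\<in>J. \<Sum>b\<in>J. ?g a b) + (\<Sum>a\<in>J. \<Sum>b\<in>J. ?g b a))"
      by (simp add: scaleR_sum_right[symmetric] sum.distrib)
    also have "(\<Sum>a\<in>J. \<Sum>b\<in>J. ?g a b) = (\<Sum>a\<in>J. \<Sum>b\<in>J. ?g b a)" by (rule sum.swap)
    finally show ?thesis unfolding D by (simp flip: scaleR_2)
  qed
  then show ?thesis by (intro exI[of _ "\<lambda>a b. c a b / 2"]) blast
qed

lemma rot_polys: "a \<in> J \<Longrightarrow> b \<in> J \<Longrightarrow> f \<in> polys J \<Longrightarrow> rot a b f \<in> polys J"
  using pder_polys[of f J] by (simp add: rot_def uder_def var_mult_polys)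

lemma rot_hom_superderivation:
  assumes ab: "a \<in> J" "b \<in> J" and p: "even p = even (parity a + parity b)"
  shows "hom_superderivation (polys J) p (rot a b)"
  unfolding hom_superderivation_def
proof (intro conjI allI ballI)
  show "rot a b \<in> polys J \<rightarrow> polys J" using ab rot_polys by blast
  show "linear_on (polys J) (rot a b)" by (simp add: linear_on_def)
  have sp: "var c * uder d f \<in> super_part (p + q)"
    if "f \<in> super_part q" "even p = even (parity c + parity d)" for c d f q
  proof -
    have "pder (dual d) f \<in> super_part (parity d + q)"
      using pder_super_part[OF that(1), of "dual d"] by (cases d) (auto simp: parity_def dual_def)
    then have "var c * uder d f \<in> super_part (parity c + (parity d + q))"
      unfolding uder_def by (intro super_part_mult var_super_part subspace_scale[OF subspace_super_part])
    then show ?thesis using super_part_cong[of "parity c + (parity d + q)" "p + q"] that(2) by auto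
  qed
  show "rot a b \<in> polys J \<inter> super_part q \<rightarrow> super_part (p + q)" for q
    using sp p unfolding rot_def
    by (auto intro!: subspace_diff[OF subspace_super_part] subspace_scale[OF subspace_super_part])
  fix q f g assume f: "f \<in> polys J \<inter> super_part q"
  have leib: "var c * uder d (f * g) = var c * uder d f * g + (- 1) ^ (p * q) *\<^sub>R (f * (var c * uder d g))"
    if "even p = even (parity c + parity d)" for c d
  proof -
    have par: "parity (dual d) = parity d" by (cases d) (auto simp: parity_def dual_def)
    have "(- 1) ^ (parity d * q) = ((- 1) ^ (p * q) * (- 1) ^ (q * parity c) :: real)"
      using that by (auto simp: minus_one_power_iff)
    then show ?thesis
      using f by (simp add: uder_def pder_mult[of f q "dual d" g] var_supercommute[of f q c] distrib_left mult.assoc par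
          scaleR_add_right mult.left_commute mult.commute)
  qed
  show "rot a b (f * g) = rot a b f * g + (- 1) ^ (p * q) *\<^sub>R (f * rot a b g)"
    using leib[of a b] leib[of b a] p
    by (simp add: rot_def algebra_simps scaleR_add_right scaleR_diff_right)
qed

section \<open>The index sets of the superspaces and the translation of the given notions\<close>

definition indices :: "nat \<Rightarrow> nat \<Rightarrow> idx set" where
  "indices m n = Inl ` {1..m} \<union> Inr ` {1..2 * n}"

lemma indices_iff [simp]:
  "Inl i \<in> indices m n \<longleftrightarrow> 1 \<le> i \<and> i \<le> m" "Inr j \<in> indices m n \<longleftrightarrow> 1 \<le> j \<and> j \<le> 2 * n"
  by (auto simp: indices_def)

lemma symplectic_indices: "symplectic_set (indices m n)"
proof -
  have "dual a \<in> indices m n" if a: "a \<in> indices m n" for a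
  proof (cases a)
    case (Inr j)
    then have "1 \<le> j" "j \<le> 2 * n" using a by auto
    then show ?thesis unfolding Inr dual_def by (cases "odd j") (simp_all, presburger+)
  qed (use a in auto)
  then show ?thesis by (auto simp: symplectic_set_def indices_def)
qed

lemma finite_indices [simp]: "finite (indices m n)"
  by (simp add: indices_def)

lemma superpolys_eq: "superpolys m n = polys (indices m n)"
  by (fastforce simp: superpolys_alt polys_def mvars_def)

lemma homogeneous_eq: "homogeneous m n k = hpolys (indices m n) k"
  unfolding homogeneous_def superpolys_eq
  by (auto simp: polys_def hpolys_def mdeg_def)

lemma coordinates_eq: "coordinates m n = var ` indices m n"
  by (auto simp: coordinates_def indices_def var_def image_Un image_image)

lemma sum_indices:
  "(\<Sum>a\<in>indices m n. g a) = (\<Sum>i=1..m. g (Inl i)) + (\<Sum>j=1..n. g (Inr (2 * j - 1)) + g (Inr (2 * j)))"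
  for g :: "idx \<Rightarrow> 'v::comm_monoid_add"
proof -
  have "(\<Sum>j=1..2*n. h j) = (\<Sum>j=1..n. h (2 * j - 1) + h (2 * j))" for h :: "nat \<Rightarrow> 'v"
    by (induction n) (auto simp: add.assoc)
  then show ?thesis
    unfolding indices_def by (subst sum.union_disjoint) (auto simp: sum.reindex)
qed

lemma laplacian_eq: "laplacian m n f = lap (indices m n) f"
proof -
  have "uder (Inr (2 * j - 1)) (pder (Inr (2 * j - 1)) f) + uder (Inr (2 * j)) (pder (Inr (2 * j)) f)
      = - (4 *\<^sub>R d_th (2 * j - 1) (d_th (2 * j) f))" if "j \<in> {1..n}" for j
  proof -
    have o: "odd (2 * j - 1)" "Suc (2 * j - 1) = 2 * j" using that by auto
    have "d_th (2 * j) (d_th (2 * j - 1) f) = - d_th (2 * j - 1) (d_th (2 * j) f)"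
      using pder_comm[of "Inr (2 * j)" "Inr (2 * j - 1)" f] by (simp add: pder_def)
    moreover have "- (2 *\<^sub>R X) - 2 *\<^sub>R X = - (4 *\<^sub>R X)" for X :: spoly
      by (simp flip: scaleR_minus_left scaleR_diff_left)
    ultimately show ?thesis using o by (simp add: uder_def dual_def metric_def pder_def)
  qed
  then show ?thesis
    by (simp add: laplacian_def lap_def sum_indices uder_def[of "Inl _"] pder_def sum_negf scaleR_sum_right)
qed

lemma radius_sq_eq: "radius_sq m n = rsq (indices m n)"
proof -
  have "var (Inr (2 * j - 1)) * uvar (Inr (2 * j - 1)) + var (Inr (2 * j)) * uvar (Inr (2 * j))
      = - (th_var (2 * j - 1) * th_var (2 * j))" if "j \<in> {1..n}" for j
  proof -
    have o: "odd (2 * j - 1)" "Suc (2 * j - 1) = 2 * j" using that by auto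
    have "th_var (2 * j) * th_var (2 * j - 1) = - (th_var (2 * j - 1) * th_var (2 * j))"
      using var_comm1[of "Inr (2 * j)" "Inr (2 * j - 1)"] by (simp add: var_def)
    moreover have "- ((1/2) *\<^sub>R X) - (1/2) *\<^sub>R X = - X" for X :: spoly
      by (simp flip: scaleR_minus_left scaleR_diff_left)
    ultimately show ?thesis using o by (simp add: uvar_def dual_def metric_def var_def)
  qed
  then show ?thesis
    by (simp add: radius_sq_def rsq_def sum_indices uvar_def[of "Inl _"] var_def sum_negf power2_eq_square)
qed

lemma sdim_indices: "sdim (indices m n) = real_of_int (superdim m n)"
  by (simp add: sdim_def sum_indices superdim_def)

lemma osp_rot:
  assumes D: "D \<in> osp m n"
  obtains c where
    "\<And>f. (\<Sum>a\<in>indices m n. D (var a) * pder a f)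
      = (\<Sum>a\<in>indices m n. \<Sum>b\<in>indices m n. c a b *\<^sub>R rot a b f)"
proof -
  let ?J = "indices m n"
  have s: "superderivation (polys ?J) D" and R: "D (rsq ?J) = 0"
    and sp: "D ` hpolys ?J 1 \<subseteq> hpolys ?J 1"
    using D unfolding osp_def by (auto simp: superpolys_eq radius_sq_eq coordinates_eq span_var)
  have "D (var a) \<in> hpolys ?J 1" if "a \<in> ?J" for a
    using sp var_hpolys[OF that] by blast
  moreover have "(\<Sum>a\<in>?J. D (var a) * pder a (rsq ?J)) = 0"
    using superderivation_formula[OF finite_indices s hpolys_polys[OF rsq_hpolys[OF symplectic_indices]]] R
    by simp
  ultimately show thesis
    using derivation_rot[OF symplectic_indices, of m n "\<lambda>a. D (var a)"] that by blast
qed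

lemma osp_formula:
  assumes "D \<in> osp m n" "f \<in> polys (indices m n)"
  shows "D f = (\<Sum>a\<in>indices m n. D (var a) * pder a f)"
  using assms superderivation_formula[OF finite_indices] by (auto simp: osp_def superpolys_eq)

text \<open>The extension is determined by its values on the variables. As it annihilates the new
  one, it is given by the same differential operator as \<open>D\<close>.\<close>

lemma extension_formula:
  assumes D: "D \<in> osp (m - 1) n" and m: "1 \<le> m" and f: "f \<in> polys (indices m n)"
  shows "extension m n D f = (\<Sum>a\<in>indices (m - 1) n. D (var a) * pder a f)"
proof -
  let ?J = "indices m n" and ?J' = "indices (m - 1) n"
  have "superderivation (superpolys (m - 1) n) D" using D by (simp add: osp_def)
  then have "is_extension m n D (extension m n D)"
    unfolding extension_def using theI'[OF ex1_extension[OF _ m]] by blast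
  then have e: "superderivation (polys ?J) (extension m n D)"
    "\<And>f. f \<in> polys ?J' \<Longrightarrow> extension m n D f = D f" "extension m n D (var (Inl m)) = 0"
    by (simp_all add: is_extension_def superpolys_eq var_def)
  have "{1..m} = insert m {1..m - 1}" using m by auto
  then have J: "?J = insert (Inl m) ?J'" "Inl m \<notin> ?J'"
    using m by (auto simp: indices_def)
  have "extension m n D f = (\<Sum>a\<in>?J. extension m n D (var a) * pder a f)"
    by (rule superderivation_formula[OF finite_indices e(1) f])
  also have "\<dots> = (\<Sum>a\<in>?J'. extension m n D (var a) * pder a f)"
    using J(2) e(3) unfolding J(1) by simp
  also have "\<dots> = (\<Sum>a\<in>?J'. D (var a) * pder a f)"
    by (intro sum.cong refl) (simp add: e(2) var_polys)
  finally show ?thesis .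
qed

lemma rot_osp:
  assumes ab: "a \<in> indices m n" "b \<in> indices m n"
  shows "restrict (rot a b) (polys (indices m n)) \<in> osp m n"
proof -
  let ?J = "indices m n"
  let ?p = "(parity a + parity b) mod 2"
  have h: "hom_superderivation (polys ?J) ?p (rot a b)"
    by (rule rot_hom_superderivation[OF ab]) simp
  have z: "hom_superderivation (polys ?J) q (\<lambda>_. 0)" for q
    by (auto simp: hom_superderivation_def linear_on_def subspace_0[OF subspace_super_part])
  have "superderivation (polys ?J) (restrict (rot a b) (polys ?J))"
    unfolding superderivation_def
  proof (intro conjI)
    show "\<exists>D0 D1. hom_superderivation (polys ?J) 0 D0 \<and> hom_superderivation (polys ?J) 1 D1 \<and>
        (\<forall>f\<in>polys ?J. restrict (rot a b) (polys ?J) f = D0 f + D1 f)"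
    proof (cases "?p = 0")
      case True
      then show ?thesis using h z[of 1] by (intro exI[of _ "rot a b"] exI[of _ "\<lambda>_. 0"]) simp
    next
      case False
      then have "?p = 1" by simp
      then show ?thesis using h z[of 0] by (intro exI[of _ "\<lambda>_. 0"] exI[of _ "rot a b"]) simp
    qed
  qed auto
  moreover have "restrict (rot a b) (polys ?J) ` hpolys ?J 1 \<subseteq> hpolys ?J 1"
    using rot_hpolys[OF ab] hpolys_polys by auto
  moreover have "restrict (rot a b) (polys ?J) (rsq ?J) = 0"
    using rot_rsq[OF symplectic_indices ab, of 1] hpolys_polys[OF rsq_hpolys[OF symplectic_indices]]
    by (simp add: rot_def)
  ultimately show ?thesis
    by (simp add: osp_def superpolys_eq coordinates_eq span_var radius_sq_eq)
qed

section \<open>Harmonic polynomials and Cauchy--Kovalevskaya extension\<close>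

definition harm :: "idx set \<Rightarrow> nat \<Rightarrow> spoly set" where
  "harm J k = {f \<in> hpolys J k. lap J f = 0}"

definition gharm :: "idx set \<Rightarrow> nat \<Rightarrow> spoly set" where
  "gharm J k = {f \<in> hpolys J k. lap J (rsq J * lap J f) = 0}"

definition at_zero :: "nat \<Rightarrow> spoly \<Rightarrow> spoly" where
  "at_zero i = lin_ext (\<lambda>u. if Poly_Mapping.lookup (fst u) i = 0 then mon u else 0)"

lemma linear_at_zero: "linear (at_zero i)"
  by (simp add: at_zero_def linear_lin_ext)

lemmas at_zero_linear [simp] =
  linear_0[OF linear_at_zero] linear_add[OF linear_at_zero] linear_diff[OF linear_at_zero]
  linear_scale[OF linear_at_zero] linear_neg[OF linear_at_zero] linear_sum[OF linear_at_zero]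

lemma coeff_at_zero:
  "coeff (at_zero i f) u = (if Poly_Mapping.lookup (fst u) i = 0 then coeff f u else 0)"
proof (rule linear_eq_on_supp[of "\<lambda>f. coeff (at_zero i f) u"
      "\<lambda>f. if Poly_Mapping.lookup (fst u) i = 0 then coeff f u else 0"])
  show "coeff (at_zero i (mon v)) u = (if Poly_Mapping.lookup (fst u) i = 0 then coeff (mon v) u else 0)" for v
    by (auto simp: at_zero_def coeff_mon)
qed (auto intro!: linearI)

lemma at_zero_var: "at_zero i (var a * f) = (if a = Inl i then 0 else var a * at_zero i f)"
proof (rule linear_eq_on_supp[of "\<lambda>f. at_zero i (var a * f)" "\<lambda>f. if a = Inl i then 0 else var a * at_zero i f"])
  have m: "at_zero i (mon u) = (if Poly_Mapping.lookup (fst u) i = 0 then mon u else 0)" for u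
    by (simp add: at_zero_def)
  fix u :: smono
  obtain b S where "u = (b, S)" by (metis surj_pair)
  then show "at_zero i (var a * mon u) = (if a = Inl i then 0 else var a * at_zero i (mon u))"
    by (cases a) (auto simp: var_def x_var_def th_var_def mon_mult m lookup_add lookup_single)
qed (auto intro!: linearI simp: distrib_left)

lemma at_zero_1 [simp]: "at_zero i 1 = 1"
  by (simp add: at_zero_def one_spoly_def)

lemma at_zero_id:
  assumes "f \<in> polys J" "Inl i \<notin> J" shows "at_zero i f = f"
proof (rule linear_eq_on_polys[OF assms(1) linear_at_zero linear_id[unfolded id_def]])
  fix a g assume "a \<in> J" "at_zero i g = g"
  then show "at_zero i (var a * g) = var a * g" using assms(2) by (auto simp: at_zero_var)
qed simp

lemma at_zero_hpolys: 
  assumes "f \<in> hpolys J k" shows "at_zero i f \<in> hpolys (J - {Inl i}) k"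
proof -
  have "u \<in> supp f \<and> Poly_Mapping.lookup (fst u) i = 0" if "u \<in> supp (at_zero i f)" for u
    using that by (auto simp: supp_iff coeff_at_zero split: if_splits)
  moreover have "Inl i \<notin> mvars u" if "Poly_Mapping.lookup (fst u) i = 0" for u
    using that by (auto simp: mvars_def in_keys_iff)
  ultimately show ?thesis using assms unfolding hpolys_def by blast
qed

lemma at_zero_pder:
  assumes "a \<noteq> Inl i" shows "at_zero i (pder a f) = pder a (at_zero i f)"
  by (rule linear_eqI[of "\<lambda>f. at_zero i (pder a f)" "\<lambda>f. pder a (at_zero i f)"])
    (use assms in \<open>auto intro!: linearI simp: pder_var at_zero_var\<close>)

lemma at_zero_lap:
  assumes "Inl i \<notin> J" "symplectic_set J" shows "at_zero i (lap J f) = lap J (at_zero i f)"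
proof -
  have "at_zero i (uder a (pder a f)) = uder a (pder a (at_zero i f))" if "a \<in> J" for a
  proof -
    have "a \<noteq> Inl i" "dual a \<noteq> Inl i" using that assms(1) by auto
    then show ?thesis by (simp add: uder_def at_zero_pder)
  qed
  then show ?thesis by (simp add: lap_def)
qed

lemma coeff_pder_Inl:
  "coeff (pder (Inl i) f) u
    = real (Suc (Poly_Mapping.lookup (fst u) i)) * coeff f (fst u + Poly_Mapping.single i 1, snd u)"
proof (rule linear_eq_on_supp[of "\<lambda>f. coeff (pder (Inl i) f) u"
      "\<lambda>f. real (Suc (Poly_Mapping.lookup (fst u) i)) * coeff f (fst u + Poly_Mapping.single i 1, snd u)"])
  fix v :: smono
  obtain a S b T where uv: "u = (a, S)" "v = (b, T)" by (metis surj_pair)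
  define e where "e = Poly_Mapping.single i (1::nat)"
  have e: "Poly_Mapping.lookup e i = 1" by (simp add: e_def)
  have "a + e = b \<longleftrightarrow> a = b - e \<and> Poly_Mapping.lookup b i \<noteq> 0"
  proof
    assume *: "a = b - e \<and> Poly_Mapping.lookup b i \<noteq> 0"
    show "a + e = b"
      using * by (intro poly_mapping_eqI) (auto simp: e_def lookup_add lookup_minus lookup_single when_def)
  qed (auto simp: lookup_add e)
  moreover have "coeff (pder (Inl i) (mon v)) u = real (Poly_Mapping.lookup b i) * (if a = b - e \<and> S = T then 1 else 0)"
    by (simp add: uv pder_def d_x_def coeff_mon e_def)
  moreover have "Suc (Poly_Mapping.lookup a i) = Poly_Mapping.lookup b i" if "a + e = b"
    using that e by (auto simp: lookup_add)
  ultimately show "coeff (pder (Inl i) (mon v)) u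
      = real (Suc (Poly_Mapping.lookup (fst u) i)) * coeff (mon v) (fst u + Poly_Mapping.single i 1, snd u)"
    by (auto simp: uv coeff_mon e_def[symmetric] simp del: One_nat_def)
qed (auto intro!: linearI simp: algebra_simps)

lemma taylor_zero:
  assumes "\<And>j. at_zero i ((pder (Inl i) ^^ j) f) = 0"
  shows "f = 0"
proof (rule spoly_eqI)
  fix u :: smono
  \<comment> \<open>The factor is a quotient of factorials, but only its being nonzero
    matters.\<close>
  have *: "\<exists>c\<noteq>0. coeff ((pder (Inl i) ^^ j) f) v = c * coeff f (fst v + Poly_Mapping.single i j, snd v)" for j v
  proof (induction j arbitrary: v)
    case (Suc j)
    obtain c where "c \<noteq> 0" "coeff ((pder (Inl i) ^^ j) f) (fst v + Poly_Mapping.single i 1, snd v)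
        = c * coeff f (fst v + Poly_Mapping.single i 1 + Poly_Mapping.single i j, snd v)"
      using Suc[of "(fst v + Poly_Mapping.single i 1, snd v)"] by auto
    moreover have "fst v + Poly_Mapping.single i 1 + Poly_Mapping.single i j = fst v + Poly_Mapping.single i (Suc j)"
      by (simp add: add.assoc single_add[symmetric])
    ultimately show ?case
      by (intro exI[of _ "real (Suc (Poly_Mapping.lookup (fst v) i)) * c"]) (simp add: coeff_pder_Inl)
  qed (auto intro!: exI[of _ 1])
  define j where "j = Poly_Mapping.lookup (fst u) i"
  define v where "v = (fst u - Poly_Mapping.single i j, snd u)"
  have "fst v + Poly_Mapping.single i j = fst u" "Poly_Mapping.lookup (fst v) i = 0"
    by (auto intro!: poly_mapping_eqI simp: v_def j_def lookup_add lookup_minus lookup_single when_def)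
  moreover obtain c where "c \<noteq> 0" "coeff ((pder (Inl i) ^^ j) f) v = c * coeff f (fst v + Poly_Mapping.single i j, snd v)"
    using * by blast
  moreover have "coeff (at_zero i ((pder (Inl i) ^^ j) f)) v = 0" using assms by simp
  ultimately show "coeff f u = coeff 0 u" by (simp add: coeff_at_zero v_def)
qed

section \<open>Powers of the normal variable and Cauchy-Kovalevskaya extension\<close>

lemma xp_Suc: "xp i (Suc s) * g = var (Inl i) * (xp i s * g)"
  using xp_mult[of i 1 s] by (simp add: var_def xp_def x_var_def mult.assoc[symmetric])

lemma xp_commute_op:
  assumes "\<And>g. F (var (Inl i) * g) = var (Inl i) * F g"
  shows "F (xp i s * g) = xp i s * F g"
  by (induction s) (simp_all add: xp_Suc assms)

lemma at_zero_xp: "at_zero i (xp i s * g) = (if s = 0 then at_zero i g else 0)"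
  by (cases s) (simp_all add: xp_Suc at_zero_var)

lemma pder_xp: "pder (Inl i) (xp i s * g) = real s *\<^sub>R (xp i (s - 1) * g) + xp i s * pder (Inl i) g"
proof (induction s)
  case (Suc s)
  have "var (Inl i) * (real s *\<^sub>R (xp i (s - 1) * g)) = real s *\<^sub>R (xp i s * g)"
    by (cases s) (simp_all add: xp_Suc)
  then show ?case using Suc by (simp add: xp_Suc pder_var distrib_left algebra_simps)
qed simp

lemma xp_hpolys: "Inl i \<in> J \<Longrightarrow> g \<in> hpolys J k \<Longrightarrow> xp i s * g \<in> hpolys J (s + k)"
  by (induction s) (auto simp: xp_Suc var_mult_hpolys)

lemma lap_pow_hpolys:
  assumes "f \<in> hpolys J k"
  shows "(lap J ^^ j) f \<in> hpolys J (k - 2 * j)" "k < 2 * j \<Longrightarrow> (lap J ^^ j) f = 0"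
proof -
  have "(lap J ^^ j) f \<in> hpolys J (k - 2 * j) \<and> (k < 2 * j \<longrightarrow> (lap J ^^ j) f = 0)"
  proof (induction j)
    case (Suc j)
    have "lap J ((lap J ^^ j) f) \<in> hpolys J (k - 2 * j - 2)" using Suc lap_hpolys' by blast
    moreover have "lap J ((lap J ^^ j) f) = 0" if "k < 2 * Suc j"
      using Suc that lap_hpolys_low[of "(lap J ^^ j) f" J "k - 2 * j"] by (cases "k < 2 * j") auto
    ultimately show ?case by simp
  qed (use assms in auto)
  then show "(lap J ^^ j) f \<in> hpolys J (k - 2 * j)" "k < 2 * j \<Longrightarrow> (lap J ^^ j) f = 0" by auto
qed

lemma symplectic_remove_Inl: "symplectic_set J \<Longrightarrow> symplectic_set (J - {Inl i})"
  by (auto simp: symplectic_set_def)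

lemma lap_split_Inl:
  assumes "symplectic_set J" "Inl i \<in> J"
  shows "lap J f = pder (Inl i) (pder (Inl i) f) + lap (J - {Inl i}) f"
  unfolding lap_def using sum.remove[OF symplectic_setD(1)[OF assms(1)] assms(2), of "\<lambda>a. uder a (pder a f)"]
  by (simp add: uder_def)

text \<open>
  The harmonic polynomial with prescribed restriction to \<open>x\<^sub>i = 0\<close> (for \<open>e = 0\<close>) or prescribed
  normal derivative there (for \<open>e = 1\<close>), the other one being \<open>0\<close>; \<open>d\<close> only truncates the series.
\<close>

definition ck_ext :: "nat \<Rightarrow> idx set \<Rightarrow> nat \<Rightarrow> nat \<Rightarrow> spoly \<Rightarrow> spoly" where
  "ck_ext i J e d f = (\<Sum>j\<le>d. ((- 1) ^ j / fact (2 * j + e)) *\<^sub>R (xp i (2 * j + e) * (lap J ^^ j) f))"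

lemma linear_lap_pow: "linear (lap J ^^ j)"
  by (induction j) (simp_all add: linear_id[unfolded id_def] linear_compose[OF _ linear_lap, unfolded o_def] o_def)

lemma linear_ck_ext: "linear (ck_ext i J e d)"
  unfolding ck_ext_def
  by (intro linearI)
    (simp_all add: linear_add[OF linear_lap_pow] linear_scale[OF linear_lap_pow] distrib_left scaleR_add_right
      sum.distrib scaleR_sum_right mult.commute)

text \<open>Applied to elements of osp(m-1|2n) and to the parity automorphism, this makes the
  extension of Cauchy data a map of graded modules.\<close>

lemma ck_ext_commute:
  assumes "linear K" "\<And>g. K (var (Inl i) * g) = var (Inl i) * K g" "\<And>g. K (lap J g) = lap J (K g)"
  shows "K (ck_ext i J e d f) = ck_ext i J e d (K f)"
proof -
  have "K ((lap J ^^ j) f) = (lap J ^^ j) (K f)" for j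
    by (induction j) (simp_all add: assms(3))
  then show ?thesis
    by (simp add: ck_ext_def linear_sum[OF assms(1)] linear_scale[OF assms(1)] xp_commute_op[of K i, OF assms(2)])
qed

text \<open>The second normal derivative of the term \<open>j + 1\<close> cancels the tangential
  Laplacian of the term \<open>j\<close>, so a partial sum leaves one term; the one left by the full
  sum is 0 because \<open>k \<le> d\<close> makes the power of the Laplacian vanish.\<close>

lemma ck_ext_harm:
  assumes J: "symplectic_set J" and i: "Inl i \<in> J" and f: "f \<in> hpolys (J - {Inl i}) k"
    and "e < 2" "k \<le> d"
  shows "ck_ext i (J - {Inl i}) e d f \<in> harm J (k + e)"
    "at_zero i (ck_ext i (J - {Inl i}) e d f) = (if e = 0 then f else 0)"
    "at_zero i (pder (Inl i) (ck_ext i (J - {Inl i}) e d f)) = (if e = 0 then 0 else f)"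
proof -
  let ?J = "J - {Inl i}" and ?c = "\<lambda>j. (- 1) ^ j / fact (2 * j + e) :: real"
  let ?L = "\<lambda>j. (lap ?J ^^ j) f"
  have J': "symplectic_set ?J" by (rule symplectic_remove_Inl[OF J])
  have zero: "at_zero i (?L j) = ?L j" "pder (Inl i) (?L j) = 0" for j
    using lap_pow_hpolys(1)[OF f] at_zero_id[of "?L j" ?J i] pder_outside[of "?L j" ?J "Inl i"] hpolys_polys
    by auto
  have lapx: "lap ?J (xp i s * g) = xp i s * lap ?J g" for s g
    by (rule xp_commute_op) (simp add: lap_var[OF J'])
  have "xp i (2 * j + e) * ?L j \<in> hpolys J (k + e)" for j
  proof (cases "k < 2 * j")
    case True
    then show ?thesis using lap_pow_hpolys(2)[OF f] by simp
  next
    case False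
    have "?L j \<in> hpolys J (k - 2 * j)" using lap_pow_hpolys(1)[OF f, of j] by (rule hpolys_mono[rotated]) auto
    then have "xp i (2 * j + e) * ?L j \<in> hpolys J ((2 * j + e) + (k - 2 * j))" by (rule xp_hpolys[OF i])
    then show ?thesis using False by (simp add: add.commute)
  qed
  then have deg: "ck_ext i ?J e d f \<in> hpolys J (k + e)"
    unfolding ck_ext_def by (intro hpolys_closed)
  have dd: "pder (Inl i) (pder (Inl i) (xp i s * ?L j)) = (real s * real (s - 1)) *\<^sub>R (xp i (s - 2) * ?L j)" for s j
    by (simp add: pder_xp zero numeral_2_eq_2)
  have "lap J (\<Sum>j\<le>D. ?c j *\<^sub>R (xp i (2 * j + e) * ?L j)) = ?c D *\<^sub>R (xp i (2 * D + e) * ?L (Suc D))" for D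
  proof (induction D)
    case 0
    \<comment> \<open>The lowest power of the normal variable is 0 or 1 and has no second
      derivative.\<close>
    have "real e * real (e - 1) = 0" using \<open>e < 2\<close> by (auto simp: less_2_cases_iff)
    then show ?case using dd[of e 0] by (simp add: lap_split_Inl[OF J i] lapx scaleR_add_right)
  next
    case (Suc D)
    have "lap J (xp i (2 * Suc D + e) * ?L (Suc D)) = (real (2 * D + e + 2) * real (2 * D + e + 1)) *\<^sub>R
        (xp i (2 * D + e) * ?L (Suc D)) + xp i (2 * Suc D + e) * ?L (Suc (Suc D))"
      by (simp add: lap_split_Inl[OF J i] dd[of _ "Suc D", simplified] lapx)
    moreover have "?c (Suc D) * (real (2 * D + e + 2) * real (2 * D + e + 1)) = - ?c D"
    proof -
      have "fact (2 * Suc D + e) = real (2 * D + e + 2) * real (2 * D + e + 1) * fact (2 * D + e)"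
        by (simp add: algebra_simps)
      moreover have "(- x) / (a * b * F) * (a * b) = - (x / F)" if "a \<noteq> 0" "b \<noteq> 0" for x a b F :: real
        using that by simp
      moreover have "real (2 * D + e + 2) \<noteq> 0" "real (2 * D + e + 1) \<noteq> 0" by linarith+
      ultimately show ?thesis by (simp only: power_Suc mult_minus1)
    qed
    ultimately have "lap J (?c (Suc D) *\<^sub>R (xp i (2 * Suc D + e) * ?L (Suc D)))
       = - ?c D *\<^sub>R (xp i (2 * D + e) * ?L (Suc D)) + ?c (Suc D) *\<^sub>R (xp i (2 * Suc D + e) * ?L (Suc (Suc D)))"
      by (simp only: lap_linear scaleR_add_right scaleR_scaleR)
    then show ?case using Suc by (simp only: sum.atMost_Suc lap_linear) simp
  qed
  moreover have "?L (Suc d) = 0" using \<open>k \<le> d\<close> by (intro lap_pow_hpolys(2)[OF f]) simp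
  ultimately have "lap J (ck_ext i ?J e d f) = 0" unfolding ck_ext_def by (simp only: mult_zero_right scaleR_zero_right)
  then show "ck_ext i ?J e d f \<in> harm J (k + e)" using deg by (simp add: harm_def)
  have "at_zero i (ck_ext i ?J e d f) = (\<Sum>j\<le>d. if j = 0 then if e = 0 then f else 0 else 0)"
    unfolding ck_ext_def at_zero_linear by (intro sum.cong refl) (use zero(1)[of 0] in \<open>auto simp: at_zero_xp\<close>)
  then show "at_zero i (ck_ext i ?J e d f) = (if e = 0 then f else 0)" by simp
  have "at_zero i (pder (Inl i) (ck_ext i ?J e d f)) = (\<Sum>j\<le>d. if j = 0 then if e = 0 then 0 else f else 0)"
    unfolding ck_ext_def at_zero_linear pder_linear
    by (intro sum.cong refl)
      (use zero(1)[of 0] \<open>e < 2\<close> in \<open>auto simp: pder_xp zero(2) at_zero_xp less_2_cases_iff\<close>)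
  then show "at_zero i (pder (Inl i) (ck_ext i ?J e d f)) = (if e = 0 then 0 else f)" by simp
qed

text \<open>The harmonic equation expresses the second normal derivative by tangential ones, so all
  Taylor coefficients in the normal direction follow from the first two.\<close>

lemma harm_zero:
  assumes J: "symplectic_set J" and i: "Inl i \<in> J" and f: "lap J f = 0"
    and z: "at_zero i f = 0" "at_zero i (pder (Inl i) f) = 0"
  shows "f = 0"
proof (rule taylor_zero)
  fix j
  show "at_zero i ((pder (Inl i) ^^ j) f) = 0"
  proof (induction j rule: induct_nat_012)
    case (ge2 j)
    let ?J = "J - {Inl i}"
    have pl: "(pder (Inl i) ^^ j) (lap ?J f) = lap ?J ((pder (Inl i) ^^ j) f)"
      by (induction j) (simp_all add: pder_lap)
    have pm: "(pder (Inl i) ^^ j) (- g) = - (pder (Inl i) ^^ j) g" for g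
      by (induction j) simp_all
    have "pder (Inl i) (pder (Inl i) f) = - lap ?J f"
      using f lap_split_Inl[OF J i, of f] by (simp add: eq_neg_iff_add_eq_0)
    then have "(pder (Inl i) ^^ Suc (Suc j)) f = - lap ?J ((pder (Inl i) ^^ j) f)"
      unfolding funpow_Suc_right o_def by (simp add: pl pm)
    then show ?case using ge2(1) at_zero_lap[OF _ symplectic_remove_Inl[OF J], of i i] by simp
  qed (use z in simp_all)
qed

lemma harm_eqI:
  assumes J: "symplectic_set J" "Inl i \<in> J" and "f \<in> harm J k" "g \<in> harm J k"
    and "at_zero i f = at_zero i g" "at_zero i (pder (Inl i) f) = at_zero i (pder (Inl i) g)"
  shows "f = g"
  using harm_zero[OF J, of "f - g"] assms by (simp add: harm_def)

lemma subspace_harm: "subspace (harm J k)" and subspace_gharm: "subspace (gharm J k)"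
  by (auto simp: subspace_def harm_def gharm_def distrib_left)

lemma harm_hpolys: "f \<in> harm J k \<Longrightarrow> f \<in> hpolys J k"
  and gharm_hpolys: "f \<in> gharm J k \<Longrightarrow> f \<in> hpolys J k"
  and harm_gharm: "f \<in> harm J k \<Longrightarrow> f \<in> gharm J k"
  by (auto simp: harm_def gharm_def)

lemma rot_harm:
  assumes "symplectic_set J" "a \<in> J" "b \<in> J"
  shows "f \<in> harm J k \<Longrightarrow> rot a b f \<in> harm J k" "f \<in> gharm J k \<Longrightarrow> rot a b f \<in> gharm J k"
proof -
  show "f \<in> harm J k \<Longrightarrow> rot a b f \<in> harm J k"
    using assms rot_hpolys by (auto simp: harm_def rot_lap)
  assume "f \<in> gharm J k"
  then have "lap J (rsq J * lap J (rot a b f)) = rot a b (lap J (rsq J * lap J f))"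
    using assms by (simp add: rot_lap rot_rsq[symmetric])
  then show "rot a b f \<in> gharm J k"
    using assms rot_hpolys \<open>f \<in> gharm J k\<close> by (auto simp: gharm_def)
qed

section \<open>Fischer decomposition\<close>

lemma rsq_pow_hpolys: "symplectic_set J \<Longrightarrow> f \<in> hpolys J k \<Longrightarrow> rsq J ^ j * f \<in> hpolys J (2 * j + k)"
  by (induction j) (auto simp: mult.assoc rsq_mult_hpolys)

text \<open>The constant is the sum of the constants 4 (l + 2i) + 2M of the sl(2) relation over i =
  0, ..., j.\<close>

lemma lap_rsq_pow:
  assumes J: "symplectic_set J" and f: "f \<in> hpolys J l"
  shows "lap J (rsq J ^ Suc j * f) = rsq J ^ Suc j * lap J f
    + (2 * real (Suc j) * (sdim J + 2 * real l + 2 * real j)) *\<^sub>R (rsq J ^ j * f)"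
proof (induction j)
  case 0
  then show ?case using lap_rsq[OF J f] by (simp add: algebra_simps)
next
  case (Suc j)
  have "lap J (rsq J ^ Suc (Suc j) * f) = lap J (rsq J * (rsq J ^ Suc j * f))"
    by (simp add: mult.assoc)
  also have "\<dots> = rsq J * lap J (rsq J ^ Suc j * f)
      + (4 * real (2 * Suc j + l) + 2 * sdim J) *\<^sub>R (rsq J ^ Suc j * f)"
    by (rule lap_rsq[OF J rsq_pow_hpolys[OF J f]])
  also have "rsq J * lap J (rsq J ^ Suc j * f) = rsq J ^ Suc (Suc j) * lap J f
      + (2 * real (Suc j) * (sdim J + 2 * real l + 2 * real j)) *\<^sub>R (rsq J ^ Suc j * f)"
    unfolding Suc by (simp add: distrib_left mult.assoc)
  also have "\<dots> + (4 * real (2 * Suc j + l) + 2 * sdim J) *\<^sub>R (rsq J ^ Suc j * f)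
      = rsq J ^ Suc (Suc j) * lap J f + (2 * real (Suc j) * (sdim J + 2 * real l + 2 * real j)
        + (4 * real (2 * Suc j + l) + 2 * sdim J)) *\<^sub>R (rsq J ^ Suc j * f)"
    by (simp only: scaleR_add_left add.assoc)
  also have "2 * real (Suc j) * (sdim J + 2 * real l + 2 * real j) + (4 * real (2 * Suc j + l) + 2 * sdim J)
      = 2 * real (Suc (Suc j)) * (sdim J + 2 * real l + 2 * real (Suc j))"
    by (simp add: algebra_simps)
  finally show ?case .
qed

definition fischer_comp :: "idx set \<Rightarrow> int \<Rightarrow> nat \<Rightarrow> spoly set" where
  "fischer_comp J N l = (if l \<in> exceptional_indices N then gharm J l else harm J l)"

text \<open>The index 2 - N - l' drops out once the degree reaches the exceptional l': from there
  on, its component is a multiple of one that already lies in \<open>gharm J l'\<close>, by the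
  vanishing of the constant in \<open>lap_rsq_pow\<close>.\<close>

definition fischer_indices :: "int \<Rightarrow> nat \<Rightarrow> nat set" where
  "fischer_indices N d = {l. l \<le> d \<and> even (d + l) \<and>
     (\<forall>l'\<in>exceptional_indices N. l' \<le> d \<longrightarrow> int l \<noteq> 2 - N - int l')}"

definition fischer_sum :: "idx set \<Rightarrow> int \<Rightarrow> nat \<Rightarrow> (nat \<Rightarrow> spoly) \<Rightarrow> spoly" where
  "fischer_sum J N d h = (\<Sum>l\<in>fischer_indices N d. rsq J ^ ((d - l) div 2) * h l)"

lemma finite_fischer_indices [simp]: "finite (fischer_indices N d)"
  by (rule finite_subset[of _ "{..d}"]) (auto simp: fischer_indices_def)

lemma subspace_fischer_comp: "subspace (fischer_comp J N l)"
  by (simp add: fischer_comp_def subspace_harm subspace_gharm)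

lemma fischer_comp_hpolys: "f \<in> fischer_comp J N l \<Longrightarrow> f \<in> hpolys J l"
  by (auto simp: fischer_comp_def harm_def gharm_def split: if_splits)

lemma fischer_comp_nilpotent: "f \<in> fischer_comp J N l \<Longrightarrow> rsq J * lap J (rsq J * lap J f) = 0"
  by (auto simp: fischer_comp_def harm_def gharm_def split: if_splits)

lemma fischer_comp_rsq_lap: 
  "symplectic_set J \<Longrightarrow> f \<in> fischer_comp J N l \<Longrightarrow> rsq J * lap J f \<in> fischer_comp J N l"
  by (auto simp: fischer_comp_def harm_def gharm_def rsq_lap_hpolys split: if_splits)

text \<open>Multiplication by \<open>R\<^sup>2\<close> followed by \<open>\<Delta>\<close> acts on the components by these maps, which are
  invertible for \<open>c \<noteq> 0\<close> as \<open>R\<^sup>2\<Delta>\<close> is nilpotent there.\<close>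

definition shift :: "idx set \<Rightarrow> real \<Rightarrow> spoly \<Rightarrow> spoly" where
  "shift J c f = c *\<^sub>R f + rsq J * lap J f"

definition unshift :: "idx set \<Rightarrow> real \<Rightarrow> spoly \<Rightarrow> spoly" where
  "unshift J c f = (1 / c) *\<^sub>R f - (1 / c\<^sup>2) *\<^sub>R (rsq J * lap J f)"

lemma shift_comp:
  assumes "symplectic_set J" "f \<in> fischer_comp J N l"
  shows "shift J c f \<in> fischer_comp J N l" "unshift J c f \<in> fischer_comp J N l"
  using assms fischer_comp_rsq_lap subspace_fischer_comp[of J N l]
  by (auto simp: shift_def unshift_def intro!: subspace_add subspace_diff subspace_scale)

lemma shift_unshift:
  assumes "f \<in> fischer_comp J N l" "c \<noteq> 0"
  shows "shift J c (unshift J c f) = f" "unshift J c (shift J c f) = f"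
  using assms(2) fischer_comp_nilpotent[OF assms(1)]
  by (simp_all add: shift_def unshift_def power2_eq_square algebra_simps)

text \<open>Passing from \<open>d\<close> to \<open>d + 2\<close> adds one index and drops at most
  the one on which Delta R^2 has eigenvalue 0. That index is not exceptional itself, so its
  component consists of genuine harmonics.\<close>

lemma fischer_indices_Suc_Suc:
  defines "K \<equiv> \<lambda>N d. {l \<in> fischer_indices N d. int l \<noteq> 2 - N - int (Suc (Suc d))}"
  shows "fischer_indices N (Suc (Suc d)) = insert (Suc (Suc d)) (K N d)" "Suc (Suc d) \<notin> K N d"
    "Suc (Suc d) \<notin> exceptional_indices N \<Longrightarrow> K N d = fischer_indices N d"
    "l \<in> fischer_indices N d - K N d \<Longrightarrow> l \<notin> exceptional_indices N"
proof -
  \<comment> \<open>The equation says \<open>l + d = - N\<close>, so \<open>N\<close> is even and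
    not positive; \<open>l \<le> d\<close> then puts \<open>d + 2\<close> into the exceptional range
    and \<open>l\<close> below it.\<close>
  have partner: "Suc (Suc d) \<in> exceptional_indices N \<and> l \<notin> exceptional_indices N"
    if "int l = 2 - N - int (Suc (Suc d))" "l \<le> d" "even (d + l)" for l
    using that unfolding exceptional_indices_def by (auto; presburger)
  then show "Suc (Suc d) \<notin> exceptional_indices N \<Longrightarrow> K N d = fischer_indices N d"
    "l \<in> fischer_indices N d - K N d \<Longrightarrow> l \<notin> exceptional_indices N"
    by (auto simp: K_def fischer_indices_def)
  show "Suc (Suc d) \<notin> K N d" by (simp add: K_def fischer_indices_def)
  have top: "int (Suc (Suc d)) \<noteq> 2 - N - int l'" if "l' \<in> exceptional_indices N" "l' \<le> Suc (Suc d)" for l'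
    using that unfolding exceptional_indices_def by (auto split: if_splits)
  have odd: "even N" if "l' \<in> exceptional_indices N" for l'
    using that by (auto simp: exceptional_indices_def split: if_splits)
  show "fischer_indices N (Suc (Suc d)) = insert (Suc (Suc d)) (K N d)"
  proof (intro equalityI subsetI)
    fix l assume l: "l \<in> fischer_indices N (Suc (Suc d))"
    show "l \<in> insert (Suc (Suc d)) (K N d)"
    proof (cases "l = Suc (Suc d)")
      case False
      have "l \<le> Suc (Suc d)" "even (Suc (Suc d) + l)"
        and e: "\<forall>l'\<in>exceptional_indices N. l' \<le> Suc (Suc d) \<longrightarrow> int l \<noteq> 2 - N - int l'"
        using l unfolding fischer_indices_def by blast+
      with False have "l \<le> d" "even (d + l)" by presburger+
      moreover have "int l \<noteq> 2 - N - int (Suc (Suc d))"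
        using e partner[OF _ calculation] by blast
      ultimately show ?thesis using l by (simp add: K_def fischer_indices_def)
    qed simp
  next
    fix l assume l: "l \<in> insert (Suc (Suc d)) (K N d)"
    show "l \<in> fischer_indices N (Suc (Suc d))"
    proof (cases "l = Suc (Suc d)")
      case True
      then show ?thesis using top by (auto simp: fischer_indices_def)
    next
      case False
      then have *: "l \<le> d" "even (d + l)" "int l \<noteq> 2 - N - int (Suc (Suc d))"
        "\<And>l'. l' \<in> exceptional_indices N \<Longrightarrow> l' \<le> d \<Longrightarrow> int l \<noteq> 2 - N - int l'"
        using l by (auto simp: K_def fischer_indices_def)
      have "int l \<noteq> 2 - N - int l'" if "l' \<in> exceptional_indices N" "l' \<le> Suc (Suc d)" for l'
      proof -
        consider "l' \<le> d" | "l' = Suc d" | "l' = Suc (Suc d)" using \<open>l' \<le> Suc (Suc d)\<close> by linarith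
        then show ?thesis
        proof cases
          case 2
          then show ?thesis using odd[OF that(1)] *(2) by presburger
        qed (use * that in auto)
      qed
      then show ?thesis using * by (auto simp: fischer_indices_def)
    qed
  qed
qed

text \<open>From \<open>lap_rsq_pow\<close> with \<open>j = (d - l) / 2\<close>. The first factor of
  the scalar is positive for \<open>l \<le> d\<close>, so the scalar vanishes only for
  \<open>l + d = - N\<close>.\<close>

lemma lap_rsq_fischer_sum:
  assumes J: "symplectic_set J" and N: "sdim J = real_of_int N" and h: "\<And>l. h l \<in> fischer_comp J N l"
  shows "lap J (rsq J * fischer_sum J N d h) =
    fischer_sum J N d (\<lambda>l. shift J ((real d + 2 - real l) * (real_of_int N + real l + real d)) (h l))"
proof -
  have "lap J (rsq J * (rsq J ^ ((d - l) div 2) * h l)) = rsq J ^ ((d - l) div 2) *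
      shift J ((real d + 2 - real l) * (real_of_int N + real l + real d)) (h l)"
    if l: "l \<in> fischer_indices N d" for l
  proof -
    define j where "j = (d - l) div 2"
    have d: "d = l + 2 * j" using l by (auto simp: j_def fischer_indices_def)
    have "lap J (rsq J * (rsq J ^ j * h l)) = lap J (rsq J ^ Suc j * h l)" by (simp add: mult.assoc)
    also have "\<dots> = rsq J ^ Suc j * lap J (h l)
        + (2 * real (Suc j) * (sdim J + 2 * real l + 2 * real j)) *\<^sub>R (rsq J ^ j * h l)"
      by (rule lap_rsq_pow[OF J fischer_comp_hpolys[OF h]])
    also have "2 * real (Suc j) * (sdim J + 2 * real l + 2 * real j)
        = (real d + 2 - real l) * (real_of_int N + real l + real d)"
      by (simp add: d N algebra_simps)
    also have "rsq J ^ Suc j * lap J (h l) = rsq J ^ j * (rsq J * lap J (h l))"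
      unfolding power_Suc2 by (simp add: mult.assoc)
    finally show ?thesis
      by (simp add: j_def[symmetric] shift_def distrib_left add.commute)
  qed
  then show ?thesis
    by (simp add: fischer_sum_def sum_distrib_left)
qed

lemma fischer_sum_hpolys:
  assumes J: "symplectic_set J" and h: "\<And>l. h l \<in> fischer_comp J N l"
  shows "fischer_sum J N d h \<in> hpolys J d"
  unfolding fischer_sum_def
proof (rule hpolys_closed(6))
  fix l assume l: "l \<in> fischer_indices N d"
  then have "2 * ((d - l) div 2) + l = d" by (auto simp: fischer_indices_def)
  then show "rsq J ^ ((d - l) div 2) * h l \<in> hpolys J d"
    using rsq_pow_hpolys[OF J fischer_comp_hpolys[OF h], of "(d - l) div 2" l] by simp
qed

lemma fischer_sum_cong:
  "(\<And>l. l \<in> fischer_indices N d \<Longrightarrow> h l = h' l) \<Longrightarrow> fischer_sum J N d h = fischer_sum J N d h'"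
  by (simp add: fischer_sum_def)

text \<open>Existence and uniqueness are proved in one induction: existence in degree
  \<open>d + 2\<close> needs uniqueness in degree \<open>d\<close> to see that the new component is
  harmonic when \<open>d + 2\<close> is not exceptional.\<close>

lemma fischer_decomposition:
  assumes J: "symplectic_set J" and N: "sdim J = real_of_int N"
  shows "(\<forall>f\<in>hpolys J d. \<exists>h. (\<forall>l. h l \<in> fischer_comp J N l) \<and> f = fischer_sum J N d h) \<and>
    (\<forall>h. (\<forall>l. h l \<in> fischer_comp J N l) \<longrightarrow> fischer_sum J N d h = 0 \<longrightarrow>
      (\<forall>l\<in>fischer_indices N d. h l = 0))"
proof -
  have zero: "0 \<in> fischer_comp J N l" for l using subspace_0[OF subspace_fischer_comp] .
  \<comment> \<open>In degrees below 2 every polynomial is harmonic and no index is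
    exceptional.\<close>
  have base: "(\<forall>f\<in>hpolys J d. \<exists>h. (\<forall>l. h l \<in> fischer_comp J N l) \<and> f = fischer_sum J N d h) \<and>
    (\<forall>h. (\<forall>l. h l \<in> fischer_comp J N l) \<longrightarrow> fischer_sum J N d h = 0 \<longrightarrow>
      (\<forall>l\<in>fischer_indices N d. h l = 0))" if d: "d < 2" for d
  proof -
    have exc: "l \<ge> 2" if "l \<in> exceptional_indices N" for l
      using that by (auto simp: exceptional_indices_def split: if_splits)
    have "l = d" if "l \<le> d" "even (d + l)" for l
      using that d by (auto simp: less_2_cases_iff le_Suc_eq)
    then have I: "fischer_indices N d = {d}"
      using exc d by (force simp: fischer_indices_def)
    have "d \<notin> exceptional_indices N" using exc d by force
    then have "f \<in> fischer_comp J N d" if "f \<in> hpolys J d" for f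
      using that lap_hpolys_low[OF that d] by (simp add: fischer_comp_def harm_def)
    then have "(\<forall>l. (if l = d then f else 0) \<in> fischer_comp J N l) \<and>
        f = fischer_sum J N d (\<lambda>l. if l = d then f else 0)" if "f \<in> hpolys J d" for f
      using that zero by (simp add: fischer_sum_def I)
    then show ?thesis by (fastforce simp: fischer_sum_def I)
  qed
  show ?thesis
  proof (induction d rule: induct_nat_012)
    case (ge2 d)
    let ?d = "Suc (Suc d)"
    let ?I = "fischer_indices N d"
    define c where "c l = (real d + 2 - real l) * (real_of_int N + real l + real d)" for l
    define K where "K = {l \<in> ?I. int l \<noteq> 2 - N - int ?d}"
    note I = fischer_indices_Suc_Suc[where N = N and d = d, folded K_def]
    note S = shift_unshift[where N = N] and SC = shift_comp[OF J]
    have surj: "\<exists>h. (\<forall>l. h l \<in> fischer_comp J N l) \<and> f = fischer_sum J N d h" if "f \<in> hpolys J d" for f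
      using ge2(1) that by blast
    have inj: "h l = 0" if "\<And>l. h l \<in> fischer_comp J N l" "fischer_sum J N d h = 0" "l \<in> ?I" for h l
      using ge2(1) that by blast
    have A: "lap J (rsq J * fischer_sum J N d h) = fischer_sum J N d (\<lambda>l. shift J (c l) (h l))"
      if "\<And>l. h l \<in> fischer_comp J N l" for h
      using lap_rsq_fischer_sum[OF J N that] by (simp add: c_def)
    have c: "c l \<noteq> 0" if "l \<in> K" for l
      using that by (auto simp: c_def K_def fischer_indices_def)
    \<comment> \<open>On the dropped component the eigenvalue is 0 and all elements are harmonic, so
      both terms of \<open>shift\<close> vanish.\<close>
    have c0: "shift J (c l) x = 0" if "l \<in> ?I - K" "x \<in> fischer_comp J N l" for l x
    proof -
      have "real_of_int N + real l + real d = 0"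
        using that(1) by (auto simp: K_def)
      then show ?thesis using that I(4)[of l] by (simp add: shift_def c_def fischer_comp_def harm_def)
    qed
    have split: "fischer_sum J N ?d h = h ?d + rsq J * fischer_sum J N d (\<lambda>l. if l \<in> K then h l else 0)" for h
    proof -
      have "fischer_sum J N d (\<lambda>l. if l \<in> K then h l else 0)
          = (\<Sum>l\<in>K. rsq J ^ ((d - l) div 2) * (if l \<in> K then h l else 0))"
        unfolding fischer_sum_def by (rule sum.mono_neutral_right) (auto simp: K_def)
      also have "\<dots> = (\<Sum>l\<in>K. rsq J ^ ((d - l) div 2) * h l)" by (rule sum.cong) auto
      moreover have "rsq J * (rsq J ^ ((d - l) div 2) * h l) = rsq J ^ ((?d - l) div 2) * h l" if "l \<in> K" for l
      proof -
        have "l \<le> d" using that by (auto simp: K_def fischer_indices_def)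
        then have "(?d - l) div 2 = Suc ((d - l) div 2)" by (simp add: Suc_diff_le)
        then show ?thesis by (simp add: mult.assoc)
      qed
      moreover have "finite K" by (simp add: K_def)
      ultimately show ?thesis
        using I(2) by (simp add: fischer_sum_def[of J N ?d] I(1) sum_distrib_left)
    qed
    have "\<exists>h. (\<forall>l. h l \<in> fischer_comp J N l) \<and> f = fischer_sum J N ?d h" if f: "f \<in> hpolys J ?d" for f
    proof -
      obtain h where h: "\<And>l. h l \<in> fischer_comp J N l" "lap J f = fischer_sum J N d h"
        using surj[OF lap_hpolys[OF f]] by blast
      \<comment> \<open>The aim is a \<open>g\<close> such that Delta R^2 Delta annihilates
        \<open>f - rsq J * g\<close>. It suffices to invert Delta R^2 on the components in
        \<open>K\<close>: the part of \<open>lap J f\<close> in the dropped component is killed by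
        Delta R^2 anyway.\<close>
      define h' where "h' l = (if l \<in> K then unshift J (c l) (h l) else 0)" for l
      have h': "h' l \<in> fischer_comp J N l" for l using h(1) SC(2) zero by (simp add: h'_def)
      define g where "g = fischer_sum J N d h'"
      define f' where "f' = f - rsq J * g"
      have f'd: "f' \<in> hpolys J ?d"
        unfolding f'_def g_def by (intro hpolys_closed f rsq_mult_hpolys J fischer_sum_hpolys h')
      have "lap J (rsq J * lap J (rsq J * g)) = fischer_sum J N d (\<lambda>l. shift J (c l) (shift J (c l) (h' l)))"
        unfolding g_def A[OF h'] by (rule A) (rule SC(1)[OF h'])
      also have "\<dots> = fischer_sum J N d (\<lambda>l. shift J (c l) (h l))"
      proof (rule fischer_sum_cong)
        fix l assume "l \<in> ?I"
        then show "shift J (c l) (shift J (c l) (h' l)) = shift J (c l) (h l)"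
          using S(1)[OF h(1) c] c0[of l "h l"] h(1) by (cases "l \<in> K") (auto simp: h'_def shift_def[of _ _ 0])
      qed
      also have "\<dots> = lap J (rsq J * lap J f)" using A[OF h(1)] h(2) by simp
      finally have gh: "lap J (rsq J * lap J f') = 0" by (simp add: f'_def right_diff_distrib)
      then have "f' \<in> gharm J ?d" using f'd by (simp add: gharm_def)
      \<comment> \<open>Here no component is dropped, so Delta R^2 is injective in degree
        \<open>d\<close> and can be cancelled from the equation for \<open>f'\<close>.\<close>
      moreover have "f' \<in> harm J ?d" if "?d \<notin> exceptional_indices N"
      proof -
        obtain h2 where h2: "\<And>l. h2 l \<in> fischer_comp J N l" "lap J f' = fischer_sum J N d h2"
          using surj[OF lap_hpolys[OF f'd]] by blast
        have z: "fischer_sum J N d (\<lambda>l. shift J (c l) (h2 l)) = 0" using A[OF h2(1)] gh h2(2) by simp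
        have "h2 l = 0" if "l \<in> ?I" for l
        proof -
          have "shift J (c l) (h2 l) = 0"
            using inj[of "\<lambda>l. shift J (c l) (h2 l)", OF SC(1)[OF h2(1)] z that] .
          moreover have "l \<in> K" using I(3) that \<open>?d \<notin> exceptional_indices N\<close> by simp
          ultimately show ?thesis using S(2)[OF h2(1)[of l] c[of l]] by (simp add: unshift_def)
        qed
        then have "lap J f' = 0" using h2(2) by (simp add: fischer_sum_def)
        then show ?thesis using f'd by (simp add: harm_def)
      qed
      ultimately have f'c: "f' \<in> fischer_comp J N ?d" by (simp add: fischer_comp_def)
      let ?h = "\<lambda>l. if l = ?d then f' else h' l"
      have "(\<lambda>l. if l \<in> K then ?h l else 0) = h'" using I(2) by (auto simp: h'_def fun_eq_iff)
      then have "f = fischer_sum J N ?d ?h" unfolding split by (simp add: f'_def g_def)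
      moreover have "\<forall>l. ?h l \<in> fischer_comp J N l" using f'c h' by simp
      ultimately show ?thesis by (intro exI[of _ ?h] conjI)
    qed
    moreover have "\<forall>l\<in>fischer_indices N ?d. h l = 0"
      if h: "\<forall>l. h l \<in> fischer_comp J N l" and s: "fischer_sum J N ?d h = 0" for h
    proof -
      define h' where "h' l = (if l \<in> K then h l else 0)" for l
      define g where "g = fischer_sum J N d h'"
      have h': "h' l \<in> fischer_comp J N l" for l using h zero by (simp add: h'_def)
      \<comment> \<open>Since Delta R^2 Delta kills the top component, (Delta R^2)^2 kills
        \<open>g\<close>; all components of \<open>g\<close> lie in \<open>K\<close>, where Delta
        R^2 is injective.\<close>
      have hd: "h ?d = - (rsq J * g)" using s unfolding split g_def h'_def by (simp add: eq_neg_iff_add_eq_0)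
      have "h ?d \<in> fischer_comp J N ?d" using h by blast
      then have "lap J (rsq J * lap J (h ?d)) = 0"
        by (auto simp: fischer_comp_def harm_def gharm_def split: if_splits)
      then have "lap J (rsq J * lap J (rsq J * g)) = 0" by (simp add: hd)
      moreover have "lap J (rsq J * lap J (rsq J * g)) = fischer_sum J N d (\<lambda>l. shift J (c l) (shift J (c l) (h' l)))"
        unfolding g_def A[OF h'] by (rule A) (rule SC(1)[OF h'])
      ultimately have z: "shift J (c l) (shift J (c l) (h' l)) = 0" if "l \<in> ?I" for l
        using inj[of "\<lambda>l. shift J (c l) (shift J (c l) (h' l))" l, OF SC(1)[OF SC(1)[OF h']] _ that] by simp
      have hK: "h l = 0" if "l \<in> K" for l
      proof -
        have "l \<in> ?I" using that by (simp add: K_def)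
        have "shift J (c l) (h' l) = 0"
          using S(2)[OF SC(1)[OF h', of "c l" l] c[OF that]] z[OF \<open>l \<in> ?I\<close>] by (simp add: unshift_def)
        then have "h' l = 0" using S(2)[OF h'[of l] c[OF that]] by (simp add: unshift_def)
        then show ?thesis using that by (simp add: h'_def)
      qed
      then have "h' l = 0" for l by (simp add: h'_def)
      then have "g = 0" by (simp add: g_def fischer_sum_def)
      then show ?thesis using hK hd by (auto simp: I(1))
    qed
    ultimately show ?case by blast
  qed (rule base; simp)+
qed

section \<open>Indecomposability\<close>

definition rot_stable :: "idx set \<Rightarrow> spoly set \<Rightarrow> bool" where
  "rot_stable J U \<longleftrightarrow> subspace U \<and> (\<forall>a\<in>J. \<forall>b\<in>J. \<forall>u\<in>U. rot a b u \<in> U)"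

text \<open>The zero space qualifies, unlike in \<open>indecomposable\<close>, so that inductions
  may pass through degrees without harmonics.\<close>

definition rot_indecomposable :: "idx set \<Rightarrow> spoly set \<Rightarrow> bool" where
  "rot_indecomposable J H \<longleftrightarrow> (\<forall>U W. rot_stable J U \<and> rot_stable J W \<and> U \<inter> W = {0} \<and>
     H = {u + w | u w. u \<in> U \<and> w \<in> W} \<longrightarrow> U = {0} \<or> W = {0})"

lemma rot_stableD:
  "rot_stable J U \<Longrightarrow> subspace U" "rot_stable J U \<Longrightarrow> a \<in> J \<Longrightarrow> b \<in> J \<Longrightarrow> u \<in> U \<Longrightarrow> rot a b u \<in> U"
  by (auto simp: rot_stable_def)

lemma sum_summands:
  assumes "subspace U" "subspace W" "H = {u + w | u w. u \<in> U \<and> w \<in> W}"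
  shows "U \<subseteq> H" "W \<subseteq> H"
proof -
  have "u + 0 \<in> H" "0 + w \<in> H" if "u \<in> U" "w \<in> W" for u w
    unfolding assms(3) using that subspace_0 assms(1,2) by blast+
  then show "U \<subseteq> H" "W \<subseteq> H" using subspace_0 assms(1,2) by fastforce+
qed

lemma rot_indecomposableI:
  assumes "\<And>U W. rot_stable J U \<Longrightarrow> rot_stable J W \<Longrightarrow> U \<inter> W = {0} \<Longrightarrow>
     H = {u + w | u w. u \<in> U \<and> w \<in> W} \<Longrightarrow> U \<subseteq> H \<Longrightarrow> W \<subseteq> H \<Longrightarrow> U \<subseteq> {0} \<or> W \<subseteq> {0}"
  shows "rot_indecomposable J H"
  unfolding rot_indecomposable_def
proof (intro allI impI)
  fix U W
  assume *: "rot_stable J U \<and> rot_stable J W \<and> U \<inter> W = {0} \<and> H = {u + w | u w. u \<in> U \<and> w \<in> W}"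
  then have "U \<subseteq> H" "W \<subseteq> H" using sum_summands[of U W H] rot_stableD(1) by blast+
  then have "U \<subseteq> {0} \<or> W \<subseteq> {0}" using assms[of U W] * by blast
  then show "U = {0} \<or> W = {0}" using * by blast
qed

text \<open>The functional embeds \<open>H\<close> into a line, where two nonzero subspaces cannot
  meet in 0.\<close>

lemma one_dim_indecomposable:
  fixes \<phi> :: "spoly \<Rightarrow> real"
  assumes lin: "linear \<phi>" and inj: "\<And>f. f \<in> H \<Longrightarrow> \<phi> f = 0 \<Longrightarrow> f = 0" and H: "subspace H"
  shows "rot_indecomposable J H"
proof (rule rot_indecomposableI, rule ccontr)
  fix U W assume *: "rot_stable J U" "rot_stable J W" "U \<inter> W = {0}" "U \<subseteq> H" "W \<subseteq> H" "\<not> (U \<subseteq> {0} \<or> W \<subseteq> {0})"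
  then obtain u w where uw: "u \<in> U" "w \<in> W" "u \<noteq> 0" "w \<noteq> 0" by blast
  have "\<phi> w *\<^sub>R u - \<phi> u *\<^sub>R w \<in> H"
    using H uw * by (intro subspace_diff subspace_scale) auto
  moreover have "\<phi> (\<phi> w *\<^sub>R u - \<phi> u *\<^sub>R w) = 0"
    by (simp add: linear_diff[OF lin] linear_scale[OF lin])
  ultimately have e: "\<phi> w *\<^sub>R u = \<phi> u *\<^sub>R w" using inj by force
  then have "\<phi> w *\<^sub>R u \<in> U \<inter> W"
    using uw *(1,2) rot_stableD(1) by (metis IntI subspace_scale)
  then have "\<phi> w = 0" using *(3) uw by auto
  then show False using inj uw * by blast
qed

text \<open>In a fixed degree the Casimir element is a scalar minus 2 R^2 Delta, so the formula can
  be solved for R^2 Delta although this operator does not belong to the algebra.\<close>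

lemma rsq_lap_stable:
  assumes J: "symplectic_set J" and U: "rot_stable J U" "U \<subseteq> hpolys J k" and u: "u \<in> U"
  shows "rsq J * lap J u \<in> U"
proof -
  note sub = rot_stableD(1)[OF U(1)]
  define C where "C = (\<Sum>a\<in>J. \<Sum>b\<in>J. (sg a a * sg b b / (metric a * metric b)) *\<^sub>R rot a b (rot (dual b) (dual a) u))"
  have "C \<in> U" unfolding C_def
    by (intro subspace_sum[OF sub] subspace_scale[OF sub] rot_stableD(2)[OF U(1)] symplectic_setD(2)[OF J] u)
  moreover have "C = (2 * real k * (real k + sdim J - 2)) *\<^sub>R u - 2 *\<^sub>R (rsq J * lap J u)"
    unfolding C_def using casimir[OF J] u U(2) by blast
  then have "rsq J * lap J u = (1/2) *\<^sub>R ((2 * real k * (real k + sdim J - 2)) *\<^sub>R u - C)" by simp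
  ultimately show ?thesis using u sub by (metis subspace_diff subspace_scale)
qed

lemma rsq_injective:
  assumes J: "symplectic_set J" and i: "Inl i \<in> J" and g: "g \<in> hpolys J k" and z: "rsq J * g = 0"
  shows "g = 0"
proof (rule ccontr)
  assume "g \<noteq> 0"
  let ?P = "\<lambda>s. (pder (Inl i) ^^ s) g"
  have d: "pder (Inl i) (rsq J * f) = rsq J * pder (Inl i) f + 2 *\<^sub>R (var (Inl i) * f)" for f
    using uder_rsq[OF J, of "Inl i" f] i by (simp add: uder_def)
  have leib: "(pder (Inl i) ^^ s) (rsq J * g) = rsq J * ?P s
      + (2 * real s) *\<^sub>R (var (Inl i) * ?P (s - 1)) + (real s * (real s - 1)) *\<^sub>R ?P (s - 2)" for s
  proof (induction s)
    case (Suc s)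
    let ?x = "var (Inl i)"
    have a: "(2 * real s) *\<^sub>R (?x * pder (Inl i) (?P (s - 1))) = (2 * real s) *\<^sub>R (?x * ?P s)"
      by (cases s) auto
    have b: "(real s * (real s - 1)) *\<^sub>R pder (Inl i) (?P (s - 2)) = (real s * (real s - 1)) *\<^sub>R ?P (s - 1)"
      using pder_linear(1) by (cases s; cases "s - 1") (auto simp: diff_Suc split: nat.splits)
    have "(pder (Inl i) ^^ Suc s) (rsq J * g) = rsq J * ?P (Suc s) + 2 *\<^sub>R (?x * ?P s)
        + (2 * real s) *\<^sub>R (?P (s - 1)) + (2 * real s) *\<^sub>R (?x * pder (Inl i) (?P (s - 1)))
        + (real s * (real s - 1)) *\<^sub>R pder (Inl i) (?P (s - 2))"
      using Suc by (simp add: d pder_var scaleR_add_right)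
    also have "\<dots> = rsq J * ?P (Suc s) + (2 + 2 * real s) *\<^sub>R (?x * ?P s)
        + (2 * real s + real s * (real s - 1)) *\<^sub>R ?P (s - 1)"
      unfolding a b by (simp only: scaleR_add_left add.assoc add.commute add.left_commute)
    also have "2 * real s + real s * (real s - 1) = real (Suc s) * (real (Suc s) - 1)"
      by (simp add: algebra_simps)
    finally show ?case by (simp add: numeral_2_eq_2)
  qed simp
  have "?P s \<in> hpolys J (k - s) \<and> (k < s \<longrightarrow> ?P s = 0)" for s
  proof (induction s)
    case (Suc s)
    then show ?case using pder_hpolys[of "?P s" J "k - s" "Inl i"] by (cases "k < s") auto
  qed (use g in auto)
  then have "?P (Suc k) = 0" by blast
  define e where "e = (LEAST s. ?P s = 0)"
  have e: "?P e = 0" unfolding e_def by (rule LeastI[of _ "Suc k"]) fact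
  then have "e \<noteq> 0" using \<open>g \<noteq> 0\<close> by (cases e) auto
  then obtain e' where e': "e = Suc e'" by (cases e) auto
  have nz: "?P e' \<noteq> 0" using not_less_Least[of e' "\<lambda>s. ?P s = 0"] e' by (auto simp: e_def)
  have z0: "(pder (Inl i) ^^ s) 0 = 0" for s by (induction s) auto
  have "?P (e' + 2) = 0" "?P (e' + 1) = 0" using e e' by simp_all
  then have "(real (e' + 2) * (real (e' + 2) - 1)) *\<^sub>R ?P e' = 0"
    using leib[of "e' + 2"] z z0 by simp
  then show False using nz by simp
qed

text \<open>A nonzero summand meets the harmonics: it contains a harmonic vector, or else the
  nonzero harmonic image of one of its vectors under R^2 Delta. Two nonzero summands would therefore
  split the harmonics.\<close>

lemma gharm_indecomposable:
  assumes J: "symplectic_set J" and i: "Inl i \<in> J" and H: "rot_indecomposable J (harm J k)"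
  shows "rot_indecomposable J (gharm J k)"
proof (rule rot_indecomposableI)
  fix U W
  assume U: "rot_stable J U" and W: "rot_stable J W" and UW: "U \<inter> W = {0}"
    "gharm J k = {u + w | u w. u \<in> U \<and> w \<in> W}" "U \<subseteq> gharm J k" "W \<subseteq> gharm J k"
  have T0: "f \<in> harm J k" if "f \<in> gharm J k" "rsq J * lap J f = 0" for f
    using that rsq_injective[OF J i lap_hpolys'[of f J k]] by (auto simp: gharm_def harm_def)
  have T1: "rsq J * lap J f \<in> harm J k" if "f \<in> gharm J k" for f
    using that rsq_lap_hpolys[OF J] by (auto simp: gharm_def harm_def)
  have Tst: "rsq J * lap J f \<in> V" if "V = U \<or> V = W" "f \<in> V" for V f
    using that rsq_lap_stable[OF J, of V k f] U W UW(3,4) gharm_hpolys by blast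
  have st: "rot_stable J (V \<inter> harm J k)" if "V = U \<or> V = W" for V
    using that U W rot_harm(1)[OF J] subspace_inter[OF _ subspace_harm] by (auto simp: rot_stable_def)
  have "harm J k = {u + w | u w. u \<in> U \<inter> harm J k \<and> w \<in> W \<inter> harm J k}"
  proof (intro equalityI subsetI)
    fix f assume f: "f \<in> harm J k"
    then obtain u w where uw: "f = u + w" "u \<in> U" "w \<in> W" using UW(2) harm_gharm[OF f] by blast
    \<comment> \<open>R^2 Delta preserves both summands, so it kills the two components of a
      harmonic vector separately.\<close>
    have "rsq J * lap J u + rsq J * lap J w = rsq J * lap J f"
      by (simp add: uw(1) distrib_left)
    also have "\<dots> = 0" using f by (simp add: harm_def)
    finally have e: "rsq J * lap J u = - (rsq J * lap J w)" by (simp add: eq_neg_iff_add_eq_0)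
    have "rsq J * lap J u \<in> U" "rsq J * lap J w \<in> W" using Tst uw by blast+
    then have "rsq J * lap J u \<in> U \<inter> W"
      using e subspace_neg[OF rot_stableD(1)[OF W]] by auto
    then have "rsq J * lap J u = 0" "rsq J * lap J w = 0" using UW(1) e by auto
    then have "u \<in> harm J k" "w \<in> harm J k" using T0 uw UW(3,4) by blast+
    then show "f \<in> {u + w | u w. u \<in> U \<inter> harm J k \<and> w \<in> W \<inter> harm J k}" using uw by blast
  qed (auto intro: subspace_add[OF subspace_harm])
  moreover have "(U \<inter> harm J k) \<inter> (W \<inter> harm J k) = {0}"
    using UW(1) subspace_0[OF subspace_harm] by blast
  ultimately have "U \<inter> harm J k = {0} \<or> W \<inter> harm J k = {0}"
    using H st unfolding rot_indecomposable_def by blast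
  moreover have "V \<subseteq> {0}" if V: "V = U \<or> V = W" and z: "V \<inter> harm J k = {0}" for V
  proof
    fix u assume u: "u \<in> V"
    then have "u \<in> gharm J k" using V UW(3,4) by blast
    then have "rsq J * lap J u \<in> V \<inter> harm J k" using Tst[OF V u] T1 by blast
    then have "u \<in> harm J k" using T0 \<open>u \<in> gharm J k\<close> z by blast
    then show "u \<in> {0}" using u z by blast
  qed
  ultimately show "U \<subseteq> {0} \<or> W \<subseteq> {0}" by blast
qed

section \<open>Superspaces without even variables\<close>

lemma odd_hpolys_bound:
  assumes J: "finite J" "\<And>i. Inl i \<notin> J" and u: "mvars u \<subseteq> J"
  shows "fst u = 0 \<and> mdeg u \<le> card J \<and> (mdeg u = card J \<longrightarrow> Inr ` fset (snd u) = J)"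
proof -
  have "i \<notin> Poly_Mapping.keys (fst u)" for i using u J(2)[of i] by (auto simp: mvars_def)
  then have "Poly_Mapping.keys (fst u) = {}" by blast
  then have 0: "fst u = 0" by simp
  have sub: "Inr ` fset (snd u) \<subseteq> J" using u by (auto simp: mvars_def)
  have "card (Inr ` fset (snd u) :: idx set) = mdeg u"
    using 0 by (simp add: mdeg_def fcard.rep_eq card_image)
  then show ?thesis using card_mono[OF J(1) sub] card_subset_eq[OF J(1) sub] 0 by auto
qed

lemma odd_hpolys_zero:
  assumes J: "finite J" "\<And>i. Inl i \<notin> J" and "f \<in> hpolys J k" "card J < k"
  shows "f = 0"
proof -
  have "u \<notin> supp f" for u
    using assms(3,4) odd_hpolys_bound[OF J, of u] by (auto simp: hpolys_def)
  then show ?thesis by (intro spoly_eqI) (auto simp: supp_iff)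
qed

text \<open>R^2 is nilpotent for reasons of degree. Applying the Laplacian lowers the power of R^2
  that annihilates \<open>f\<close>, one step at a time, because the constant in
  \<open>lap_rsq_pow\<close> is positive.\<close>

lemma odd_rsq_lap_zero:
  assumes J: "symplectic_set J" "\<And>i. Inl i \<notin> J" and f: "f \<in> hpolys J k" "rsq J * lap J f = 0"
    and k: "2 * real k + sdim J > 0"
  shows "f = 0"
proof -
  have step: "rsq J ^ j * f = 0" if "rsq J ^ Suc j * f = 0" for j
  proof -
    have "rsq J ^ Suc j * lap J f = rsq J ^ j * (rsq J * lap J f)"
      unfolding power_Suc2 by (simp add: mult.assoc)
    then have "(2 * real (Suc j) * (sdim J + 2 * real k + 2 * real j)) *\<^sub>R (rsq J ^ j * f) = 0"
      using lap_rsq_pow[OF J(1) f(1), of j] that f(2) by simp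
    moreover have "2 * real (Suc j) * (sdim J + 2 * real k + 2 * real j) > 0"
      using k by (intro mult_pos_pos) simp_all
    ultimately show ?thesis by (metis scaleR_eq_0_iff less_irrefl)
  qed
  have z: "rsq J ^ Suc (card J) * f = 0"
    by (rule odd_hpolys_zero[OF symplectic_setD(1)[OF J(1)] J(2) rsq_pow_hpolys[OF J(1) f(1)]]) simp
  have "rsq J ^ 0 * f = 0" if "rsq J ^ j * f = 0" for j
    using that by (induction j) (use step in blast)+
  from this[OF z] show ?thesis by simp
qed

text \<open>The clause for \<open>k = 0\<close> compensates for the truncated subtraction in the
  degree of \<open>f1\<close>.\<close>

lemma hpolys_split_odd:
  assumes "f \<in> hpolys J k"
  shows "\<exists>f0 f1. f0 \<in> hpolys (J - {Inr j}) k \<and> f1 \<in> hpolys (J - {Inr j}) (k - 1) \<and>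
    (k = 0 \<longrightarrow> f1 = 0) \<and> f = f0 + var (Inr j) * f1"
  using assms
proof (induction rule: hpolys_induct)
  case (zero k)
  show ?case by (intro exI[of _ 0]) simp
next
  case one
  show ?case by (intro exI[of _ 1] exI[of _ 0]) simp
next
  case (var b k g)
  let ?J = "J - {Inr j}"
  obtain g0 g1 where g: "g0 \<in> hpolys ?J k" "g1 \<in> hpolys ?J (k - 1)" "k = 0 \<longrightarrow> g1 = 0" "g = g0 + var (Inr j) * g1"
    using var.IH by blast
  show ?case
  proof (cases "b = Inr j")
    case True
    have "var (Inr j) * (var (Inr j) * g1) = 0"
      using var_comm[of "Inr j" "Inr j" g1] by (simp add: eq_neg_iff_add_eq_0 flip: scaleR_2)
    then show ?thesis using g True by (intro exI[of _ 0] exI[of _ g0]) (simp add: distrib_left)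
  next
    case False
    have "var b * g1 \<in> hpolys ?J k"
      using g(2,3) var(1) False var_mult_hpolys[of b ?J g1 "k - 1"] by (cases k) auto
    moreover have "var b * g0 \<in> hpolys ?J (Suc k)" using g(1) var(1) False by (intro var_mult_hpolys) auto
    ultimately show ?thesis
      using g(4) var_comm[of b "Inr j" g1]
      by (intro exI[of _ "var b * g0"] exI[of _ "sg b (Inr j) *\<^sub>R (var b * g1)"]) (auto simp: distrib_left)
  qed
next
  case (add k f g)
  then obtain f0 f1 g0 g1 where
    "f0 \<in> hpolys (J - {Inr j}) k" "f1 \<in> hpolys (J - {Inr j}) (k - 1)" "k = 0 \<longrightarrow> f1 = 0" "f = f0 + var (Inr j) * f1"
    "g0 \<in> hpolys (J - {Inr j}) k" "g1 \<in> hpolys (J - {Inr j}) (k - 1)" "k = 0 \<longrightarrow> g1 = 0" "g = g0 + var (Inr j) * g1"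
    by blast
  then show ?case by (intro exI[of _ "f0 + g0"] exI[of _ "f1 + g1"]) (auto simp: distrib_left)
next
  case (scale k c f)
  then obtain f0 f1 where
    "f0 \<in> hpolys (J - {Inr j}) k" "f1 \<in> hpolys (J - {Inr j}) (k - 1)" "k = 0 \<longrightarrow> f1 = 0" "f = f0 + var (Inr j) * f1"
    by blast
  then show ?case by (intro exI[of _ "c *\<^sub>R f0"] exI[of _ "c *\<^sub>R f1"]) (auto simp: scaleR_add_right)
qed

lemma var_odd_square: "var (Inr j) * (var (Inr j) * g) = 0"
  using var_comm[of "Inr j" "Inr j" g] by (simp add: eq_neg_iff_add_eq_0 flip: scaleR_2)

text \<open>
  A hyperbolic plane \<open>\<alpha>, \<beta>\<close> of odd variables is split off. The part of weight \<open>1\<close> of a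
  summand for the torus of this plane is a summand for the smaller index set.
\<close>

locale odd_plane =
  fixes J J0 :: "idx set" and \<alpha> \<beta> :: idx and j :: nat
  assumes J: "symplectic_set J" and \<alpha>: "\<alpha> = Inr j" "odd j" "\<alpha> \<in> J" and \<beta>: "\<beta> = Inr (Suc j)"
    and J0_def: "J0 = J - {\<alpha>} - {\<beta>}"
begin

lemma \<beta>_dual: "dual \<alpha> = \<beta>" "dual \<beta> = \<alpha>"
  using \<alpha> \<beta> by (auto simp: dual_def)

lemma basic:
  "symplectic_set J0" "J0 \<subseteq> J" "\<beta> \<in> J" "\<alpha> \<notin> J0" "\<beta> \<notin> J0" "\<alpha> \<noteq> \<beta>"
  "metric \<alpha> = 2" "metric \<beta> = - 2" "sg \<alpha> \<beta> = - 1" "sg \<beta> \<alpha> = - 1" "sg \<alpha> \<alpha> = - 1" "sg \<beta> \<beta> = - 1"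
  "sg a \<alpha> = sg a \<beta>"
proof -
  show "\<beta> \<in> J" using symplectic_setD(2)[OF J \<alpha>(3)] \<beta>_dual by simp
  have "dual a \<in> J0" if "a \<in> J0" for a
    using that symplectic_setD(2)[OF J, of a] \<beta>_dual unfolding J0_def by (metis DiffE DiffI dual_dual singletonD singletonI)
  then show "symplectic_set J0" using J by (auto simp: symplectic_set_def J0_def)
qed (use \<alpha> \<beta> in \<open>auto simp: J0_def metric_def sg_def\<close>)

lemma sum_plane: "(\<Sum>a\<in>J. g a) = g \<alpha> + (g \<beta> + (\<Sum>a\<in>J0. g a))" for g :: "idx \<Rightarrow> 'v::comm_monoid_add"
proof -
  have "\<beta> \<in> J - {\<alpha>}" using basic by auto
  then show ?thesis
    using sum.remove[OF symplectic_setD(1)[OF J] \<alpha>(3), of g] sum.remove[of "J - {\<alpha>}" \<beta> g] symplectic_setD(1)[OF J]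
    by (simp add: J0_def)
qed

lemma sdim: "sdim J0 = sdim J + 2"
  by (simp add: sdim_def sum_plane basic)

lemma inside:
  assumes "g \<in> polys J0"
  shows "pder \<alpha> g = 0" "pder \<beta> g = 0" "uder \<alpha> g = 0" "uder \<beta> g = 0" "lap J g = lap J0 g"
proof -
  show *: "pder \<alpha> g = 0" "pder \<beta> g = 0" using pder_outside[OF assms] basic by auto
  then show "uder \<alpha> g = 0" "uder \<beta> g = 0" by (simp_all add: uder_def \<beta>_dual)
  then show "lap J g = lap J0 g" using * by (simp add: lap_def sum_plane)
qed

lemma decompose:
  assumes "f \<in> hpolys J (Suc k)"
  obtains f0 f1 f2 f3 where "f0 \<in> hpolys J0 (Suc k)" "f1 \<in> hpolys J0 k" "f2 \<in> hpolys J0 k"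
    "f3 \<in> hpolys J0 (k - 1)" "k = 0 \<Longrightarrow> f3 = 0"
    "f = f0 + var \<alpha> * f1 + var \<beta> * f2 + var \<alpha> * (var \<beta> * f3)"
proof -
  obtain g0 g1 where g: "g0 \<in> hpolys (J - {\<alpha>}) (Suc k)" "g1 \<in> hpolys (J - {\<alpha>}) k" "f = g0 + var \<alpha> * g1"
    using hpolys_split_odd[OF assms, of j] \<alpha> by auto
  obtain f0 f2 where f0: "f0 \<in> hpolys J0 (Suc k)" "f2 \<in> hpolys J0 k" "g0 = f0 + var \<beta> * f2"
    using hpolys_split_odd[OF g(1), of "Suc j"] \<beta> by (auto simp: J0_def)
  obtain f1 f3 where f1: "f1 \<in> hpolys J0 k" "f3 \<in> hpolys J0 (k - 1)" "k = 0 \<longrightarrow> f3 = 0" "g1 = f1 + var \<beta> * f3"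
    using hpolys_split_odd[OF g(2), of "Suc j"] \<beta> by (auto simp: J0_def)
  have "f = f0 + var \<alpha> * f1 + var \<beta> * f2 + var \<alpha> * (var \<beta> * f3)"
    by (simp add: g f0 f1 distrib_left)
  then show thesis using that f0 f1 by blast
qed

lemma unique:
  assumes "f0 \<in> polys J0" "f1 \<in> polys J0" "f2 \<in> polys J0" "f3 \<in> polys J0"
    and "f0 + var \<alpha> * f1 + var \<beta> * f2 + var \<alpha> * (var \<beta> * f3) = 0"
  shows "f0 = 0 \<and> f1 = 0 \<and> f2 = 0 \<and> f3 = 0"
proof -
  have 1: "pder \<beta> (f0 + var \<alpha> * f1 + var \<beta> * f2 + var \<alpha> * (var \<beta> * f3)) = f2 - var \<alpha> * f3"
    using assms(1-4) by (simp add: pder_var inside basic basic(6)[symmetric])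
  have 2: "pder \<alpha> (f2 - var \<alpha> * f3) = - f3"
    using assms(1-4) by (simp add: pder_var inside basic)
  have 3: "f3 = 0" using 2 unfolding 1[symmetric] assms(5) by simp
  then have 4: "f2 = 0" using 1[unfolded assms(5)] by simp
  have "pder \<alpha> (f0 + var \<alpha> * f1) = f1"
    using assms(1-4) by (simp add: pder_var inside basic)
  moreover have "f0 + var \<alpha> * f1 = 0" using assms(5) 3 4 by simp
  ultimately show ?thesis using 3 4 by (metis add.right_neutral mult_zero_right pder_linear(1))
qed

text \<open>The part of the Laplacian belonging to the plane differentiates by both of its
  variables, so it sees only \<open>f3\<close> and moves it to the component without either
  variable.\<close>

lemma lap_decomposed:
  assumes "f0 \<in> polys J0" "f1 \<in> polys J0" "f2 \<in> polys J0" "f3 \<in> polys J0"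
  shows "lap J (f0 + var \<alpha> * f1 + var \<beta> * f2 + var \<alpha> * (var \<beta> * f3))
    = (lap J0 f0 + 4 *\<^sub>R f3) + var \<alpha> * lap J0 f1 + var \<beta> * lap J0 f2 + var \<alpha> * (var \<beta> * lap J0 f3)"
  using assms \<alpha>(3) basic(3) \<beta>_dual
  by (simp add: lap_var[OF J] uder_var inside basic basic(6)[symmetric])

lemma harm_decomposed:
  assumes "f0 \<in> polys J0" "f1 \<in> polys J0" "f2 \<in> polys J0" "f3 \<in> polys J0"
    and "lap J (f0 + var \<alpha> * f1 + var \<beta> * f2 + var \<alpha> * (var \<beta> * f3)) = 0"
  shows "lap J0 f0 + 4 *\<^sub>R f3 = 0" "lap J0 f1 = 0" "lap J0 f2 = 0" "lap J0 f3 = 0"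
proof -
  have "lap J0 f0 + 4 *\<^sub>R f3 \<in> polys J0" using assms by (intro polys_closed lap_polys)
  from unique[OF this lap_polys lap_polys lap_polys assms(5)[unfolded lap_decomposed[OF assms(1-4)]]] assms
  show "lap J0 f0 + 4 *\<^sub>R f3 = 0" "lap J0 f1 = 0" "lap J0 f2 = 0" "lap J0 f3 = 0" by blast+
qed

lemma var_harm:
  assumes "g \<in> harm J0 k"
  shows "var \<alpha> * g \<in> harm J (Suc k)"
proof -
  have "g \<in> polys J0" using assms harm_hpolys hpolys_polys by blast
  then have "lap J (var \<alpha> * g) = 0" using lap_decomposed[of 0 g 0 0] assms by (simp add: harm_def)
  moreover have "var \<alpha> * g \<in> hpolys J (Suc k)"
    by (rule var_mult_hpolys[OF \<alpha>(3) hpolys_mono[OF basic(2) harm_hpolys[OF assms]]])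
  ultimately show ?thesis by (simp add: harm_def)
qed

text \<open>A torus element \<open>h\<close> with weights 1, -1, 0, 0 on the components of
  \<open>f1\<close>, \<open>f2\<close>, \<open>f0\<close>, \<open>f3\<close> is available, and (h^2
  + h) / 2 projects onto weight 1.\<close>

lemma weight_one:
  assumes U: "rot_stable J U" and u: "f0 + var \<alpha> * f1 + var \<beta> * f2 + var \<alpha> * (var \<beta> * f3) \<in> U"
    and f: "f0 \<in> polys J0" "f1 \<in> polys J0" "f2 \<in> polys J0" "f3 \<in> polys J0"
  shows "var \<alpha> * f1 \<in> U"
proof -
  let ?u = "f0 + var \<alpha> * f1 + var \<beta> * f2 + var \<alpha> * (var \<beta> * f3)"
  \<comment> \<open>The factor compensates the values 2 and -2 of \<open>metric\<close> on the
    plane.\<close>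
  define h where "h x = (- 1 / 2) *\<^sub>R rot \<alpha> \<beta> x" for x
  have h: "h x = var \<alpha> * pder \<alpha> x - var \<beta> * pder \<beta> x" for x
    by (simp add: h_def rot_def uder_def \<beta>_dual basic scaleR_add_right scaleR_diff_right)
  have sq: "var \<alpha> * (var \<alpha> * g) = 0" "var \<beta> * (var \<beta> * g) = 0" "var \<beta> * (var \<alpha> * g) = - (var \<alpha> * (var \<beta> * g))" for g
    using var_odd_square \<alpha> \<beta> var_comm[of \<beta> \<alpha> g] basic by auto
  have "h ?u = var \<alpha> * f1 - var \<beta> * f2"
    unfolding h using f by (simp add: pder_var inside basic basic(6)[symmetric] sq distrib_left algebra_simps)
  moreover have "h (var \<alpha> * f1 - var \<beta> * f2) = var \<alpha> * f1 + var \<beta> * f2"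
    unfolding h using f by (simp add: pder_var inside basic basic(6)[symmetric] sq distrib_left algebra_simps)
  moreover have hU: "h x \<in> U" if "x \<in> U" for x
    unfolding h_def using that rot_stableD[OF U] \<alpha>(3) basic(3) by (intro subspace_scale) auto
  ultimately have d: "var \<alpha> * f1 - var \<beta> * f2 \<in> U" "var \<alpha> * f1 + var \<beta> * f2 \<in> U" using u by metis+
  then have "(1/2) *\<^sub>R ((var \<alpha> * f1 - var \<beta> * f2) + (var \<alpha> * f1 + var \<beta> * f2)) \<in> U"
    by (intro subspace_scale[OF rot_stableD(1)[OF U]] subspace_add[OF rot_stableD(1)[OF U] d])
  then show ?thesis by (simp flip: scaleR_2)
qed

lemma weight_one_stable:
  assumes U: "rot_stable J U"
  shows "rot_stable J0 {g \<in> harm J0 k. var \<alpha> * g \<in> U}"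
proof -
  have "var \<alpha> * rot a b g \<in> U" if "a \<in> J0" "b \<in> J0" "var \<alpha> * g \<in> U" for a b g
  proof -
    have "\<alpha> \<noteq> dual a" "\<alpha> \<noteq> dual b" using that basic(5) \<beta>_dual by auto
    then have r: "rot a b (var \<alpha> * g) = (sg a \<alpha> * sg b \<alpha>) *\<^sub>R (var \<alpha> * rot a b g)" by (rule rot_var)
    have "rot a b (var \<alpha> * g) \<in> U" using rot_stableD(2)[OF U] that basic(2) by blast
    then have "(sg a \<alpha> * sg b \<alpha>) *\<^sub>R ((sg a \<alpha> * sg b \<alpha>) *\<^sub>R (var \<alpha> * rot a b g)) \<in> U"
      unfolding r using subspace_scale[OF rot_stableD(1)[OF U]] by blast
    moreover have "(sg a \<alpha> * sg b \<alpha>) * (sg a \<alpha> * sg b \<alpha>) = 1"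
      using sg_mult[of a \<alpha>] sg_mult[of b \<alpha>] by auto
    ultimately show ?thesis by simp
  qed
  moreover have "subspace {g \<in> harm J0 k. var \<alpha> * g \<in> U}"
    using subspace_harm[of J0 k] rot_stableD(1)[OF U]
    by (auto simp: subspace_def distrib_left)
  ultimately show ?thesis using rot_harm(1)[OF basic(1)] by (auto simp: rot_stable_def)
qed

text \<open>\<open>rot \<beta> \<beta>\<close> carries weight 1 to weight -1. The operators
  \<open>rot a \<beta>\<close> carry it to weight 0 and give \<open>var a * g\<close> plus a
  correction with harmonic \<open>g\<close>; so the task is to write \<open>f0\<close> as a sum of
  \<open>var a * w a\<close> with harmonic \<open>w a\<close>.\<close>

lemma weight_one_generates:
  assumes U: "rot_stable J U" "U \<subseteq> harm J (Suc k)" and g: "\<And>g. g \<in> harm J0 k \<Longrightarrow> var \<alpha> * g \<in> U"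
    and k: "real k + sdim J \<noteq> 1"
  shows "harm J (Suc k) \<subseteq> U"
proof
  note sub = rot_stableD(1)[OF U(1)]
  have g': "var \<beta> * g \<in> U" if "g \<in> harm J0 k" for g
  proof -
    have "g \<in> polys J0" using that harm_hpolys hpolys_polys by blast
    then have "rot \<beta> \<beta> (var \<alpha> * g) = (- 2) *\<^sub>R (var \<beta> * g) + (- 2) *\<^sub>R (var \<beta> * g)"
      by (simp add: rot_def uder_var inside basic basic(6)[symmetric] \<beta>_dual)
    then have "rot \<beta> \<beta> (var \<alpha> * g) = (- 4) *\<^sub>R (var \<beta> * g)"
      by (simp only: scaleR_add_left[symmetric]) simp
    moreover have "rot \<beta> \<beta> (var \<alpha> * g) \<in> U" using rot_stableD(2)[OF U(1)] g[OF that] basic(3) by blast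
    ultimately have "(- 1 / 4) *\<^sub>R ((- 4) *\<^sub>R (var \<beta> * g)) \<in> U" using subspace_scale[OF sub] by metis
    then show ?thesis by simp
  qed
  have F: "var a * g - (1/2) *\<^sub>R (var \<alpha> * (var \<beta> * uder a g)) \<in> U" if a: "a \<in> J0" and "g \<in> harm J0 k" for a g
  proof -
    have gp: "g \<in> polys J0" using that harm_hpolys hpolys_polys by blast
    have "a \<noteq> \<beta>" using a basic by auto
    have s: "sg a \<beta> *\<^sub>R (var \<beta> * (sg a \<beta> *\<^sub>R (var \<alpha> * uder a g))) = - (var \<alpha> * (var \<beta> * uder a g))"
      using var_comm[of \<beta> \<alpha> "uder a g"] by (simp add: basic)
    have "rot a \<beta> (var \<alpha> * g) = (- 2) *\<^sub>R (var a * g) + var \<alpha> * (var \<beta> * uder a g)"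
      using \<open>a \<noteq> \<beta>\<close> s by (simp add: rot_def uder_var inside[OF gp] basic \<beta>_dual)
    moreover have "rot a \<beta> (var \<alpha> * g) \<in> U" using rot_stableD(2)[OF U(1)] g that basic(2,3) by blast
    ultimately have "(- 1 / 2) *\<^sub>R ((- 2) *\<^sub>R (var a * g) + var \<alpha> * (var \<beta> * uder a g)) \<in> U"
      using subspace_scale[OF sub] by metis
    then show ?thesis by (simp add: scaleR_add_right scaleR_diff_right)
  qed
  fix f assume f: "f \<in> harm J (Suc k)"
  then obtain f0 f1 f2 f3 where d: "f0 \<in> hpolys J0 (Suc k)" "f1 \<in> hpolys J0 k" "f2 \<in> hpolys J0 k"
    "f3 \<in> hpolys J0 (k - 1)" "k = 0 \<Longrightarrow> f3 = 0"
    and fd: "f = f0 + var \<alpha> * f1 + var \<beta> * f2 + var \<alpha> * (var \<beta> * f3)"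
    using decompose harm_hpolys by metis
  note p = d(1-4)[THEN hpolys_polys]
  have "lap J f = 0" using f by (simp add: harm_def)
  note h = harm_decomposed[OF p this[unfolded fd]]
  have U12: "var \<alpha> * f1 \<in> U" "var \<beta> * f2 \<in> U" using g g' d h by (auto simp: harm_def)
  text \<open>The remaining part of \<open>f\<close>, of weight \<open>0\<close>, is determined by \<open>f0\<close>.\<close>
  define \<kappa> where "\<kappa> = 4 * (real k - 1) + 2 * sdim J0"
  \<comment> \<open>\<open>\<kappa>\<close> is the eigenvalue of Delta R^2 on the harmonic
    polynomial \<open>lap J0 f0\<close>. \<open>\<mu>\<close> makes the multiples of
    \<open>rsq J0 * lap J0 f0\<close> cancel in the sum of all \<open>var a * w a\<close>. Its
    denominator is \<open>- 2 * (k + sdim J - 1)\<close>, which is where the assumption on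
    \<open>k\<close> enters.\<close>
  define \<mu> where "\<mu> = 1 / (2 * real (Suc k) - \<kappa>)"
  have "2 * real (Suc k) - \<kappa> \<noteq> 0" using k by (auto simp: \<kappa>_def sdim algebra_simps)
  then have \<mu>: "2 * (\<mu> * real (Suc k)) - \<mu> * \<kappa> = 1" 
    unfolding \<mu>_def by (simp add: diff_divide_distrib[symmetric])
  have lf0: "lap J0 f0 \<in> hpolys J0 (k - 1)" "k = 0 \<Longrightarrow> lap J0 f0 = 0"
    using lap_hpolys'[OF d(1)] lap_hpolys_low[OF d(1)] by simp_all
  have lap2: "lap J0 (lap J0 f0) = 0"
  proof -
    have "lap J0 f0 = - (4 *\<^sub>R f3)" using h(1) by (simp add: eq_neg_iff_add_eq_0)
    then show ?thesis using h(4) by simp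
  qed
  have lr: "lap J0 (rsq J0 * lap J0 f0) = \<kappa> *\<^sub>R lap J0 f0"
  proof (cases k)
    case (Suc k')
    then show ?thesis using lap_rsq[OF basic(1) lf0(1)] lap2 by (simp add: \<kappa>_def)
  qed (use lf0 in simp)
  define q where "q = f0 + \<mu> *\<^sub>R (rsq J0 * lap J0 f0)"
  have q: "q \<in> hpolys J0 (Suc k)" unfolding q_def by (intro hpolys_closed d(1) rsq_lap_hpolys basic)
  have lq: "lap J0 q = (1 + \<mu> * \<kappa>) *\<^sub>R lap J0 f0" by (simp add: q_def lr scaleR_add_left)
  \<comment> \<open>The correction makes \<open>pder a q\<close> harmonic: the Laplacian of
    \<open>uvar a * lap J0 q\<close> is twice \<open>pder a (lap J0 q)\<close>, since
    \<open>lap J0 q\<close> is itself harmonic.\<close>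
  define w where "w a = pder a q - (1/2) *\<^sub>R (uvar a * lap J0 q)" for a
  have w: "w a \<in> harm J0 k" if a: "a \<in> J0" for a
  proof -
    have "uvar a * lap J0 f0 \<in> hpolys J0 k"
      using lf0 var_mult_hpolys[OF symplectic_setD(2)[OF basic(1) a], of "lap J0 f0" "k - 1"]
      by (cases k) (auto simp: uvar_def)
    then have "w a \<in> hpolys J0 k"
      unfolding w_def lq using pder_hpolys_Suc[OF q, of a] by auto
    moreover have "lap J0 (w a) = 0"
      using lap2 by (simp add: w_def lap_uvar[OF basic(1) a] lq scaleR_add_right pder_lap[symmetric])
    ultimately show ?thesis by (simp add: harm_def)
  qed
  define z where "z = (\<Sum>a\<in>J0. var a * w a - (1/2) *\<^sub>R (var \<alpha> * (var \<beta> * uder a (w a))))"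
  have zU: "z \<in> U" unfolding z_def by (intro subspace_sum[OF sub] F w)
  define y where "y = (\<Sum>a\<in>J0. uder a (w a))"
  have yp: "y \<in> polys J0"
    using w harm_hpolys hpolys_polys pder_polys unfolding y_def uder_def by (blast intro: polys_closed)
  have "(\<Sum>a\<in>J0. var a * w a) = real (Suc k) *\<^sub>R q - (1/2) *\<^sub>R (rsq J0 * lap J0 q)"
    using euler[OF symplectic_setD(1)[OF basic(1)] q]
    by (simp add: w_def right_diff_distrib sum_subtractf rsq_def sum_distrib_right mult.assoc scaleR_sum_right)
  also have "\<dots> = real (Suc k) *\<^sub>R f0 + (\<mu> * real (Suc k) - (1/2) * (1 + \<mu> * \<kappa>)) *\<^sub>R (rsq J0 * lap J0 f0)"
    unfolding lq unfolding q_def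
    by (simp only: mult_scaleR scaleR_add_right scaleR_scaleR scaleR_diff_left add_diff_eq mult.commute)
  also have "\<mu> * real (Suc k) - (1/2) * (1 + \<mu> * \<kappa>) = 0" using \<mu> by simp
  finally have z: "z = real (Suc k) *\<^sub>R f0 - (1/2) *\<^sub>R (var \<alpha> * (var \<beta> * y))"
    by (simp add: z_def y_def sum_subtractf scaleR_sum_right sum_distrib_left)
  \<comment> \<open>\<open>y\<close> need not be computed: a harmonic polynomial of weight 0 is
    determined by its component free of the plane, and for \<open>z\<close> this is a multiple of
    \<open>f0\<close>.\<close>
  have "lap J z = 0" using zU U(2) by (auto simp: harm_def)
  moreover have "z = real (Suc k) *\<^sub>R f0 + var \<alpha> * 0 + var \<beta> * 0 + var \<alpha> * (var \<beta> * ((- 1/2) *\<^sub>R y))"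
    by (simp add: z)
  ultimately have "real (Suc k) *\<^sub>R lap J0 f0 + 4 *\<^sub>R ((- 1/2) *\<^sub>R y) = 0"
    using harm_decomposed(1)[of "real (Suc k) *\<^sub>R f0" 0 0 "(- 1/2) *\<^sub>R y"] p yp by (metis lap_linear(4) polys_closed(1,4))
  then have "4 *\<^sub>R ((- 1/2) *\<^sub>R y) = - (real (Suc k) *\<^sub>R lap J0 f0)"
    by (simp only: add_eq_0_iff)
  also have "lap J0 f0 = - (4 *\<^sub>R f3)" using h(1) by (simp only: eq_neg_iff_add_eq_0)
  also have "- (real (Suc k) *\<^sub>R - (4 *\<^sub>R f3)) = 4 *\<^sub>R (real (Suc k) *\<^sub>R f3)"
    by (simp only: scaleR_minus_right minus_minus scaleR_left_commute)
  finally have y: "(- 1/2) *\<^sub>R y = real (Suc k) *\<^sub>R f3" by (rule scaleR_left_imp_eq[rotated]) simp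
  have "z = real (Suc k) *\<^sub>R f0 + var \<alpha> * (var \<beta> * ((- 1/2) *\<^sub>R y))" by (simp add: z)
  then have "z = real (Suc k) *\<^sub>R (f0 + var \<alpha> * (var \<beta> * f3))"
    unfolding y by (simp only: mult_scaleR scaleR_add_right)
  then have "f0 + var \<alpha> * (var \<beta> * f3) = (1 / real (Suc k)) *\<^sub>R z" by simp
  then have "f0 + var \<alpha> * (var \<beta> * f3) \<in> U" using zU subspace_scale[OF sub] by metis
  then have "(f0 + var \<alpha> * (var \<beta> * f3)) + (var \<alpha> * f1 + var \<beta> * f2) \<in> U"
    using subspace_add[OF sub] U12 by metis
  then show "f \<in> U" by (simp add: fd add.assoc add.commute add.left_commute)
qed

text \<open>By induction the vectors of weight 1 all lie in one summand, and they generate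
  everything, so that the other summand is 0.\<close>

lemma indecomposable_step:
  assumes IH: "rot_indecomposable J0 (harm J0 k)" and k: "real k + sdim J \<noteq> 1"
  shows "rot_indecomposable J (harm J (Suc k))"
proof (rule rot_indecomposableI)
  fix U W
  assume U: "rot_stable J U" and W: "rot_stable J W" and UW: "U \<inter> W = {0}"
    "harm J (Suc k) = {u + w | u w. u \<in> U \<and> w \<in> W}" "U \<subseteq> harm J (Suc k)" "W \<subseteq> harm J (Suc k)"
  let ?S = "\<lambda>V. {g \<in> harm J0 k. var \<alpha> * g \<in> V}"
  have inj: "g = 0" if "g \<in> harm J0 k" "var \<alpha> * g = 0" for g
  proof -
    have "g \<in> polys J0" using that(1) harm_hpolys hpolys_polys by blast
    then show ?thesis using unique[of 0 g 0 0] that(2) by simp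
  qed
  have "harm J0 k = {u + w | u w. u \<in> ?S U \<and> w \<in> ?S W}"
  proof (intro equalityI subsetI)
    fix g assume g: "g \<in> harm J0 k"
    obtain u w where uw: "var \<alpha> * g = u + w" "u \<in> U" "w \<in> W" using UW(2) var_harm[OF g] by blast
    have E: "\<exists>v0 v1 v2 v3. v0 \<in> hpolys J0 (Suc k) \<and> v1 \<in> harm J0 k \<and> v2 \<in> hpolys J0 k \<and> v3 \<in> hpolys J0 (k - 1) \<and>
        v = v0 + var \<alpha> * v1 + var \<beta> * v2 + var \<alpha> * (var \<beta> * v3)" if v: "v \<in> harm J (Suc k)" for v
    proof -
      obtain v0 v1 v2 v3 where d: "v0 \<in> hpolys J0 (Suc k)" "v1 \<in> hpolys J0 k" "v2 \<in> hpolys J0 k" "v3 \<in> hpolys J0 (k - 1)"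
        "v = v0 + var \<alpha> * v1 + var \<beta> * v2 + var \<alpha> * (var \<beta> * v3)"
        by (rule decompose[OF harm_hpolys[OF v]])
      have "lap J0 v1 = 0" using harm_decomposed(2)[OF d(1-4)[THEN hpolys_polys]] v d(5) by (simp add: harm_def)
      then show ?thesis using d by (auto simp: harm_def)
    qed
    obtain u0 u1 u2 u3 where
      u: "u0 \<in> hpolys J0 (Suc k)" "u1 \<in> harm J0 k" "u2 \<in> hpolys J0 k" "u3 \<in> hpolys J0 (k - 1)"
        "u = u0 + var \<alpha> * u1 + var \<beta> * u2 + var \<alpha> * (var \<beta> * u3)"
      using E[OF subsetD[OF UW(3) uw(2)]] by blast
    obtain w0 w1 w2 w3 where
      w: "w0 \<in> hpolys J0 (Suc k)" "w1 \<in> harm J0 k" "w2 \<in> hpolys J0 k" "w3 \<in> hpolys J0 (k - 1)"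
        "w = w0 + var \<alpha> * w1 + var \<beta> * w2 + var \<alpha> * (var \<beta> * w3)"
      using E[OF subsetD[OF UW(4) uw(3)]] by blast
    note up = u(1)[THEN hpolys_polys] u(2)[THEN harm_hpolys, THEN hpolys_polys] u(3,4)[THEN hpolys_polys]
    note wp = w(1)[THEN hpolys_polys] w(2)[THEN harm_hpolys, THEN hpolys_polys] w(3,4)[THEN hpolys_polys]
    have gp: "g \<in> polys J0" using g harm_hpolys hpolys_polys by blast
    have "(u0 + w0) + var \<alpha> * (u1 + w1 - g) + var \<beta> * (u2 + w2) + var \<alpha> * (var \<beta> * (u3 + w3)) = u + w - var \<alpha> * g"
      unfolding u(5) w(5) by (simp add: algebra_simps)
    also have "\<dots> = 0" using uw(1) by simp
    finally have e: "(u0 + w0) + var \<alpha> * (u1 + w1 - g) + var \<beta> * (u2 + w2) + var \<alpha> * (var \<beta> * (u3 + w3)) = 0" .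
    have "u1 + w1 - g = 0"
      using unique[OF polys_closed(2) polys_closed(3)[OF polys_closed(2)] polys_closed(2) polys_closed(2) e]
        up wp gp by blast
    moreover have "var \<alpha> * u1 \<in> U" "var \<alpha> * w1 \<in> W"
      using weight_one[OF U _ up] weight_one[OF W _ wp] uw u(5) w(5) by auto
    ultimately show "g \<in> {u + w | u w. u \<in> ?S U \<and> w \<in> ?S W}" using u(2) w(2) by force
  qed (auto intro: subspace_add[OF subspace_harm])
  moreover have "?S U \<inter> ?S W = {0}"
    using UW(1) inj subspace_0[OF subspace_harm] subspace_0[OF rot_stableD(1)[OF U]] subspace_0[OF rot_stableD(1)[OF W]]
    by auto
  ultimately have "?S U = {0} \<or> ?S W = {0}"
    using IH weight_one_stable[OF U] weight_one_stable[OF W] unfolding rot_indecomposable_def by blast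
  then show "U \<subseteq> {0} \<or> W \<subseteq> {0}"
  proof
    assume "?S U = {0}"
    then have "var \<alpha> * g \<in> W" if "g \<in> harm J0 k" for g
      using \<open>harm J0 k = {u + w | u w. u \<in> ?S U \<and> w \<in> ?S W}\<close> that by auto
    from weight_one_generates[OF W UW(4) this k] show ?thesis using UW(1,3) by blast
  next
    assume "?S W = {0}"
    then have "var \<alpha> * g \<in> U" if "g \<in> harm J0 k" for g
      using \<open>harm J0 k = {u + w | u w. u \<in> ?S U \<and> w \<in> ?S W}\<close> that by auto
    from weight_one_generates[OF U UW(3) this k] show ?thesis using UW(1,4) by blast
  qed
qed

end

section \<open>Harmonics in at most one even variable\<close>

lemma harm_0_indecomposable: "rot_indecomposable J (harm J 0)"
proof (rule one_dim_indecomposable[of "\<lambda>f. coeff f (0, {||})"])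
  fix f assume f: "f \<in> harm J 0" "coeff f (0, {||}) = 0"
  then obtain c where "f = c *\<^sub>R 1" using hpolys_0 harm_hpolys by blast
  then show "f = 0" using f(2) by (simp add: one_spoly_def coeff_mon)
qed (auto intro!: linearI simp: subspace_harm)

lemma indices_0: "indices 0 n = Inr ` {1..2 * n}"
  by (auto simp: indices_def)

lemma card_indices_0: "card (indices 0 n) = 2 * n"
  by (simp add: indices_0 card_image)

lemma harm_0_high:
  assumes "2 * n < k" "f \<in> hpolys (indices 0 n) k"
  shows "f = 0"
  by (rule odd_hpolys_zero[OF _ _ assms(2)]) (use assms(1) in \<open>auto simp: indices_0 card_image\<close>)

text \<open>The Cauchy data live in the Grassmann algebra on \<open>2 * n\<close> generators. The
  value on the hyperplane has too high a degree and vanishes; the normal derivative is at most a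
  multiple of the top product.\<close>

lemma harm_1_high_indecomposable:
  assumes k: "2 * n < k"
  shows "rot_indecomposable (indices 1 n) (harm (indices 1 n) k)"
proof -
  let ?J = "indices 1 n"
  have J': "?J - {Inl 1} = indices 0 n" by (auto simp: indices_def)
  define S where "S = Abs_fset {1..2 * n}"
  have S: "fset S = {1..2 * n}" by (simp add: S_def Abs_fset_inverse)
  show ?thesis
  proof (rule one_dim_indecomposable[of "\<lambda>f. coeff (at_zero 1 (pder (Inl 1) f)) (0, S)"])
    fix f assume f: "f \<in> harm ?J k" "coeff (at_zero 1 (pder (Inl 1) f)) (0, S) = 0"
    have "at_zero 1 f \<in> hpolys (indices 0 n) k"
      using at_zero_hpolys[OF harm_hpolys[OF f(1)], of 1] by (simp only: J')
    then have 0: "at_zero 1 f = 0" using harm_0_high[OF k] by blast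
    have "f \<in> hpolys ?J (Suc (k - 1))" using harm_hpolys[OF f(1)] k by simp
    from at_zero_hpolys[OF pder_hpolys_Suc[OF this, of "Inl 1"], of 1]
    have 1: "at_zero 1 (pder (Inl 1) f) \<in> hpolys (indices 0 n) (k - 1)" by (simp only: J')
    have "u \<notin> supp (at_zero 1 (pder (Inl 1) f))" for u
    proof
      assume u: "u \<in> supp (at_zero 1 (pder (Inl 1) f))"
      then have *: "mvars u \<subseteq> indices 0 n" "mdeg u = k - 1" using 1 by (auto simp: hpolys_def)
      have "fst u = 0 \<and> mdeg u \<le> card (indices 0 n) \<and> (mdeg u = card (indices 0 n) \<longrightarrow> Inr ` fset (snd u) = indices 0 n)"
        by (rule odd_hpolys_bound[OF _ _ *(1)]) (auto simp: indices_0)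
      then have "fst u = 0" "Inr ` fset (snd u) = (Inr ` {1..2 * n} :: idx set)"
        using *(2) k unfolding card_indices_0 by (auto simp: indices_0)
      then have "fst u = 0" "fset (snd u) = {1..2 * n}" by (simp_all add: inj_image_eq_iff)
      then have "u = (0, S)" using S by (metis fset_inject prod.collapse)
      then show False using u f(2) by (simp add: supp_iff)
    qed
    then have "at_zero 1 (pder (Inl 1) f) = 0" by (intro spoly_eqI) (auto simp: supp_iff)
    then show "f = 0"
      using harm_zero[OF symplectic_indices, of 1 1 n f] 0 f(1) by (simp add: harm_def)
  qed (auto intro!: linearI simp: subspace_harm)
qed

lemma harm_indecomposable_01:
  assumes "m \<le> 1"
  shows "rot_indecomposable (indices m n) (harm (indices m n) k)"
proof (induction n arbitrary: k)
  case 0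
  show ?case
  proof (cases "k = 0 \<or> m = 1")
    case True
    then show ?thesis using harm_0_indecomposable harm_1_high_indecomposable[of 0 k] by auto
  next
    case False
    then have "m = 0" using assms by auto
    then have "f = 0" if "f \<in> harm (indices m 0) k" for f
      using harm_0_high[of 0 k f] harm_hpolys[OF that] False by auto
    then show ?thesis by (intro one_dim_indecomposable[of "\<lambda>_. 0"]) (auto intro!: linearI simp: subspace_harm)
  qed
next
  case (Suc n)
  show ?case
  proof (cases k)
    case 0
    then show ?thesis using harm_0_indecomposable by simp
  next
    case k: (Suc l)
    have s: "sdim (indices m (Suc n)) = real m - 2 * real n - 2"
      by (simp add: sdim_indices superdim_def)
    show ?thesis
    proof (cases "real l + sdim (indices m (Suc n)) = 1")
      case False
      have "odd_plane (indices m (Suc n)) (indices m n) (Inr (2 * n + 1)) (Inr (2 * n + 2)) (2 * n + 1)"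
        by unfold_locales (auto simp: symplectic_indices, auto simp: indices_def)
      then show ?thesis unfolding k using odd_plane.indecomposable_step[OF _ Suc.IH False] by blast
    next
      case True
      then have e: "l + m = 2 * n + 3" unfolding s by linarith
      show ?thesis
      proof (cases "m = 0")
        case True
        then have "f = 0" if "f \<in> harm (indices m (Suc n)) k" for f
          using harm_0_high[of "Suc n" k f] harm_hpolys[OF that] e k by auto
        then show ?thesis by (intro one_dim_indecomposable[of "\<lambda>_. 0"]) (auto intro!: linearI simp: subspace_harm)
      next
        case False
        then have "m = 1" "2 * Suc n < k" using assms e k by auto
        then show ?thesis using harm_1_high_indecomposable[of "Suc n" k] by simp
      qed
    qed
  qed
qed

section \<open>Harmonics in at least two even variables\<close>

lemma linear_pder_pow: "linear (pder a ^^ e)"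
  by (induction e) (simp_all add: linear_id[unfolded id_def] linear_compose[OF _ linear_pder, unfolded o_def] o_def)

lemma taylor_var:
  "at_zero i ((pder (Inl i) ^^ e) (var (Inl i) * g)) = real e *\<^sub>R at_zero i ((pder (Inl i) ^^ (e - 1)) g)"
proof (induction e arbitrary: g)
  case 0
  then show ?case by (simp add: at_zero_var)
next
  case (Suc e)
  have "(pder (Inl i) ^^ Suc e) (var (Inl i) * g)
      = (pder (Inl i) ^^ e) g + (pder (Inl i) ^^ e) (var (Inl i) * pder (Inl i) g)"
    unfolding funpow_Suc_right o_def by (simp add: pder_var linear_add[OF linear_pder_pow])
  moreover have "real e *\<^sub>R at_zero i ((pder (Inl i) ^^ (e - 1)) (pder (Inl i) g)) = real e *\<^sub>R at_zero i ((pder (Inl i) ^^ e) g)"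
    by (cases e) (simp_all add: funpow_swap1)
  moreover have "x + real e *\<^sub>R x = real (Suc e) *\<^sub>R x" for x :: spoly
    by (simp add: scaleR_add_left)
  ultimately show ?case using Suc[of "pder (Inl i) g"] by (simp only: at_zero_linear(2) diff_Suc_1)
qed

lemma taylor_xp:
  "at_zero i ((pder (Inl i) ^^ e) (xp i s)) = (if e = s then fact s *\<^sub>R 1 else 0)"
proof (induction s arbitrary: e)
  case 0
  show ?case
  proof (cases e)
    case (Suc e')
    have "(pder (Inl i) ^^ e) 1 = (pder (Inl i) ^^ e') (pder (Inl i) 1)"
      unfolding Suc funpow_Suc_right o_def ..
    then show ?thesis using linear_0[OF linear_pder_pow] Suc by simp
  qed simp
next
  case (Suc s)
  have "xp i (Suc s) = var (Inl i) * xp i s" using xp_Suc[of i s 1] by simp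
  then show ?case using Suc[of "e - 1"] unfolding \<open>xp i (Suc s) = _\<close> taylor_var by (cases e) auto
qed

text \<open>Solves the eigenvalue equation of the Casimir of \<open>so(2)\<close> on the zeroth (\<open>c = 0\<close>) or
  first (\<open>c = 1\<close>) Cauchy datum.\<close>

lemma eigen_unique:
  assumes J: "symplectic_set J" "Inl y \<notin> J" and f: "f \<in> hpolys (insert (Inl y) J) s" and k: "k = s + c" "k > 0"
    and eq: "(real c)\<^sup>2 *\<^sub>R f + (2 * real c + 1) *\<^sub>R (var (Inl y) * pder (Inl y) f)
      + var (Inl y) * (var (Inl y) * pder (Inl y) (pder (Inl y) f)) + var (Inl y) * (var (Inl y) * lap J f)
      = (real k)\<^sup>2 *\<^sub>R f"
  obtains r where "f = r *\<^sub>R xp y s"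
proof -
  let ?P = "\<lambda>e g. (pder (Inl y) ^^ e) g"
  let ?c = "\<lambda>e g. at_zero y (?P e g)"
  have lin: "?c e (g + h) = ?c e g + ?c e h" "?c e (t *\<^sub>R g) = t *\<^sub>R ?c e g" for e g h t
    by (simp_all add: linear_add[OF linear_pder_pow] linear_scale[OF linear_pder_pow])
  have pl: "?c e (lap J g) = lap J (?c e g)" for e g
  proof -
    have "?P e (lap J g) = lap J (?P e g)" by (induction e) (simp_all add: pder_lap)
    then show ?thesis using at_zero_lap[OF J(2,1)] by simp
  qed
  \<comment> \<open>Taking \<open>e\<close> derivatives at \<open>y = 0\<close>: the Euler operator
    in \<open>y\<close> becomes \<open>e\<close>, and the terms without \<open>lap J\<close> add up
    to the square of \<open>e + c\<close>.\<close>
  have rec: "((real e + real c)\<^sup>2 - (real k)\<^sup>2) *\<^sub>R ?c e f + (real e * (real e - 1)) *\<^sub>R lap J (?c (e - 2) f) = 0" for e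
  proof -
    have a: "?c e (var (Inl y) * pder (Inl y) f) = real e *\<^sub>R ?c e f"
      unfolding taylor_var by (cases e) (simp_all add: funpow_swap1)
    have b: "?c e (var (Inl y) * (var (Inl y) * g)) = (real e * (real e - 1)) *\<^sub>R ?c (e - 2) g" for g
      unfolding taylor_var by (cases e) (simp_all add: numeral_2_eq_2)
    have b': "(real e * (real e - 1)) *\<^sub>R ?c (e - 2) (pder (Inl y) (pder (Inl y) f)) = (real e * (real e - 1)) *\<^sub>R ?c e f"
    proof -
      consider "e < 2" | e' where "e = Suc (Suc e')" by (metis add_2_eq_Suc le_Suc_ex not_less)
      then show ?thesis by cases (auto simp: funpow_swap1 less_2_cases_iff)
    qed
    have "(real c)\<^sup>2 *\<^sub>R ?c e f + (2 * real c + 1) *\<^sub>R (real e *\<^sub>R ?c e f) + (real e * (real e - 1)) *\<^sub>R ?c e f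
        + (real e * (real e - 1)) *\<^sub>R lap J (?c (e - 2) f) = (real k)\<^sup>2 *\<^sub>R ?c e f"
      using arg_cong[OF eq, of "?c e"] unfolding lin a b pl b' .
    then have "((real c)\<^sup>2 + (2 * real c + 1) * real e + real e * (real e - 1) - (real k)\<^sup>2) *\<^sub>R ?c e f
        + (real e * (real e - 1)) *\<^sub>R lap J (?c (e - 2) f) = 0"
    proof -
      have z: "a1 + a2 + a3 - t + a4 = 0" if "a1 + a2 + a3 + a4 = t" for a1 a2 a3 a4 t :: spoly
        unfolding that[symmetric] by simp
      assume "(real c)\<^sup>2 *\<^sub>R ?c e f + (2 * real c + 1) *\<^sub>R (real e *\<^sub>R ?c e f) + (real e * (real e - 1)) *\<^sub>R ?c e f
        + (real e * (real e - 1)) *\<^sub>R lap J (?c (e - 2) f) = (real k)\<^sup>2 *\<^sub>R ?c e f"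
      from z[OF this] show ?thesis by (simp only: scaleR_add_left scaleR_diff_left scaleR_scaleR)
    qed
    moreover have "(real c)\<^sup>2 + (2 * real c + 1) * real e + real e * (real e - 1) = (real e + real c)\<^sup>2"
      by (simp add: power2_eq_square algebra_simps)
    ultimately show ?thesis by simp
  qed
  \<comment> \<open>Below \<open>e = s\<close> the factor \<open>(e + c)^2 - k^2\<close> is nonzero,
    so each coefficient is determined by the one two steps lower; only the top power of
    \<open>y\<close> can remain.\<close>
  have low: "?c e f = 0" if "e < s" for e
    using that
  proof (induction e rule: less_induct)
    case (less e)
    have z: "(real e * (real e - 1)) *\<^sub>R lap J (?c (e - 2) f) = 0"
      using less.IH[of "e - 2"] less.prems by (cases "e < 2") (auto simp: less_2_cases_iff)
    then have "((real e + real c)\<^sup>2 - (real k)\<^sup>2) *\<^sub>R ?c e f = 0" using rec[of e] unfolding z by simp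
    moreover have "(real e + real c)\<^sup>2 < (real k)\<^sup>2"
      using less.prems k by (intro power_strict_mono) auto
    ultimately show ?case by (metis less_irrefl right_minus_eq scaleR_eq_0_iff)
  qed
  have deg: "?P e f \<in> hpolys (insert (Inl y) J) (s - e) \<and> (s < e \<longrightarrow> ?P e f = 0)" for e
  proof (induction e)
    case (Suc e)
    then show ?case using pder_hpolys[of "?P e f" "insert (Inl y) J" "s - e" "Inl y"] by (cases "s < e") auto
  qed (use f in auto)
  have "?P s f \<in> hpolys (insert (Inl y) J) 0" using deg[of s] by simp
  then obtain t where t: "?P s f = t *\<^sub>R 1" using hpolys_0 by blast
  define r where "r = t / fact s"
  have "f - r *\<^sub>R xp y s = 0"
  proof (rule taylor_zero)
    fix e
    have "?c e (f - r *\<^sub>R xp y s) = ?c e f - r *\<^sub>R (if e = s then fact s *\<^sub>R 1 else 0)"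
      by (simp add: linear_diff[OF linear_pder_pow] linear_scale[OF linear_pder_pow] taylor_xp)
    also have "\<dots> = 0"
      using low[of e] deg[of e] t by (cases e s rule: linorder_cases) (auto simp: r_def)
    finally show "?c e (f - r *\<^sub>R xp y s) = 0" .
  qed
  then have "f = r *\<^sub>R xp y s" by simp
  then show thesis by (rule that)
qed

lemma hpolys_expand:
  assumes V: "subspace V" and k: "\<And>d g. d \<le> k \<Longrightarrow> g \<in> hpolys (J - {Inl y}) d \<Longrightarrow> xp y (k - d) * g \<in> V"
    and f: "f \<in> hpolys J k"
  shows "f \<in> V"
proof -
  define S where "S k = span {xp y (k - d) * g | d g. d \<le> k \<and> g \<in> hpolys (J - {Inl y}) d}" for k
  have "f \<in> S k" using f
  proof (induction rule: hpolys_induct)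
    case one
    then show ?case unfolding S_def by (intro span_base) (auto intro!: exI[of _ 0] exI[of _ 1])
  next
    case (var b k g)
    have "subspace {h. var b * h \<in> S (Suc k)}"
      unfolding S_def by (auto simp: subspace_def distrib_left span_zero span_add span_scale)
    moreover have "var b * (xp y (k - d) * h) \<in> S (Suc k)" if h: "d \<le> k" "h \<in> hpolys (J - {Inl y}) d" for d h
    proof (cases "b = Inl y")
      case True
      then have "var b * (xp y (k - d) * h) = xp y (Suc k - d) * h"
        using h(1) by (simp add: Suc_diff_le xp_Suc)
      then show ?thesis unfolding S_def using h by (intro span_base CollectI exI[of _ d] exI[of _ h]) auto
    next
      case False
      then have "var b * h \<in> hpolys (J - {Inl y}) (Suc d)" using h var.hyps by (intro var_mult_hpolys) auto
      moreover have "var b * (xp y (k - d) * h) = xp y (Suc k - Suc d) * (var b * h)"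
        using xp_commute_op[of "\<lambda>g. var b * g" y "k - d" h] var_comm[of b "Inl y"] by simp
      ultimately show ?thesis unfolding S_def using h(1) by (intro span_base) blast
    qed
    ultimately have "S k \<subseteq> {h. var b * h \<in> S (Suc k)}"
      unfolding S_def[of k] by (intro span_minimal) auto
    then show ?case using var.IH by blast
  qed (auto simp: S_def span_zero span_add span_scale)
  moreover have "S k \<subseteq> V" unfolding S_def using V k by (intro span_minimal) auto
  ultimately show ?thesis by blast
qed

text \<open>
  For two even variables \<open>x\<close>, \<open>y\<close> the polynomials \<open>Re (y + \<i>x)\<^sup>k\<close> and
  \<open>Im (y + \<i>x)\<^sup>k\<close> span an eigenspace of the squared rotation in the plane of \<open>x\<close> and
  \<open>y\<close>, and they generate the harmonic polynomials of degree \<open>k\<close>.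
  Both facts are checked on the Cauchy data at \<open>x = 0\<close>.
\<close>

locale even_plane =
  fixes J J1 J2 :: "idx set" and x y l k :: nat
  assumes J: "symplectic_set J" and xy: "Inl x \<in> J" "Inl y \<in> J" "x \<noteq> y"
    and J1_def: "J1 = J - {Inl x}" and J2_def: "J2 = J1 - {Inl y}" and k: "k = Suc l"
begin

abbreviation "e0 f \<equiv> at_zero x f"
abbreviation "e1 f \<equiv> at_zero x (pder (Inl x) f)"

lemma J1: "symplectic_set J1" "Inl x \<notin> J1" "Inl y \<in> J1" "J1 \<subseteq> J"
  and J2: "symplectic_set J2" "Inl y \<notin> J2" "J1 = insert (Inl y) J2" "J2 \<subseteq> J1"
  using symplectic_remove_Inl[OF J, of x] symplectic_remove_Inl[of "J - {Inl x}" y] symplectic_remove_Inl[OF J] xy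
  by (auto simp: J1_def J2_def)

text \<open>The harmonic equation replaces the second normal derivative by the tangential Laplacian,
  so that a rotation involving the normal variable acts on the Cauchy data alone.\<close>

lemma data_rot:
  assumes f: "f \<in> harm J k" and a: "a \<in> J1"
  shows "e0 (rot a (Inl x) f) = var a * e1 f"
    "e1 (rot a (Inl x) f) = - (uder a (e0 f) + var a * lap J1 (e0 f))"
proof -
  have ax: "a \<noteq> Inl x" "dual a \<noteq> Inl x" using a J1 by auto
  have u: "uder (Inl x) g = pder (Inl x) g" for g by (simp add: uder_def)
  show "e0 (rot a (Inl x) f) = var a * e1 f"
    using ax by (simp add: rot_def u at_zero_var)
  have "lap J f = 0" using f by (simp add: harm_def)
  then have "pder (Inl x) (pder (Inl x) f) = - lap J1 f"
    using lap_split_Inl[OF J xy(1), of f] by (simp add: J1_def eq_neg_iff_add_eq_0)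
  moreover have "at_zero x (uder a f) = uder a (e0 f)"
    using ax by (simp add: uder_def at_zero_pder)
  ultimately show "e1 (rot a (Inl x) f) = - (uder a (e0 f) + var a * lap J1 (e0 f))"
    using ax at_zero_lap[OF J1(2,1), of f] by (simp add: rot_def u pder_var at_zero_var)
qed

lemma data_eqI: "f \<in> harm J k \<Longrightarrow> g \<in> harm J k \<Longrightarrow> e0 f = e0 g \<Longrightarrow> e1 f = e1 g \<Longrightarrow> f = g"
  using harm_eqI[OF J xy(1)] by blast

lemma data_hpolys:
  assumes "f \<in> harm J k" shows "e0 f \<in> hpolys J1 k" "e1 f \<in> hpolys J1 l"
  using at_zero_hpolys[of f J k x] at_zero_hpolys[OF pder_hpolys_Suc, of f J l x "Inl x"] assms harm_hpolys
  by (auto simp: J1_def k)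

text \<open>The operator from \<open>data_rot\<close> for the index of \<open>y\<close>; the square
  arises as e + e (e - 1).\<close>

lemma uder_lap_xp:
  assumes g: "g \<in> hpolys J2 d"
  shows "uder (Inl y) (xp y e * g) + var (Inl y) * lap J1 (xp y e * g)
    = (real e)\<^sup>2 *\<^sub>R (xp y (e - 1) * g) + xp y (Suc e) * lap J2 g"
proof -
  have gy: "pder (Inl y) g = 0" using pder_outside[OF hpolys_polys[OF g]] J2(2) by blast
  have "lap J2 (xp y e * g) = xp y e * lap J2 g"
    by (rule xp_commute_op) (simp add: lap_var[OF J2(1)] J2(2))
  then have "lap J1 (xp y e * g) = (real e * real (e - 1)) *\<^sub>R (xp y (e - 2) * g) + xp y e * lap J2 g"
    using lap_split_Inl[OF J1(1,3), of "xp y e * g"] gy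
    by (simp add: pder_xp J2_def numeral_2_eq_2)
  moreover have "real (e - 1) *\<^sub>R (var (Inl y) * (xp y (e - 2) * g)) = real (e - 1) *\<^sub>R (xp y (e - 1) * g)"
  proof -
    consider "e < 2" | e' where "e = Suc (Suc e')" by (metis add_2_eq_Suc le_Suc_ex not_less)
    then show ?thesis by cases (auto simp: xp_Suc less_2_cases_iff)
  qed
  then have "var (Inl y) * ((real e * real (e - 1)) *\<^sub>R (xp y (e - 2) * g)) = (real e * real (e - 1)) *\<^sub>R (xp y (e - 1) * g)"
    by (metis mult_scaleR(2) scaleR_scaleR)
  ultimately have "var (Inl y) * lap J1 (xp y e * g)
      = (real e * real (e - 1)) *\<^sub>R (xp y (e - 1) * g) + xp y (Suc e) * lap J2 g"
    by (simp only: distrib_left xp_Suc)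
  moreover have "uder (Inl y) (xp y e * g) = real e *\<^sub>R (xp y (e - 1) * g)"
    using gy by (simp add: uder_def pder_xp)
  moreover have "real e + real e * real (e - 1) = (real e)\<^sup>2"
    by (cases e) (simp_all add: power2_eq_square algebra_simps)
  moreover have "a1 *\<^sub>R v + (a2 *\<^sub>R v + w) = (a1 + a2) *\<^sub>R v + w" for a1 a2 and v w :: spoly
    by (simp add: scaleR_add_left)
  ultimately show ?thesis by (simp only:)
qed

text \<open>\<open>A0\<close> and \<open>A1\<close> collect the values and normal derivatives
  attained in \<open>U\<close> with the other datum 0. Induction on the degree in the variables
  other than \<open>y\<close>: multiplication by these variables leads from \<open>A1\<close> to
  \<open>A0\<close>, and Euler's identity recovers \<open>g\<close> from its derivatives; the
  operator of \<open>uder_lap_xp\<close> leads back to \<open>A1\<close>, up to a term of degree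
  smaller by 2.\<close>

lemma generates:
  assumes U: "rot_stable J U" "U \<subseteq> harm J k"
    and u0: "\<exists>u\<in>U. e0 u = xp y k \<and> e1 u = 0" and u1: "\<exists>u\<in>U. e0 u = 0 \<and> e1 u = xp y l"
  shows "harm J k \<subseteq> U"
proof -
  note sub = rot_stableD(1)[OF U(1)]
  define A0 where "A0 = {f. \<exists>u\<in>U. e0 u = f \<and> e1 u = 0}"
  define A1 where "A1 = {f. \<exists>u\<in>U. e0 u = 0 \<and> e1 u = f}"
  have "subspace {u \<in> U. e1 u = 0}" "subspace {u \<in> U. e0 u = 0}"
    using sub by (auto simp: subspace_def)
  moreover have "A0 = at_zero x ` {u \<in> U. e1 u = 0}" "A1 = (\<lambda>u. e1 u) ` {u \<in> U. e0 u = 0}"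
    by (auto simp: A0_def A1_def)
  ultimately have subA: "subspace A0" "subspace A1"
    using linear_subspace_image[OF linear_at_zero, of _ x]
      linear_subspace_image[OF linear_compose[OF linear_pder linear_at_zero, unfolded o_def]] by auto
  have rotU: "rot a (Inl x) u \<in> U" if "a \<in> J1" "u \<in> U" for a u
    using rot_stableD(2)[OF U(1)] that xy(1) J1(4) by blast
  have A10: "var a * g \<in> A0" if g: "g \<in> A1" "a \<in> J1" for a g
  proof -
    obtain u where u: "u \<in> U" "e0 u = 0" "e1 u = g" using g(1) by (auto simp: A1_def)
    then have "u \<in> harm J k" using U(2) by blast
    from data_rot[OF this g(2)] u rotU[OF g(2) u(1)] show ?thesis by (auto simp: A0_def)
  qed
  have A01: "uder a g + var a * lap J1 g \<in> A1" if g: "g \<in> A0" "a \<in> J1" for a g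
  proof -
    obtain u where u: "u \<in> U" "e0 u = g" "e1 u = 0" using g(1) by (auto simp: A0_def)
    then have "u \<in> harm J k" using U(2) by blast
    from data_rot[OF this g(2)] u rotU[OF g(2) u(1)]
    have "- (uder a g + var a * lap J1 g) \<in> A1" by (auto simp: A1_def)
    from subspace_neg[OF subA(2) this] show ?thesis by (simp only: minus_minus)
  qed
  have P: "(d \<le> k \<longrightarrow> xp y (k - d) * g \<in> A0) \<and> (d \<le> l \<longrightarrow> xp y (l - d) * g \<in> A1)"
    if "g \<in> hpolys J2 d" for d g
    using that
  proof (induction d arbitrary: g rule: less_induct)
    case (less d)
    show ?case
    proof (cases d)
      case 0
      then obtain c where "g = c *\<^sub>R 1" using hpolys_0 less.prems by blast
      then show ?thesis
        using u0 u1 subspace_scale[OF subA(1)] subspace_scale[OF subA(2)] by (auto simp: 0 A0_def A1_def)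
    next
      case d: (Suc d')
      have "xp y (k - d) * g \<in> A0" if "d \<le> k"
      proof -
        have "xp y (k - d) * (var a * pder a g) \<in> A0" if a: "a \<in> J2" for a
        proof -
          have "xp y (l - d') * pder a g \<in> A1"
            using less.IH[of d' "pder a g"] pder_hpolys_Suc[of g J2 d' a] less.prems d k \<open>d \<le> k\<close> by simp
          then have "var a * (xp y (l - d') * pder a g) \<in> A0" using A10 a J2(4) by blast
          moreover have "var a * (xp y (l - d') * pder a g) = xp y (l - d') * (var a * pder a g)"
            using xp_commute_op[of "\<lambda>g. var a * g" y] var_comm[of a "Inl y"] by simp
          ultimately show ?thesis by (simp add: k d)
        qed
        then have "(1 / real d) *\<^sub>R (xp y (k - d) * (\<Sum>a\<in>J2. var a * pder a g)) \<in> A0"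
          unfolding sum_distrib_left by (intro subspace_scale subspace_sum subA)
        then show ?thesis using euler[OF symplectic_setD(1)[OF J2(1)] less.prems] d by simp
      qed
      moreover have "xp y (l - d) * g \<in> A1" if "d \<le> l"
      proof -
        define e where "e = k - d"
        have e: "e - 1 = l - d" "real e \<noteq> 0" using that by (auto simp: e_def k)
        have "xp y e * g \<in> A0" using calculation that by (simp add: e_def k)
        from A01[OF this J1(3)] have 1: "(real e)\<^sup>2 *\<^sub>R (xp y (l - d) * g) + xp y (Suc e) * lap J2 g \<in> A1"
          unfolding uder_lap_xp[OF less.prems] e(1) .
        have 2: "xp y (Suc e) * lap J2 g \<in> A1"
        proof (cases "d < 2")
          case True
          then show ?thesis using lap_hpolys_low[OF less.prems] subspace_0[OF subA(2)] by simp
        next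
          case False
          then have "l - (d - 2) = Suc e" "d - 2 < d" "d - 2 \<le> l" using that by (auto simp: e_def k)
          then show ?thesis using less.IH[of "d - 2" "lap J2 g"] lap_hpolys'[OF less.prems] by simp
        qed
        from subspace_scale[OF subA(2) subspace_diff[OF subA(2) 1 2], of "1 / (real e)\<^sup>2"]
        show ?thesis using e(2) by simp
      qed
      ultimately show ?thesis by blast
    qed
  qed
  show ?thesis
  proof
    fix f assume f: "f \<in> harm J k"
    have "e0 f \<in> A0"
      by (rule hpolys_expand[OF subA(1) _ data_hpolys(1)[OF f], of y]) (use P J2_def in blast)
    moreover have "e1 f \<in> A1"
      by (rule hpolys_expand[OF subA(2) _ data_hpolys(2)[OF f], of y]) (use P J2_def in blast)
    ultimately obtain u w where uw: "u \<in> U" "w \<in> U" "e0 u = e0 f" "e1 u = 0" "e0 w = 0" "e1 w = e1 f"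
      by (auto simp: A0_def A1_def)
    then have "u + w \<in> U" using subspace_add[OF sub] by blast
    moreover have "f = u + w"
      by (rule data_eqI) (use f U(2) \<open>u + w \<in> U\<close> uw in auto)
    ultimately show "f \<in> U" by simp
  qed
qed

lemma indecomposable: "rot_indecomposable J (harm J k)"
proof (rule rot_indecomposableI)
  fix U W
  assume U: "rot_stable J U" and W: "rot_stable J W" and UW: "U \<inter> W = {0}"
    "harm J k = {u + w | u w. u \<in> U \<and> w \<in> W}" "U \<subseteq> harm J k" "W \<subseteq> harm J k"
  let ?L = "rot (Inl y) (Inl x)" and ?r = "(real k)\<^sup>2"
  have xpy: "xp y s \<in> hpolys J1 s" for s using xp_hpolys[OF J1(3) one_hpolys, of s] by simp
  \<comment> \<open>By their Cauchy data, \<open>a\<close> is the real part of (y + ix)^k and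
    \<open>b\<close> is 1/k times the imaginary part.\<close>
  define a where "a = ck_ext x J1 0 k (xp y k)"
  define b where "b = ck_ext x J1 1 k (xp y l)"
  have a: "a \<in> harm J k" "e0 a = xp y k" "e1 a = 0"
    using ck_ext_harm[OF J xy(1), of "xp y k" k 0 k] xpy[of k] by (simp_all add: a_def J1_def)
  have b: "b \<in> harm J k" "e0 b = 0" "e1 b = xp y l"
    using ck_ext_harm[OF J xy(1), of "xp y l" l 1 k] xpy[of l] by (simp_all add: b_def J1_def k)
  have LH: "?L f \<in> harm J k" if "f \<in> harm J k" for f
    using rot_harm(1)[OF J xy(2,1) that] .
  have u: "uder (Inl y) g = pder (Inl y) g" for g by (simp add: uder_def)
  have xk: "var (Inl y) * xp y l = xp y k" using xp_Suc[of y l 1] by (simp add: k)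
  have "pder (Inl y) (xp y k) + var (Inl y) * lap J1 (xp y k) = ?r *\<^sub>R xp y l"
    using uder_lap_xp[OF one_hpolys, of k] by (simp add: u k)
  then have "e1 (?L a) = e1 (- ?r *\<^sub>R b)" using data_rot(2)[OF a(1) J1(3)] a b by (simp add: u)
  moreover have "e0 (?L a) = e0 (- ?r *\<^sub>R b)" using data_rot(1)[OF a(1) J1(3)] a b by simp
  ultimately have La: "?L a = - ?r *\<^sub>R b"
    using data_eqI[OF LH[OF a(1)] subspace_scale[OF subspace_harm b(1)]] by blast
  have "e0 (?L b) = e0 a" "e1 (?L b) = e1 a"
    using data_rot[OF b(1) J1(3)] a b by (simp_all add: u xk)
  then have Lb: "?L b = a" using data_eqI[OF LH[OF b(1)] a(1)] by blast
  have kpos: "k > 0" by (simp add: k)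
  \<comment> \<open>Written in Cauchy data, the eigenvalue equation separates into one equation for
    each datum, and \<open>eigen_unique\<close> leaves a multiple of a power of \<open>y\<close> for
    both.\<close>
  have span: "\<exists>r s. z = r *\<^sub>R a + s *\<^sub>R b" if z: "z \<in> harm J k" "?L (?L z) = - ?r *\<^sub>R z" for z
  proof -
    have z0: "e0 (?L z) = var (Inl y) * e1 z" "e1 (?L z) = - (pder (Inl y) (e0 z) + var (Inl y) * lap J1 (e0 z))"
      using data_rot[OF z(1) J1(3)] by (simp_all add: u)
    have z1: "- ?r *\<^sub>R e0 z = var (Inl y) * e1 (?L z)"
      "- ?r *\<^sub>R e1 z = - (pder (Inl y) (e0 (?L z)) + var (Inl y) * lap J1 (e0 (?L z)))"
      using data_rot[OF LH[OF z(1)] J1(3)] unfolding z(2) by (simp_all add: u)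
    have lapJ1: "lap J1 g = pder (Inl y) (pder (Inl y) g) + lap J2 g" for g
      using lap_split_Inl[OF J1(1,3)] by (simp add: J2_def)
    have "\<exists>r. e0 z = r *\<^sub>R xp y k"
    proof (rule eigen_unique[OF J2(1,2), of "e0 z" k k 0])
      have "var (Inl y) * (pder (Inl y) (e0 z) + var (Inl y) * lap J1 (e0 z)) = ?r *\<^sub>R e0 z"
        using z1(1) unfolding z0(2) by (simp only: mult_minus_right scaleR_minus_left neg_equal_iff_equal)
      then show "(real 0)\<^sup>2 *\<^sub>R e0 z + (2 * real 0 + 1) *\<^sub>R (var (Inl y) * pder (Inl y) (e0 z))
          + var (Inl y) * (var (Inl y) * pder (Inl y) (pder (Inl y) (e0 z))) + var (Inl y) * (var (Inl y) * lap J2 (e0 z))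
          = ?r *\<^sub>R e0 z"
        by (simp add: lapJ1 distrib_left add.assoc)
    qed (use data_hpolys(1)[OF z(1)] J2(3) kpos in auto)
    moreover have "\<exists>s. e1 z = s *\<^sub>R xp y l"
    proof (rule eigen_unique[OF J2(1,2), of "e1 z" l k 1])
      let ?g = "e1 z" and ?v = "var (Inl y)"
      have "pder (Inl y) (?v * ?g) + ?v * lap J1 (?v * ?g) = ?r *\<^sub>R ?g"
        using z1(2) unfolding z0(1) by (simp only: scaleR_minus_left neg_equal_iff_equal)
      moreover have "lap J1 (?v * ?g) = ?v * lap J1 ?g + 2 *\<^sub>R pder (Inl y) ?g"
        by (simp add: lap_var[OF J1(1)] J1(3) u)
      ultimately have "?g + ?v * pder (Inl y) ?g + (?v * (?v * lap J1 ?g) + 2 *\<^sub>R (?v * pder (Inl y) ?g)) = ?r *\<^sub>R ?g"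
        by (simp add: pder_var distrib_left)
      moreover have "(2 * real 1 + 1) *\<^sub>R (?v * pder (Inl y) ?g) = ?v * pder (Inl y) ?g + 2 *\<^sub>R (?v * pder (Inl y) ?g)"
        by (simp only: of_nat_1 scaleR_add_left mult_1_right scaleR_one add.commute)
      ultimately show "(real 1)\<^sup>2 *\<^sub>R ?g + (2 * real 1 + 1) *\<^sub>R (?v * pder (Inl y) ?g)
          + ?v * (?v * pder (Inl y) (pder (Inl y) ?g)) + ?v * (?v * lap J2 ?g) = ?r *\<^sub>R ?g"
        by (simp only: lapJ1 distrib_left) (simp add: add.assoc add.commute add.left_commute)
    qed (use data_hpolys(2)[OF z(1)] J2(3) kpos k in auto)
    ultimately obtain r s where rs: "e0 z = r *\<^sub>R xp y k" "e1 z = s *\<^sub>R xp y l" by blast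
    have "r *\<^sub>R a + s *\<^sub>R b \<in> harm J k"
      by (intro subspace_add subspace_scale subspace_harm a b)
    from data_eqI[OF z(1) this] have "z = r *\<^sub>R a + s *\<^sub>R b" using rs a b by simp
    then show ?thesis by blast
  qed
  have full: "harm J k \<subseteq> V" if V: "rot_stable J V" "V \<subseteq> harm J k" and aV: "a \<in> V" for V
  proof (rule generates[OF V])
    have "?L a \<in> V" using rot_stableD(2)[OF V(1)] xy aV by blast
    then have "(- 1 / ?r) *\<^sub>R (- ?r *\<^sub>R b) \<in> V" unfolding La by (rule subspace_scale[OF rot_stableD(1)[OF V(1)]])
    then have "b \<in> V" using kpos by simp
    then show "\<exists>u\<in>V. e0 u = 0 \<and> e1 u = xp y l" using b by blast
    show "\<exists>u\<in>V. e0 u = xp y k \<and> e1 u = 0" using a aV by blast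
  qed
  obtain u w where uw: "a = u + w" "u \<in> U" "w \<in> W" using UW(2) a(1) by blast
  have "?L (?L a) = - ?r *\<^sub>R a" using La Lb by simp
  \<comment> \<open>Both components of \<open>a\<close> satisfy the same eigenvalue equation,
    because the sum of the summands is direct.\<close>
  then have e: "?L (?L u) + ?r *\<^sub>R u = - (?L (?L w) + ?r *\<^sub>R w)"
    unfolding uw(1) by (simp add: eq_neg_iff_add_eq_0 algebra_simps)
  have "?L (?L v) + ?r *\<^sub>R v \<in> V" if "rot_stable J V" "v \<in> V" for v V
    using that rot_stableD[OF that(1)] xy by (intro subspace_add subspace_scale) auto
  then have "?L (?L u) + ?r *\<^sub>R u \<in> U" "?L (?L w) + ?r *\<^sub>R w \<in> W" using U W uw by blast+
  then have "?L (?L u) + ?r *\<^sub>R u \<in> U \<inter> W"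
    using e subspace_neg[OF rot_stableD(1)[OF W]] by (metis IntI)
  then have "?L (?L u) = - ?r *\<^sub>R u" using UW(1) by (auto simp: eq_neg_iff_add_eq_0)
  then obtain r s where u': "u = r *\<^sub>R a + s *\<^sub>R b" using span UW(3) uw(2) by blast
  show "U \<subseteq> {0} \<or> W \<subseteq> {0}"
  proof (cases "r = 0 \<and> s = 0")
    case True
    then have "a \<in> W" using uw u' by simp
    from full[OF W UW(4) this] show ?thesis using UW(1,3) by blast
  next
    case False
    have Lu: "?L u = (- r * ?r) *\<^sub>R b + s *\<^sub>R a" unfolding u' by (simp add: La Lb)
    have "?L u \<in> U" using rot_stableD(2)[OF U] xy uw by blast
    \<comment> \<open>Combining \<open>u\<close> with its image under \<open>?L\<close> eliminates
      \<open>b\<close>. The coefficient of \<open>a\<close> is a sum of squares, so it is nonzero: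
      the plane spanned by \<open>a\<close> and \<open>b\<close> has no real eigenvector of
      \<open>?L\<close>.\<close>
    then have "(r * ?r) *\<^sub>R u + s *\<^sub>R ?L u \<in> U"
      using uw rot_stableD(1)[OF U] by (intro subspace_add subspace_scale)
    moreover have "(r * ?r) *\<^sub>R u + s *\<^sub>R ?L u = (r\<^sup>2 * ?r + s\<^sup>2) *\<^sub>R a"
      unfolding Lu unfolding u' by (simp add: algebra_simps power2_eq_square)
    moreover have "r\<^sup>2 * ?r + s\<^sup>2 > 0"
      using False kpos by (cases "r = 0") (auto intro!: add_pos_nonneg)
    ultimately have "(1 / (r\<^sup>2 * ?r + s\<^sup>2)) *\<^sub>R ((r\<^sup>2 * ?r + s\<^sup>2) *\<^sub>R a) \<in> U"
      using subspace_scale[OF rot_stableD(1)[OF U]] by metis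
    then have "a \<in> U" using \<open>r\<^sup>2 * ?r + s\<^sup>2 > 0\<close> by simp
    from full[OF U UW(3) this] show ?thesis using UW(1,4) by blast
  qed
qed

end

lemma harm_indecomposable: "rot_indecomposable (indices m n) (harm (indices m n) k)"
proof (cases "m \<le> 1 \<or> k = 0")
  case True
  then show ?thesis using harm_indecomposable_01 harm_0_indecomposable by blast
next
  case False
  then have "even_plane (indices m n) (indices m n - {Inl 2}) (indices m n - {Inl 2} - {Inl 1}) 2 1 (k - 1) k"
    by unfold_locales (auto simp: symplectic_indices)
  then show ?thesis by (rule even_plane.indecomposable)
qed

lemma gharm_indecomposable_or_zero:
  assumes "k \<in> exceptional_indices (superdim m n)"
  shows "gharm (indices m n) k = {0} \<or> rot_indecomposable (indices m n) (gharm (indices m n) k)"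
proof (cases "m = 0")
  case False
  then show ?thesis
    using gharm_indecomposable[OF symplectic_indices, of 1 m n k] harm_indecomposable by simp
next
  case True
  \<comment> \<open>An exceptional degree is at least \<open>n + 2\<close> when there are no even
    variables.\<close>
  have z: "2 * real k + sdim (indices m n) > 0"
  proof -
    have "2 - superdim m n div 2 \<le> int k" using assms by (auto simp: exceptional_indices_def split: if_splits)
    then have "int n + 2 \<le> int k" using True by (simp add: superdim_def)
    then show ?thesis using True by (simp add: sdim_indices superdim_def)
  qed
  have i: "Inl i \<notin> indices m n" for i using True by simp
  have "f = 0" if f: "f \<in> gharm (indices m n) k" for f
  proof -
    let ?J = "indices m n"
    \<comment> \<open>The lemma is used twice: for R^2 Delta \<open>f\<close>, which has the same
      degree, and then for \<open>f\<close>.\<close>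
    have "rsq ?J * lap ?J f = 0"
      by (rule odd_rsq_lap_zero[OF symplectic_indices i rsq_lap_hpolys[OF symplectic_indices gharm_hpolys[OF f]] _ z])
        (use f in \<open>simp add: gharm_def\<close>)
    then show ?thesis by (rule odd_rsq_lap_zero[OF symplectic_indices i gharm_hpolys[OF f] _ z])
  qed
  then show ?thesis using subspace_0[OF subspace_gharm] by blast
qed

section \<open>Branching\<close>

lemma lookup_mapp':
  assumes "F i 0 = 0"
  shows "Poly_Mapping.lookup (Poly_Mapping.mapp F h) i = F i (Poly_Mapping.lookup h i)"
  using assms by (cases "i \<in> Poly_Mapping.keys h") (auto simp: lookup_mapp in_keys_iff)

lemma lookup_scaleR [simp]: "Poly_Mapping.lookup (c *\<^sub>R h) i = c *\<^sub>R Poly_Mapping.lookup h i"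
  by (simp add: scaleR_poly_mapping.rep_eq)

definition branching_indices :: "int \<Rightarrow> nat \<Rightarrow> nat set" where
  "branching_indices N k = {l. l \<le> k \<and> (\<forall>l'\<in>exceptional_indices N. l' \<le> k \<longrightarrow> int l \<noteq> 2 - N - int l')}"

text \<open>The parity of \<open>k + l\<close> decides whether the component enters the value or the
  normal derivative. In the latter case the datum has degree \<open>k - 1\<close>, and rounding
  turns \<open>(k - l) div 2\<close> into the exponent \<open>(k - 1 - l) / 2\<close>.\<close>

definition branching_emb :: "nat \<Rightarrow> idx set \<Rightarrow> nat \<Rightarrow> nat \<Rightarrow> spoly \<Rightarrow> spoly" where
  "branching_emb i J k l f = ck_ext i J ((k + l) mod 2) k (rsq J ^ ((k - l) div 2) * f)"

definition branching_map :: "nat \<Rightarrow> idx set \<Rightarrow> int \<Rightarrow> nat \<Rightarrow> (nat \<Rightarrow> spoly) \<Rightarrow> spoly" where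
  "branching_map i J N k g = (\<Sum>l\<in>branching_indices N k. branching_emb i J k l (g l))"

lemma finite_branching_indices [simp]: "finite (branching_indices N k)"
  by (rule finite_subset[of _ "{..k}"]) (auto simp: branching_indices_def)

lemma branching_indices_even: "{l \<in> branching_indices N k. even (k + l)} = fischer_indices N k"
  by (auto simp: branching_indices_def fischer_indices_def)

text \<open>\<open>N\<close> is even when exceptional indices exist, so partners have equal parity,
  and the additional exceptional index \<open>Suc k\<close> removes nothing from this parity
  class.\<close>

lemma branching_indices_odd:
  "{l \<in> branching_indices N (Suc k). odd (Suc k + l)} = fischer_indices N k"
proof -
  have odd: "even N" if "l' \<in> exceptional_indices N" for l'
    using that by (auto simp: exceptional_indices_def split: if_splits)
  have "int l \<noteq> 2 - N - int (Suc k)" if "even (k + l)" "Suc k \<in> exceptional_indices N" for l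
    using odd[OF that(2)] that(1) by presburger
  moreover have "l \<le> k" if "l \<le> Suc k" "odd (Suc k + l)" for l using that by presburger
  ultimately show ?thesis
    unfolding branching_indices_def fischer_indices_def by (auto simp: le_Suc_eq)
qed

lemma branching_emb_linear:
  "branching_emb i J k l (f + g) = branching_emb i J k l f + branching_emb i J k l g"
  "branching_emb i J k l (c *\<^sub>R f) = c *\<^sub>R branching_emb i J k l f"
  by (simp_all add: branching_emb_def distrib_left linear_add[OF linear_ck_ext] linear_scale[OF linear_ck_ext])

lemma branching_emb_commute:
  assumes "linear T" "\<And>g. T (var (Inl i) * g) = var (Inl i) * T g" "\<And>g. T (lap J g) = lap J (T g)"
    "\<And>g. T (rsq J * g) = rsq J * T g"
  shows "T (branching_emb i J k l f) = branching_emb i J k l (T f)"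
proof -
  have "T (rsq J ^ j * f) = rsq J ^ j * T f" for j
    by (induction j) (simp_all add: mult.assoc assms(4))
  then show ?thesis by (simp add: branching_emb_def ck_ext_commute[OF assms(1-3)])
qed

lemma branching_map_commute:
  assumes "linear T" "\<And>g. T (var (Inl i) * g) = var (Inl i) * T g" "\<And>g. T (lap J g) = lap J (T g)"
    "\<And>g. T (rsq J * g) = rsq J * T g"
  shows "T (branching_map i J N k g) = branching_map i J N k (\<lambda>l. T (g l))"
  by (simp add: branching_map_def linear_sum[OF assms(1)] branching_emb_commute[OF assms])

locale branching =
  fixes i :: nat and J J' :: "idx set" and N :: int and k :: nat
  assumes J: "symplectic_set J" and i: "Inl i \<in> J" and J'_def: "J' = J - {Inl i}"
    and N: "sdim J' = real_of_int N"
begin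

lemma J': "symplectic_set J'"
  unfolding J'_def by (rule symplectic_remove_Inl[OF J])

lemma map_split:
  "branching_map i J' N k g = ck_ext i J' 0 k (fischer_sum J' N k g)
    + (if k = 0 then 0 else ck_ext i J' 1 k (fischer_sum J' N (k - 1) g))"
proof -
  let ?B = "branching_indices N k"
  have "(\<Sum>l\<in>?B. branching_emb i J' k l (g l))
      = (\<Sum>l\<in>{l\<in>?B. even (k + l)}. branching_emb i J' k l (g l)) + (\<Sum>l\<in>{l\<in>?B. odd (k + l)}. branching_emb i J' k l (g l))"
  proof -
    have "?B = {l\<in>?B. even (k + l)} \<union> {l\<in>?B. odd (k + l)}" by blast
    then show ?thesis
      by (subst (1) \<open>?B = _\<close>, intro sum.union_disjoint) auto
  qed
  moreover have "(\<Sum>l\<in>{l\<in>?B. even (k + l)}. branching_emb i J' k l (g l)) = ck_ext i J' 0 k (fischer_sum J' N k g)"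
    unfolding branching_indices_even fischer_sum_def linear_sum[OF linear_ck_ext]
    by (intro sum.cong refl) (auto simp: branching_emb_def fischer_indices_def)
  moreover have "(\<Sum>l\<in>{l\<in>?B. odd (k + l)}. branching_emb i J' k l (g l))
      = (if k = 0 then 0 else ck_ext i J' 1 k (fischer_sum J' N (k - 1) g))"
  proof (cases k)
    case 0
    then have e: "{l\<in>?B. odd (k + l)} = {}" by (auto simp: branching_indices_def)
    show ?thesis unfolding e using 0 by simp
  next
    case (Suc k')
    have "branching_emb i J' k l (g l) = ck_ext i J' 1 k (rsq J' ^ ((k' - l) div 2) * g l)" if l: "l \<in> fischer_indices N k'" for l
    proof -
      have "(k + l) mod 2 = 1" "(k - l) div 2 = (k' - l) div 2"
        using l by (auto simp: fischer_indices_def Suc Suc_diff_le mod_2_eq_odd)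
      then show ?thesis by (simp add: branching_emb_def)
    qed
    then show ?thesis
      unfolding Suc branching_indices_odd by (simp add: Suc fischer_sum_def linear_sum[OF linear_ck_ext])
  qed
  ultimately show ?thesis by (simp only: branching_map_def)
qed

lemma data_map:
  assumes g: "\<And>l. g l \<in> fischer_comp J' N l"
  shows "branching_map i J' N k g \<in> harm J k"
    "at_zero i (branching_map i J' N k g) = fischer_sum J' N k g"
    "at_zero i (pder (Inl i) (branching_map i J' N k g)) = (if k = 0 then 0 else fischer_sum J' N (k - 1) g)"
proof -
  have d: "fischer_sum J' N d g \<in> hpolys (J - {Inl i}) d" for d
    using fischer_sum_hpolys[OF J' g] by (simp add: J'_def)
  note 0 = ck_ext_harm[OF J i d[of k], of 0 k, folded J'_def]
  have 1: "ck_ext i J' 1 k (fischer_sum J' N (k - 1) g) \<in> harm J k" if "k \<noteq> 0"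
    using ck_ext_harm(1)[OF J i d[of "k - 1"], of 1 k, folded J'_def] that by simp
  note 2 = ck_ext_harm(2,3)[OF J i d[of "k - 1"], of 1 k, folded J'_def]
  show "branching_map i J' N k g \<in> harm J k"
    unfolding map_split using 0(1) 1 by (auto intro: subspace_add[OF subspace_harm])
  show "at_zero i (branching_map i J' N k g) = fischer_sum J' N k g"
    unfolding map_split using 0(2) 2(1) by simp
  show "at_zero i (pder (Inl i) (branching_map i J' N k g)) = (if k = 0 then 0 else fischer_sum J' N (k - 1) g)"
    unfolding map_split using 0(3) 2(2) by simp
qed

lemma map_surj:
  assumes f: "f \<in> harm J k"
  obtains g where "\<And>l. g l \<in> fischer_comp J' N l" "f = branching_map i J' N k g"
proof -
  note F = fischer_decomposition[OF J' N]
  have "at_zero i f \<in> hpolys J' k"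
    using at_zero_hpolys[OF harm_hpolys[OF f], of i] by (simp add: J'_def)
  then obtain g0 where g0: "\<And>l. g0 l \<in> fischer_comp J' N l" "at_zero i f = fischer_sum J' N k g0"
    using F[of k] by blast
  have "\<exists>g1. (\<forall>l. g1 l \<in> fischer_comp J' N l) \<and>
      at_zero i (pder (Inl i) f) = (if k = 0 then 0 else fischer_sum J' N (k - 1) g1)"
  proof (cases k)
    case 0
    then show ?thesis
      using pder_hpolys_0[of f J "Inl i"] harm_hpolys[OF f] subspace_0[OF subspace_fischer_comp]
      by (intro exI[of _ "\<lambda>_. 0"]) simp
  next
    case (Suc k')
    have "at_zero i (pder (Inl i) f) \<in> hpolys J' k'"
      using at_zero_hpolys[OF pder_hpolys_Suc, of f J k' i "Inl i"] harm_hpolys[OF f] by (simp add: J'_def Suc)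
    then show ?thesis using F[of k'] Suc by auto
  qed
  then obtain g1 where g1: "\<And>l. g1 l \<in> fischer_comp J' N l"
    "at_zero i (pder (Inl i) f) = (if k = 0 then 0 else fischer_sum J' N (k - 1) g1)" by blast
  \<comment> \<open>The two data have degrees of opposite parity, so their Fischer components have
    disjoint index sets and fit into one family.\<close>
  define g where "g l = (if even (k + l) then g0 l else g1 l)" for l
  have g: "g l \<in> fischer_comp J' N l" for l using g0(1) g1(1) by (simp add: g_def)
  have "fischer_sum J' N k g = fischer_sum J' N k g0"
    by (rule fischer_sum_cong) (auto simp: g_def fischer_indices_def)
  moreover have "fischer_sum J' N (k - 1) g = fischer_sum J' N (k - 1) g1" if "k \<noteq> 0"
    by (rule fischer_sum_cong) (use that in \<open>auto simp: g_def fischer_indices_def\<close>)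
  ultimately have "f = branching_map i J' N k g"
    using g0(2) g1(2) by (intro harm_eqI[OF J i f data_map(1)[OF g]]) (auto simp: data_map[OF g])
  then show thesis using that g by blast
qed

lemma map_inj:
  assumes g: "\<And>l. g l \<in> fischer_comp J' N l" and z: "branching_map i J' N k g = 0"
    and l: "l \<in> branching_indices N k"
  shows "g l = 0"
proof -
  have F: "g l = 0" if "fischer_sum J' N d g = 0" "l \<in> fischer_indices N d" for d
    using fischer_decomposition[OF J' N, of d] g that by blast
  show ?thesis
  proof (cases "even (k + l)")
    case True
    then have "l \<in> fischer_indices N k" using l branching_indices_even[of N k] by blast
    then show ?thesis using F[of k] data_map(2)[OF g] z by simp
  next
    case False
    have "l \<le> k" using l by (simp add: branching_indices_def)
    then have "k \<noteq> 0" using False by (cases k) auto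
    then obtain k' where k: "k = Suc k'" by (cases k) auto
    then have "l \<in> fischer_indices N k'" using l False branching_indices_odd[of N k'] by blast
    then show ?thesis using F[of k'] data_map(3)[OF g] z k by simp
  qed
qed

end

lemma superdim_pred: "1 \<le> m \<Longrightarrow> superdim (m - 1) n = superdim m n - 1"
  by (simp add: superdim_def)

text \<open>Exceptional indices are at least 2 - N/2, so their partners are at most - N/2.\<close>

lemma exceptional_partner:
  "l \<in> exceptional_indices N \<Longrightarrow> l' \<in> exceptional_indices N \<Longrightarrow> int l \<noteq> 2 - N - int l'"
  by (auto simp: exceptional_indices_def split: if_splits)

lemma branching_indices_eq:
  "branching_indices (M - 1) k = B_gen M k \<union> B_simple M k" "B_gen M k \<inter> B_simple M k = {}"
  "l \<in> B_gen M k \<Longrightarrow> l \<in> exceptional_indices (M - 1)"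
  "l \<in> B_simple M k \<Longrightarrow> l \<notin> exceptional_indices (M - 1)"
proof -
  have p: "int l \<in> B_partner M k \<longleftrightarrow> (\<exists>l'\<in>exceptional_indices (M - 1). l' \<le> k \<and> int l = 2 - (M - 1) - int l')" for l
    by (auto simp: B_partner_def B_gen_def)
  show "branching_indices (M - 1) k = B_gen M k \<union> B_simple M k"
    using exceptional_partner[of _ "M - 1"]
    unfolding branching_indices_def B_simple_def p by (auto simp: B_gen_def)
  show "B_gen M k \<inter> B_simple M k = {}" by (auto simp: B_simple_def)
  show "l \<in> B_gen M k \<Longrightarrow> l \<in> exceptional_indices (M - 1)" by (simp add: B_gen_def)
  show "l \<in> B_simple M k \<Longrightarrow> l \<notin> exceptional_indices (M - 1)"
    by (simp add: B_simple_def B_gen_def)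
qed

lemma spherical_harmonics_eq: "spherical_harmonics m n k = harm (indices m n) k"
  and gen_spherical_harmonics_eq: "gen_spherical_harmonics m n k = gharm (indices m n) k"
  by (simp_all add: spherical_harmonics_def gen_spherical_harmonics_def harm_def gharm_def
      homogeneous_eq laplacian_eq radius_sq_eq)

section \<open>From rotations to modules over the orthosymplectic algebra\<close>

lemma indecomposable_rot:
  assumes V: "V \<subseteq> polys (indices m n)" and sub: "submodule (osp m n) (natural_module V) V"
    and ind: "rot_indecomposable (indices m n) V"
  shows "V = {0} \<or> indecomposable (osp m n) (natural_module V)"
proof -
  have st: "rot_stable (indices m n) U" if U: "submodule (osp m n) (natural_module V) U" for U
  proof -
    have "rot a b u \<in> U" if ab: "a \<in> indices m n" "b \<in> indices m n" and u: "u \<in> U" for a b u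
    proof -
      have "u \<in> polys (indices m n)" using U V u by (auto simp: submodule_def natural_module_def)
      moreover have "\<forall>D\<in>osp m n. \<forall>u\<in>U. D u \<in> U"
        using U by (simp add: submodule_def natural_module_def)
      then have "restrict (rot a b) (polys (indices m n)) u \<in> U"
        using u rot_osp[OF ab] by blast
      ultimately show ?thesis by simp
    qed
    then show ?thesis using U by (auto simp: rot_stable_def submodule_def)
  qed
  show ?thesis
    unfolding indecomposable_def
    using ind st sub unfolding rot_indecomposable_def by (auto simp: natural_module_def)
qed

lemma osp_rot_combination:
  assumes D: "D \<in> osp m n"
  obtains c where "\<And>f. f \<in> polys (indices m n) \<Longrightarrow> D f = (\<Sum>a\<in>indices m n. \<Sum>b\<in>indices m n. c a b *\<^sub>R rot a b f)"
    "\<And>f. f \<in> polys (indices (Suc m) n) \<Longrightarrow>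
      extension (Suc m) n D f = (\<Sum>a\<in>indices m n. \<Sum>b\<in>indices m n. c a b *\<^sub>R rot a b f)"
proof -
  obtain c where "\<And>f. (\<Sum>a\<in>indices m n. D (var a) * pder a f)
      = (\<Sum>a\<in>indices m n. \<Sum>b\<in>indices m n. c a b *\<^sub>R rot a b f)" by (rule osp_rot[OF D]) blast
  then show thesis
    using that[of c] osp_formula[OF D] extension_formula[of D "Suc m" n] D by simp
qed

lemma module_fields [simp]:
  "module_carrier (natural_module V) = V" "parity_part (natural_module V) = super_part"
  "module_action (natural_module V) D = D"
  "module_carrier (restricted_module m n V) = V" "parity_part (restricted_module m n V) = super_part"
  "module_action (restricted_module m n V) D = extension m n D"
  by (simp_all add: natural_module_def restricted_module_def)

lemma grading_hpolys: "f \<in> hpolys J k \<Longrightarrow> grading f \<in> hpolys J k"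
proof -
  have "supp (grading f) = supp f" by (auto simp: supp_iff coeff_grading)
  then show "f \<in> hpolys J k \<Longrightarrow> grading f \<in> hpolys J k" by (simp add: hpolys_def)
qed

lemma grading_harm: "f \<in> harm J k \<Longrightarrow> grading f \<in> harm J k"
  and grading_gharm: "f \<in> gharm J k \<Longrightarrow> grading f \<in> gharm J k"
  using grading_hpolys grading_lap[symmetric] grading_rsq[symmetric]
  by (auto simp: harm_def gharm_def)

theorem theorem2:
  fixes m n k :: nat
  assumes "m \<ge> 1"
  defines "M \<equiv> superdim m n"
  shows "indecomposable_decomposition (osp (m - 1) n)
    (restricted_module m n (spherical_harmonics m n k))
    (B_gen M k <+> B_simple M k)
    (case_sum (\<lambda>l. natural_module (gen_spherical_harmonics (m - 1) n l))
              (\<lambda>l. natural_module (spherical_harmonics (m - 1) n l)))"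
proof -
  define G where "G = osp (m - 1) n"
  define J where "J = indices m n"
  define J' where "J' = indices (m - 1) n"
  define I where "I = B_gen M k <+> B_simple M k"
  define N :: "nat + nat \<Rightarrow> (spoly \<Rightarrow> spoly, spoly) smodule" where
    "N = case_sum (\<lambda>l. natural_module (gen_spherical_harmonics (m - 1) n l))
              (\<lambda>l. natural_module (spherical_harmonics (m - 1) n l))"
  define V where "V = case_sum (gharm J') (harm J')"
  define C where "C = {h. Poly_Mapping.keys h \<subseteq> I \<and> (\<forall>i\<in>I. Poly_Mapping.lookup h i \<in> V i)}"
  have Nf: "module_carrier (N i) = V i" "parity_part (N i) = super_part" "module_action (N i) D = D" for i D
    by (cases i; simp add: N_def V_def spherical_harmonics_eq gen_spherical_harmonics_eq J'_def)+
  have DS: "module_carrier (direct_sum I N) = C"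
    "parity_part (direct_sum I N) p = {h. \<forall>i\<in>I. Poly_Mapping.lookup h i \<in> super_part p}"
    "module_action (direct_sum I N) D = Poly_Mapping.mapp (\<lambda>i. D)" for p D
    by (simp_all add: direct_sum_def C_def Nf)
  have J': "symplectic_set J'" by (simp add: J'_def symplectic_indices)
  have "{1..m} = insert m {1..m - 1}" using assms(1) by auto
  then have JJ: "J' = J - {Inl m}" "J' \<subseteq> J" "Inl m \<in> J" "Inl m \<notin> J'"
    using assms(1) by (auto simp: J_def J'_def indices_def)
  have sd: "sdim J' = real_of_int (M - 1)"
    using superdim_pred[OF assms(1)] by (simp add: J'_def sdim_indices M_def)
  interpret br: branching m J J' "M - 1" k
    by unfold_locales (use JJ sd symplectic_indices in \<open>auto simp: J_def\<close>)
  have subV: "subspace (V i)" for i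
    by (cases i) (simp_all add: V_def subspace_harm subspace_gharm)
  have Vp: "V i \<subseteq> polys J'" for i
    by (cases i) (auto simp: V_def dest: harm_hpolys gharm_hpolys hpolys_polys)
  have Vg: "v \<in> V i \<Longrightarrow> grading v \<in> V i" for i v
    by (cases i) (simp_all add: V_def grading_harm grading_gharm)

  \<comment> \<open>\<open>D\<close> and its extension are only specified on their domains;
    \<open>T\<close> is one linear operator on all superpolynomials that agrees with both and
    satisfies the commutation rules globally.\<close>
  have comb: "\<exists>T. linear T \<and> (\<forall>f\<in>polys J'. D f = T f) \<and> (\<forall>f\<in>polys J. extension m n D f = T f) \<and>
      (\<forall>g. T (var (Inl m) * g) = var (Inl m) * T g) \<and> (\<forall>g. T (lap J' g) = lap J' (T g)) \<and>
      (\<forall>g. T (rsq J' * g) = rsq J' * T g) \<and> (\<forall>i. \<forall>v\<in>V i. T v \<in> V i) \<and> (\<forall>v\<in>harm J k. T v \<in> harm J k)"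
    if D: "D \<in> G" for D
  proof -
    obtain c where c: "\<And>f. f \<in> polys J' \<Longrightarrow> D f = (\<Sum>a\<in>J'. \<Sum>b\<in>J'. c a b *\<^sub>R rot a b f)"
      "\<And>f. f \<in> polys J \<Longrightarrow> extension m n D f = (\<Sum>a\<in>J'. \<Sum>b\<in>J'. c a b *\<^sub>R rot a b f)"
      using osp_rot_combination[of D "m - 1" n] D assms(1) unfolding J_def J'_def G_def by auto
    define T where "T f = (\<Sum>a\<in>J'. \<Sum>b\<in>J'. c a b *\<^sub>R rot a b f)" for f
    have "linear T"
      unfolding T_def by (intro linear_compose_sum ballI linear_compose_scale_right linear_rot)
    moreover have "T (var (Inl m) * g) = var (Inl m) * T g" for g
    proof -
      have "rot a b (var (Inl m) * g) = var (Inl m) * rot a b g" if "a \<in> J'" "b \<in> J'" for a b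
        using rot_var[of "Inl m" a b g] that JJ(4) by (metis dual_Inl(4) scaleR_one sg_simps(4) mult_1)
      then show ?thesis by (simp add: T_def sum_distrib_left)
    qed
    moreover have "T (lap J' g) = lap J' (T g)" for g
      by (simp add: T_def rot_lap[OF J'])
    moreover have "T (rsq J' * g) = rsq J' * T g" for g
      by (simp add: T_def rot_rsq[OF J'] sum_distrib_left)
    moreover have "T v \<in> V i" if "v \<in> V i" for v i
    proof -
      have "rot a b v \<in> V i" if "a \<in> J'" "b \<in> J'" for a b
        using rot_harm[OF J' that] \<open>v \<in> V i\<close> by (cases i) (auto simp: V_def)
      then show ?thesis unfolding T_def by (intro subspace_sum subspace_scale subV)
    qed
    moreover have "T v \<in> harm J k" if "v \<in> harm J k" for v
      unfolding T_def using rot_harm(1)[OF br.J _ _ that] JJ(2)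
      by (intro subspace_sum subspace_scale subspace_harm) blast
    ultimately show ?thesis using c unfolding T_def[symmetric] by (intro exI[of _ T]) blast
  qed

  \<comment> \<open>The two index sets of the statement are disjoint, so \<open>\<iota>\<close>
    identifies their tagged sum with \<open>branching_indices\<close>.\<close>
  define \<iota> where "\<iota> l = (if l \<in> B_gen M k then Inl l else Inr l :: nat + nat)" for l
  define \<Psi> where "\<Psi> h = branching_map m J' (M - 1) k (\<lambda>l. Poly_Mapping.lookup h (\<iota> l))" for h
  note B = branching_indices_eq[where M = M and k = k]
  have I: "I = \<iota> ` branching_indices (M - 1) k"
    unfolding B(1) I_def \<iota>_def using B(2) by (auto simp: Plus_def image_iff)
  have I\<iota>: "l \<in> branching_indices (M - 1) k \<Longrightarrow> \<iota> l \<in> I" for l by (simp add: I)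
  have finI: "finite I" by (simp add: I)
  have comp: "V (\<iota> l) = fischer_comp J' (M - 1) l" if "l \<in> branching_indices (M - 1) k" for l
    using that B(3)[of l] B(4)[of l] unfolding B(1) by (auto simp: \<iota>_def V_def fischer_comp_def)
  have \<Psi>_cong: "\<Psi> h = branching_map m J' (M - 1) k g"
    if "\<And>l. l \<in> branching_indices (M - 1) k \<Longrightarrow> Poly_Mapping.lookup h (\<iota> l) = g l" for h g
    using that by (simp add: \<Psi>_def branching_map_def)
  have lin: "\<Psi> (h + h') = \<Psi> h + \<Psi> h'" "\<Psi> (c *\<^sub>R h) = c *\<^sub>R \<Psi> h" for h h' c
    by (simp_all add: \<Psi>_def branching_map_def lookup_add branching_emb_linear sum.distrib scaleR_sum_right)
  have lin': "\<Psi> (h - h') = \<Psi> h - \<Psi> h'" for h h' using lin(1)[of "h - h'" h'] by simp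
  have zeroV: "0 \<in> V i" for i using subspace_0[OF subV] .
  have subC: "subspace C"
  proof -
    have "Poly_Mapping.keys h \<subseteq> I \<longleftrightarrow> (\<forall>i. i \<notin> I \<longrightarrow> Poly_Mapping.lookup h i = 0)" for h :: "nat + nat \<Rightarrow>\<^sub>0 spoly"
      by (auto simp: in_keys_iff)
    then show ?thesis
      unfolding subspace_def C_def using subV[THEN subspace_add] subV[THEN subspace_scale] zeroV
      by (simp add: lookup_add)
  qed
  \<comment> \<open>The branching lemmas require a component for every degree; outside the index set
    0 is taken.\<close>
  have ext: "\<exists>g. (\<forall>l. g l \<in> fischer_comp J' (M - 1) l) \<and> \<Psi> h = branching_map m J' (M - 1) k g \<and>
      (\<forall>l\<in>branching_indices (M - 1) k. g l = Poly_Mapping.lookup h (\<iota> l))" if "h \<in> C" for h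
  proof (intro exI[of _ "\<lambda>l. if l \<in> branching_indices (M - 1) k then Poly_Mapping.lookup h (\<iota> l) else 0"] conjI)
    show "\<forall>l. (if l \<in> branching_indices (M - 1) k then Poly_Mapping.lookup h (\<iota> l) else 0) \<in> fischer_comp J' (M - 1) l"
    proof
      fix l
      have "Poly_Mapping.lookup h (\<iota> l) \<in> fischer_comp J' (M - 1) l" if "l \<in> branching_indices (M - 1) k"
        using \<open>h \<in> C\<close> I\<iota>[OF that] unfolding C_def comp[OF that, symmetric] by blast
      then show "(if l \<in> branching_indices (M - 1) k then Poly_Mapping.lookup h (\<iota> l) else 0) \<in> fischer_comp J' (M - 1) l"
        by (simp add: subspace_0[OF subspace_fischer_comp])
    qed
  qed (auto intro: \<Psi>_cong)
  have \<Psi>0: "h = 0" if h: "h \<in> C" "\<Psi> h = 0" for h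
  proof -
    obtain g where g: "\<And>l. g l \<in> fischer_comp J' (M - 1) l" "\<Psi> h = branching_map m J' (M - 1) k g"
      "\<And>l. l \<in> branching_indices (M - 1) k \<Longrightarrow> g l = Poly_Mapping.lookup h (\<iota> l)"
      using ext[OF h(1)] by blast
    have "branching_map m J' (M - 1) k g = 0" using g(2) h(2) by simp
    then have "Poly_Mapping.lookup h (\<iota> l) = 0" if "l \<in> branching_indices (M - 1) k" for l
      using br.map_inj[OF g(1) _ that] g(3)[OF that] by simp
    then have "Poly_Mapping.lookup h i = 0" if "i \<in> I" for i
      using that unfolding I by blast
    then have "Poly_Mapping.lookup h i = 0" for i
      using h(1) by (cases "i \<in> I") (auto simp: C_def in_keys_iff subset_iff)
    then show ?thesis by (intro poly_mapping_eqI) simp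
  qed
  have inj: "inj_on \<Psi> C"
  proof (rule inj_onI)
    fix h h' assume h: "h \<in> C" "h' \<in> C" "\<Psi> h = \<Psi> h'"
    have "h - h' = 0" by (rule \<Psi>0) (use h subspace_diff[OF subC] lin' in auto)
    then show "h = h'" by simp
  qed
  have img: "\<Psi> ` C = harm J k"
  proof (intro equalityI subsetI)
    fix f assume "f \<in> \<Psi> ` C"
    then obtain h where "h \<in> C" "f = \<Psi> h" by blast
    then show "f \<in> harm J k" using ext[of h] br.data_map(1) by metis
  next
    fix f assume "f \<in> harm J k"
    then obtain g where g: "\<And>l. g l \<in> fischer_comp J' (M - 1) l" "f = branching_map m J' (M - 1) k g"
      using br.map_surj by blast
    define h where "h = Abs_poly_mapping (\<lambda>i. if i \<in> I then g (case_sum id id i) else 0)"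
    have "finite {i. (if i \<in> I then g (case_sum id id i) else 0) \<noteq> 0}"
      by (rule finite_subset[OF _ finI]) auto
    then have h: "Poly_Mapping.lookup h i = (if i \<in> I then g (case_sum id id i) else 0)" for i
      by (simp add: h_def)
    have \<iota>: "case_sum id id (\<iota> l) = l" for l by (simp add: \<iota>_def)
    have "Poly_Mapping.lookup h i \<in> V i" if i: "i \<in> I" for i
    proof -
      obtain l where l: "l \<in> branching_indices (M - 1) k" "i = \<iota> l" using i unfolding I by blast
      then show ?thesis using i g(1)[of l] comp[OF l(1)] by (simp add: h \<iota>)
    qed
    moreover have "Poly_Mapping.keys h \<subseteq> I"
      by (rule subsetI) (simp add: in_keys_iff h split: if_splits)
    ultimately have "h \<in> C" by (simp add: C_def)
    moreover have "\<Psi> h = f" unfolding g(2) by (rule \<Psi>_cong) (simp add: h I\<iota> \<iota>)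
    ultimately show "f \<in> \<Psi> ` C" by blast
  qed

  \<comment> \<open>Stated for general operators because it serves twice: for elements of the
    algebra, where \<open>T\<close> is known on \<open>polys J'\<close> only, and for the parity
    automorphism.\<close>
  have mapp_C: "Poly_Mapping.mapp (\<lambda>i. T) h \<in> C" "\<Psi> (Poly_Mapping.mapp (\<lambda>i. T) h) = S (\<Psi> h)"
    if h: "h \<in> C" and S: "linear S" "\<And>g. S (var (Inl m) * g) = var (Inl m) * S g"
      "\<And>g. S (lap J' g) = lap J' (S g)" "\<And>g. S (rsq J' * g) = rsq J' * S g" "\<And>i v. v \<in> V i \<Longrightarrow> S v \<in> V i"
      and T: "\<And>f. f \<in> polys J' \<Longrightarrow> T f = S f" for h S T
  proof -
    have l: "Poly_Mapping.lookup (Poly_Mapping.mapp (\<lambda>i. T) h) i = S (Poly_Mapping.lookup h i)" for i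
    proof (cases "i \<in> Poly_Mapping.keys h")
      case True
      then have "i \<in> I" "Poly_Mapping.lookup h i \<in> V i" using h unfolding C_def by blast+
      then have "Poly_Mapping.lookup h i \<in> polys J'" using Vp by blast
      then show ?thesis using True T by (simp add: lookup_mapp)
    next
      case False
      then show ?thesis by (simp add: lookup_mapp in_keys_iff linear_0[OF S(1)])
    qed
    have "Poly_Mapping.keys (Poly_Mapping.mapp (\<lambda>i. T) h) \<subseteq> I"
      using subset_trans[OF keys_mapp_subset[of "\<lambda>i. T" h]] h unfolding C_def by simp
    then show "Poly_Mapping.mapp (\<lambda>i. T) h \<in> C" using h S(5) by (simp add: C_def l)
    show "\<Psi> (Poly_Mapping.mapp (\<lambda>i. T) h) = S (\<Psi> h)"
      by (simp add: \<Psi>_def l branching_map_commute[OF S(1-4)])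
  qed
  have act: "Poly_Mapping.mapp (\<lambda>i. D) h \<in> C \<and> \<Psi> (Poly_Mapping.mapp (\<lambda>i. D) h) = extension m n D (\<Psi> h)"
    if D: "D \<in> G" and h: "h \<in> C" for D h
  proof -
    obtain T where T: "linear T" "\<forall>f\<in>polys J'. D f = T f" "\<forall>f\<in>polys J. extension m n D f = T f"
      "\<forall>g. T (var (Inl m) * g) = var (Inl m) * T g" "\<forall>g. T (lap J' g) = lap J' (T g)"
      "\<forall>g. T (rsq J' * g) = rsq J' * T g" "\<forall>i. \<forall>v\<in>V i. T v \<in> V i"
      using comb[OF D] by blast
    have "\<Psi> h \<in> polys J" using img h harm_hpolys hpolys_polys by blast
    then show ?thesis using mapp_C[OF h, of T D] T by simp
  qed

  define \<phi> where "\<phi> = inv_into C \<Psi>"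
  have \<phi>: "\<phi> f \<in> C" "\<Psi> (\<phi> f) = f" if "f \<in> harm J k" for f
    using that inv_into_into[of f \<Psi> C] f_inv_into_f[of f \<Psi> C] unfolding img[symmetric] \<phi>_def by auto
  have \<phi>I: "\<phi> f = h" if "h \<in> C" "\<Psi> h = f" for f h
    using that inv_into_f_eq[OF inj] by (simp add: \<phi>_def)
  have sub1: "submodule G (restricted_module m n (harm J k)) (harm J k)"
    unfolding submodule_def using subspace_harm comb harm_hpolys[THEN hpolys_polys] by fastforce
  have sub2: "submodule G (direct_sum I N) C"
    unfolding submodule_def DS using subC act by auto
  have "module_iso G (restricted_module m n (harm J k)) (direct_sum I N) \<phi>"
    unfolding module_iso_def module_fields DS
  proof (intro conjI allI ballI sub1 sub2)
    show "bij_betw \<phi> (harm J k) C"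
      unfolding \<phi>_def img[symmetric] by (intro bij_betw_inv_into inj_on_imp_bij_betw inj)
    show "linear_on (harm J k) \<phi>"
      unfolding linear_on_def
      using \<phi> lin subspace_add[OF subC] subspace_scale[OF subC] by (auto intro!: \<phi>I)
    show "\<phi> \<in> harm J k \<inter> super_part p \<rightarrow> {h. \<forall>i\<in>I. Poly_Mapping.lookup h i \<in> super_part p}" for p
    proof (intro funcsetI CollectI ballI)
      fix f i assume f: "f \<in> harm J k \<inter> super_part p" and i: "i \<in> I"
      \<comment> \<open>Parity is preserved because \<open>\<Psi>\<close> intertwines the gradings:
        by injectivity, the preimage of an eigenvector of \<open>grading\<close> is one for the same
        eigenvalue.\<close>
      have g: "grading (var (Inl m) * g) = var (Inl m) * grading g" for g
        by (simp add: grading_mult grading_var)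
      note M = mapp_C[OF \<phi>(1) linear_grading g grading_lap grading_rsq Vg refl, of f]
      have "\<Psi> (Poly_Mapping.mapp (\<lambda>i. grading) (\<phi> f)) = \<Psi> ((- 1) ^ p *\<^sub>R \<phi> f)"
        using f \<phi>(2)[of f] by (simp add: M lin super_part_grading)
      then have "Poly_Mapping.mapp (\<lambda>i. grading) (\<phi> f) = (- 1) ^ p *\<^sub>R \<phi> f"
        using inj_onD[OF inj] M(1) f \<phi>(1)[of f] subspace_scale[OF subC] by blast
      from arg_cong[OF this, of "\<lambda>h. Poly_Mapping.lookup h i"]
      show "Poly_Mapping.lookup (\<phi> f) i \<in> super_part p"
        by (simp add: super_part_grading lookup_mapp')
    qed
    show "\<phi> (extension m n D f) = Poly_Mapping.mapp (\<lambda>i. D) (\<phi> f)" if "D \<in> G" "f \<in> harm J k" for D f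
      using act[OF that(1) \<phi>(1)[OF that(2)]] \<phi>(2)[OF that(2)] by (intro \<phi>I) simp_all
  qed
  moreover have "module_carrier (N i) = {0} \<or> indecomposable G (N i)" if i: "i \<in> I" for i
  proof -
    have N: "N i = natural_module (V i)"
      by (cases i) (simp_all add: N_def V_def spherical_harmonics_eq gen_spherical_harmonics_eq J'_def)
    have "submodule G (natural_module (V i)) (V i)"
      unfolding submodule_def using subV comb Vp by (auto, metis subsetD)
    moreover have "V i = {0} \<or> rot_indecomposable J' (V i)"
    proof (cases i)
      case (Inl l)
      then have "l \<in> exceptional_indices (superdim (m - 1) n)"
        using i B(3) superdim_pred[OF assms(1)] by (auto simp: I_def M_def)
      then show ?thesis using gharm_indecomposable_or_zero Inl by (simp add: V_def J'_def)
    next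
      case (Inr l)
      then show ?thesis using harm_indecomposable by (simp add: V_def J'_def)
    qed
    ultimately show ?thesis
      using indecomposable_rot[of "V i" "m - 1" n] Vp unfolding N G_def J'_def by auto
  qed
  ultimately have "indecomposable_decomposition G (restricted_module m n (harm J k)) I N"
    unfolding indecomposable_decomposition_def by blast
  then show ?thesis by (simp add: G_def I_def N_def spherical_harmonics_eq J_def)
qed

end
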